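(* Let $a,c$ be real numbers with $0<a<1<c$ and $c\notin\mathbb N$. Put $$x_1=\max\Big(\frac{a+\langle c\rangle-1}a,0\Big),\qquad x_2=\min\Big(\frac{\langle c\rangle}a,1\Big),$$ and $\alpha=\big\langle\frac{\lfloor c\rfloor}a\big\rangle$ if $x_2\ne1$, $\alpha=\big\langle\frac ca\big\rangle$ if $x_2=1$. Let $\mathcal{E}$ be the symmetric maximal invariant set of the transformation $\mathcal{M}=\mathcal{M}_{\alpha,x_1,x_2}$ defined in the context. Then the Gabor system $\mathcal{G}(H_c;a)=\{e^{-2\pi i m x}H_c(x-na):m,n\in\mathbb Z\}$, where $H_c=-\chi_{[-c,0)}+\chi_{[0,c)}$, is a frame for $L^2(\mathbb R)$ if and only if $\mathcal{E}=\emptyset$.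
   Context: $\lfloor x\rfloor$ is the greatest integer $\le x$, $\langle x\rangle=x-\lfloor x\rfloor$ and $\langle x\rangle^\ast=1-\langle1-x\rangle\in(0,1]$. For $0\le\alpha<1$ and $0\le x_1<x_2\le 1$ put $U=[0,x_1)$, $\mathbf H=[x_1,x_2)$, $V=[x_2,1)$ and $\widetilde U=(0,x_1]$, $\widetilde{\mathbf H}=(x_1,x_2]$, $\widetilde V=(x_2,1]$. The map $\mathcal{M}=\mathcal{M}_{\alpha,x_1,x_2}:[0,1)\to[0,1)$ is $\mathcal{M}(t)=\langle t+\alpha+x_2-x_1\rangle$ for $t\in U$, $\mathcal{M}(t)=t$ for $t\in\mathbf H$, $\mathcal{M}(t)=\langle t+\alpha\rangle$ for $t\in V$. Its coherent map $\widetilde{\mathcal M}:(0,1]\to(0,1]$ is $\widetilde{\mathcal M}(t)=\langle t+\alpha+x_2-x_1\rangle^\ast$ for $t\in\widetilde U$, $\widetilde{\mathcal M}(t)=t$ for $t\in\widetilde{\mathbf H}$, $\widetilde{\mathcal M}(t)=\langle t+\alpha\rangle^\ast$ for $t\in\widetilde V$. The symmetric maximal invariant set $\mathcal{E}$ of $\mathcal{M}$ is the largest set $\mathcal{E}\subset[0,1)\setminus\big(\mathbf H\cup(1-\widetilde{\mathbf H})\big)$ with $\mathcal{M}(\mathcal{E})=\mathcal{E}$ and $\widetilde{\mathcal M}(1-\mathcal{E})=1-\mathcal{E}$, where $1-E=\{1-t:t\in E\}$. A countable system $\{g_k\}$ is a frame for $L^2(\mathbb R)$ if there are constants $A,B>0$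 with $A\|f\|_2^2\le\sum_k|\langle f,g_k\rangle|^2\le B\|f\|_2^2$ for all $f\in L^2(\mathbb R)$. *)

theory Defs
  imports "HOL-Analysis.Analysis"
begin

section \<open>Frames for $L^2$ of the real line\<close>

text \<open>Elements of $L^2$ are represented by functions rather than by classes modulo null sets;
  the norm and the inner product below do not depend on the representative.\<close>

definition L2 :: "(real \<Rightarrow> complex) set" where
  "L2 = {f \<in> borel_measurable lborel. integrable lborel (\<lambda>x. (cmod (f x))\<^sup>2)}"

definition L2_inner :: "(real \<Rightarrow> complex) \<Rightarrow> (real \<Rightarrow> complex) \<Rightarrow> complex" where
  "L2_inner f g = (\<integral>x. f x * cnj (g x) \<partial>lborel)"

definition L2_norm :: "(real \<Rightarrow> complex) \<Rightarrow> real" where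
  "L2_norm f = sqrt (\<integral>x. (cmod (f x))\<^sup>2 \<partial>lborel)"

text \<open>Summability is required explicitly because \<^const>\<open>infsum\<close> is 0 on families that are not
  summable.\<close>

definition is_frame :: "'i set \<Rightarrow> ('i \<Rightarrow> real \<Rightarrow> complex) \<Rightarrow> bool" where
  "is_frame K g \<longleftrightarrow> countable K \<and> (\<forall>k\<in>K. g k \<in> L2) \<and>
     (\<exists>A B. A > 0 \<and> B > 0 \<and>
       (\<forall>f\<in>L2.
          (\<lambda>k. (cmod (L2_inner f (g k)))\<^sup>2) summable_on K \<and>
          A * (L2_norm f)\<^sup>2 \<le> (\<Sum>\<^sub>\<infinity>k\<in>K. (cmod (L2_inner f (g k)))\<^sup>2) \<and>
          (\<Sum>\<^sub>\<infinity>k\<in>K. (cmod (L2_inner f (g k)))\<^sup>2) \<le> B * (L2_norm f)\<^sup>2))"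

section \<open>The Gabor system\<close>

definition haar_window :: "real \<Rightarrow> real \<Rightarrow> complex" where
  "haar_window c x = - indicator {-c..<0} x + indicator {0..<c} x"

definition gabor_system :: "(real \<Rightarrow> complex) \<Rightarrow> real \<Rightarrow> int \<times> int \<Rightarrow> real \<Rightarrow> complex" where
  "gabor_system g a = (\<lambda>(m, n) x.
     exp (- 2 * of_real pi * \<i> * of_int m * of_real x) * g (x - of_int n * a))"

section \<open>The transformations and the symmetric maximal invariant set\<close>

definition frac_star :: "real \<Rightarrow> real" where
  "frac_star x = 1 - frac (1 - x)"

text \<open>The maps below are meant on $[0,1)$ and $(0,1]$ respectively; their values elsewhere are
  irrelevant. The last branch is then the case $t \in [x_2,1)$, respectively $t \in (x_2,1]$.\<close>

definition Mmap :: "real \<Rightarrow> real \<Rightarrow> real \<Rightarrow> real \<Rightarrow> real" where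
  "Mmap \<alpha> x1 x2 t =
     (if t \<in> {0..<x1} then frac (t + \<alpha> + x2 - x1)
      else if t \<in> {x1..<x2} then t
      else frac (t + \<alpha>))"

definition Mmap_coherent :: "real \<Rightarrow> real \<Rightarrow> real \<Rightarrow> real \<Rightarrow> real" where
  "Mmap_coherent \<alpha> x1 x2 t =
     (if t \<in> {0<..x1} then frac_star (t + \<alpha> + x2 - x1)
      else if t \<in> {x1<..x2} then t
      else frac_star (t + \<alpha>))"

definition reflect :: "real set \<Rightarrow> real set" where
  "reflect E = (\<lambda>t. 1 - t) ` E"

definition sym_invariant :: "real \<Rightarrow> real \<Rightarrow> real \<Rightarrow> real set \<Rightarrow> bool" where
  "sym_invariant \<alpha> x1 x2 E \<longleftrightarrow>
     E \<subseteq> {0..<1} - ({x1..<x2} \<union> reflect {x1<..x2}) \<and>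
     Mmap \<alpha> x1 x2 ` E = E \<and>
     Mmap_coherent \<alpha> x1 x2 ` reflect E = reflect E"

definition sym_max_invariant_set :: "real \<Rightarrow> real \<Rightarrow> real \<Rightarrow> real set" where
  "sym_max_invariant_set \<alpha> x1 x2 = \<Union> {E. sym_invariant \<alpha> x1 x2 E}"

text \<open>The union is itself symmetric invariant, so it is the largest such set.\<close>

lemma sym_invariant_sym_max_invariant_set:
  "sym_invariant \<alpha> x1 x2 (sym_max_invariant_set \<alpha> x1 x2)"
proof -
  let ?C = "{E. sym_invariant \<alpha> x1 x2 E}"
  have inv: "Mmap_coherent \<alpha> x1 x2 ` reflect E = reflect E" if "sym_invariant \<alpha> x1 x2 E" for E
    using that by (simp only: sym_invariant_def)
  have r: "reflect (\<Union>?C) = (\<Union>E\<in>?C. reflect E)"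
    by (auto simp: reflect_def)
  have "Mmap \<alpha> x1 x2 ` (\<Union>?C) = (\<Union>E\<in>?C. Mmap \<alpha> x1 x2 ` E)"
    by (simp only: image_Union)
  also have "\<dots> = \<Union>?C"
    by (simp add: sym_invariant_def)
  finally have 1: "Mmap \<alpha> x1 x2 ` (\<Union>?C) = \<Union>?C" .
  have "Mmap_coherent \<alpha> x1 x2 ` reflect (\<Union>?C)
      = (\<Union>E\<in>?C. Mmap_coherent \<alpha> x1 x2 ` reflect E)"
    unfolding r image_UN ..
  also have "\<dots> = reflect (\<Union>?C)"
    unfolding r by (rule SUP_cong) (simp_all add: inv)
  finally have 2: "Mmap_coherent \<alpha> x1 x2 ` reflect (\<Union>?C) = reflect (\<Union>?C)" .
  have 3: "\<Union>?C \<subseteq> {0..<1} - ({x1..<x2} \<union> reflect {x1<..x2})"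
    by (rule Union_least) (simp add: sym_invariant_def)
  show ?thesis
    unfolding sym_max_invariant_set_def
    by (subst sym_invariant_def) (intro conjI 1 2 3)
qed

lemma sym_max_invariant_set_greatest:
  "sym_invariant \<alpha> x1 x2 E \<Longrightarrow> E \<subseteq> sym_max_invariant_set \<alpha> x1 x2"
  by (auto simp: sym_max_invariant_set_def)

end

theory Submission
  imports Defs
begin

text \<open>
  Expanding the exponentials by Parseval turns \<open>\<Sum>\<^sub>m \<bar>\<langle>F, g\<^sub>m\<^sub>n\<rangle>\<bar>\<^sup>2\<close> into the energy over the unit interval of
  a row \<open>x \<mapsto> \<Sum>\<^sub>k F(x + na + k) H(x + k)\<close>. The difference of rows \<open>n\<close> and \<open>n + 1\<close> at \<open>p \<in> [na, na + a)\<close> is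
  \<open>2 F(p) - F(f p) - F(g p)\<close>, where \<open>f p\<close> and \<open>g p\<close> are the points of \<open>p + \<int>\<close> in \<open>[na + c, na + c + a)\<close> and
  \<open>[na - c, na - c + a)\<close>, and the corresponding summand is absent if there is no such point. Modulo \<open>a\<close>, the partial
  translations \<open>f\<close> and \<open>g\<close> are \<open>M\<close> and the reflection of its coherent map.

  If no nonempty set is invariant under \<open>f\<close>, \<open>g\<close> and their inverses, then by compactness (one-sided
  limits are exchanged by the reflection) there is an \<open>N\<close> such that from every point some word of length
  at most \<open>N\<close> in these four maps is undefined. Since \<open>f\<close> and \<open>g\<close> preserve Lebesgue measure, the equality case of
  the triangle inequality makes an \<open>F\<close> with small second difference almost invariant under all four maps, so
  its mass on the points where a word is undefined, that is all its mass, is small. This is the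
  lower frame bound.

  Conversely, from a nonempty invariant set take the part \<open>Q\<close> in one coset of \<open>\<int>\<close>. Its indicator has
  constant row sums, because \<open>f\<close> and \<open>g\<close> act as index shifts on \<open>Q\<close>; the two shifts are equal since otherwise
  \<open>g (f p) = p \<plusminus> 1\<close> on \<open>Q\<close>, which forces all positions modulo \<open>a\<close> to miss an interval of length \<open>1/2\<close>. Hence
  the row sums vanish, and truncations of the indicator to long intervals only see boundary rows.
\<close>

section \<open>Parseval's identity on the unit interval\<close>

text \<open>Nothing shows that a nonempty invariant set has positive measure, so neither direction
  can work with functions supported on it. The lower bound uses a uniform word length
  \<open>N\<close> instead, and the converse thickens finitely many points to short intervals [p, p
  + \<epsilon>), which the right-continuity of the window permits.

  The window jumps by -1, 2, -1 at -c, 0, c. The middle jump balances the two outer ones: with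
  absent values read as 0, a vanishing second difference makes \<open>F(p)\<close> the mean of the
  values at \<open>f p\<close> and \<open>g p\<close>. As both maps are injective and preserve
  measure, the mass off the domains of the four maps plus the squared differences of
  \<open>F\<close> along \<open>f\<close> and \<open>g\<close> add up to exactly 2 Re <F, D>, where
  \<open>D\<close> is the second difference. This identity is the quantitative form of the equality
  case. Each letter of a word costs a factor 12 in mass, so the lower frame constant obtained decays
  like 144^(-N).\<close>

lemma card_int_interval_le:
  fixes x y :: real
  assumes "x \<le> y"
  shows "real (card {\<lceil>x\<rceil>..\<lfloor>y\<rfloor>}) \<le> y - x + 1"
proof (cases "0 \<le> \<lfloor>y\<rfloor> - \<lceil>x\<rceil> + 1")
  case True
  then have "real (card {\<lceil>x\<rceil>..\<lfloor>y\<rfloor>}) = of_int (\<lfloor>y\<rfloor> - \<lceil>x\<rceil> + 1)"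
    by (simp add: add.commute diff_add_eq)
  also have "\<dots> \<le> y - x + 1"
    using of_int_floor_le[of y] le_of_int_ceiling[of x]
    unfolding of_int_add of_int_diff of_int_1 by linarith
  finally show ?thesis .
next
  case False
  then have "card {\<lceil>x\<rceil>..\<lfloor>y\<rfloor>} = 0"
    by simp
  then show ?thesis
    using assms by simp
qed

lemma norm_add_square_le: "(norm (x + y))\<^sup>2 \<le> 2 * (norm x)\<^sup>2 + 2 * (norm y)\<^sup>2" for x y :: "'a::real_normed_vector"
proof -
  have "(norm (x + y))\<^sup>2 \<le> (norm x + norm y)\<^sup>2"
    by (intro power_mono norm_triangle_ineq) auto
  also have "\<dots> \<le> 2 * (norm x)\<^sup>2 + 2 * (norm y)\<^sup>2"
    using zero_le_power2[of "norm x - norm y"] by (simp add: power2_eq_square algebra_simps)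
  finally show ?thesis .
qed

lemma nn_integral_shift:
  fixes f :: "real \<Rightarrow> ennreal"
  assumes "f \<in> borel_measurable borel"
  shows "(\<integral>\<^sup>+p. f (p + t) \<partial>lborel) = (\<integral>\<^sup>+p. f p \<partial>lborel)"
  using nn_integral_real_affine[of f 1 t] assms by (simp add: add.commute)

section \<open>Exponentials and square-integrable functions on the unit interval\<close>

text \<open>This is the conjugate of the modulation in \<open>gabor_system\<close>, so that Gabor
  coefficients become integrals against \<open>expi m\<close> with no conjugation left.\<close>

definition expi :: "int \<Rightarrow> real \<Rightarrow> complex" where
  "expi m x = cis (2 * pi * of_int m * x)"

definition unit_measure :: "real measure" where
  "unit_measure = restrict_space lborel {0..<1}"

lemma finite_measure_unit: "finite_measure unit_measure"
  unfolding unit_measure_def by (rule finite_measureI) (simp add: emeasure_restrict_space space_restrict_space)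

interpretation unit: finite_measure unit_measure
  by (rule finite_measure_unit)

lemma space_unit [simp]: "space unit_measure = {0..<1}"
  by (simp add: unit_measure_def space_restrict_space)

lemma borel_measurable_unit: "f \<in> borel_measurable borel \<Longrightarrow> f \<in> borel_measurable unit_measure"
  unfolding unit_measure_def by (simp add: measurable_restrict_space1)

lemma AE_unit: "AE x in lborel. P x \<Longrightarrow> AE x in unit_measure. P x"
  unfolding unit_measure_def by (subst AE_restrict_space_iff) auto

lemma expi_add: "expi (m + n) x = expi m x * expi n x"
  by (simp add: expi_def cis_mult algebra_simps)

lemma expi_minus: "expi (- m) x = cnj (expi m x)"
  by (simp add: expi_def cis_cnj)

lemma norm_expi [simp]: "cmod (expi m x) = 1"
  by (simp add: expi_def)

lemma continuous_on_expi [continuous_intros]: "continuous_on S (expi m)"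
  unfolding expi_def by (intro continuous_intros)

lemma borel_measurable_expi [measurable]: "expi m \<in> borel_measurable borel"
  by (intro borel_measurable_continuous_onI continuous_on_expi)

lemma expi_measurable_unit [measurable]: "expi m \<in> borel_measurable unit_measure"
  by (intro borel_measurable_unit borel_measurable_expi)

lemma expi_shift_int: "expi m (x + of_int k) = expi m x"
proof -
  have "expi m (x + of_int k) = expi m x * cis (2 * pi * of_int (m * k))"
    by (simp add: expi_def cis_mult algebra_simps)
  also have "cis (2 * pi * of_int (m * k)) = 1"
    by (intro complex_eqI) (auto simp: cos_int_2pin sin_int_2pin simp del: of_int_mult)
  finally show ?thesis
    by simp
qed

lemma integral_expi: "integral\<^sup>L unit_measure (expi m) = (if m = 0 then 1 else 0)"
proof (cases "m = 0")
  case True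
  then have "expi m = (\<lambda>_. 1)"
    by (auto simp: expi_def)
  then show ?thesis
    using True by (simp add: unit_measure_def measure_restrict_space)
next
  case False
  define k where "k = 2 * of_real pi * of_int m * \<i>"
  have "k \<noteq> 0"
    using False by (simp add: k_def)
  have expi_exp: "expi m x = exp (of_real x * k)" for x
    by (simp add: expi_def cis_conv_exp k_def mult_ac)
  define F where "F x = expi m x / k" for x
  have "(F has_vector_derivative expi m x) (at x within {0..1})" for x
  proof -
    have "((\<lambda>z. exp (z * k) / k) has_field_derivative exp (of_real x * k)) (at (of_real x))"
      using \<open>k \<noteq> 0\<close> by (auto intro!: derivative_eq_intros)
    then show ?thesis
      unfolding F_def expi_exp by (rule has_vector_derivative_real_field)
  qed
  then have "integral\<^sup>L lborel (\<lambda>x. indicator {0..1} x *\<^sub>R expi m x) = F 1 - F 0"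
    by (intro integral_FTC_Icc) (auto intro: continuous_on_expi)
  also have "F 1 = F 0"
    using expi_shift_int[of m 0 1] by (simp add: F_def)
  finally have "integral\<^sup>L lborel (\<lambda>x. indicator {0..1} x *\<^sub>R expi m x) = 0"
    by simp
  moreover have "integral\<^sup>L lborel (\<lambda>x. indicator {0..<1} x *\<^sub>R expi m x) =
      integral\<^sup>L lborel (\<lambda>x. indicator {0..1} x *\<^sub>R expi m x)"
    using AE_lborel_singleton[of 1] by (intro integral_cong_AE) (auto elim!: eventually_mono simp: indicator_def)
  ultimately show ?thesis
    using False by (simp add: unit_measure_def integral_restrict_space)
qed

lemma measure_unit [simp]: "measure unit_measure {0..<1} = 1"
  by (simp add: unit_measure_def measure_restrict_space)

lemma integral_const_unit [simp]: "(LINT x|unit_measure. d) = d" for d :: real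
  by (simp add: unit_measure_def measure_restrict_space)

definition square_integrable :: "(real \<Rightarrow> complex) \<Rightarrow> bool" where
  "square_integrable h \<longleftrightarrow> h \<in> borel_measurable unit_measure \<and> integrable unit_measure (\<lambda>x. (cmod (h x))\<^sup>2)"

lemma square_integrable_bounded:
  assumes "h \<in> borel_measurable unit_measure" "\<And>x. x \<in> {0..<1} \<Longrightarrow> cmod (h x) \<le> B"
  shows "square_integrable h"
  unfolding square_integrable_def
proof (intro conjI assms unit.integrable_const_bound[where B = "B\<^sup>2"] AE_I2)
  show "(\<lambda>x. (cmod (h x))\<^sup>2) \<in> borel_measurable unit_measure"
    using assms(1) by measurable
qed (use assms(2) in \<open>auto intro!: power_mono\<close>)

lemma square_integrable_add:
  assumes "square_integrable f" "square_integrable g" shows "square_integrable (\<lambda>x. f x + g x)"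
proof -
  have [measurable]: "f \<in> borel_measurable unit_measure" "g \<in> borel_measurable unit_measure"
    using assms by (auto simp: square_integrable_def)
  have "integrable unit_measure (\<lambda>x. (cmod (f x + g x))\<^sup>2)"
  proof (rule Bochner_Integration.integrable_bound)
    show "integrable unit_measure (\<lambda>x. 2 * (cmod (f x))\<^sup>2 + 2 * (cmod (g x))\<^sup>2)"
      using assms by (auto simp: square_integrable_def)
  qed (auto simp: norm_add_square_le)
  then show ?thesis
    by (simp add: square_integrable_def)
qed

lemma square_integrable_mult_bounded:
  assumes "square_integrable f" "g \<in> borel_measurable unit_measure" "\<And>x. cmod (g x) \<le> B"
  shows "square_integrable (\<lambda>x. f x * g x)"
proof -
  have [measurable]: "f \<in> borel_measurable unit_measure" "g \<in> borel_measurable unit_measure"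
    using assms by (auto simp: square_integrable_def)
  have "integrable unit_measure (\<lambda>x. (cmod (f x * g x))\<^sup>2)"
  proof (rule Bochner_Integration.integrable_bound)
    show "integrable unit_measure (\<lambda>x. B\<^sup>2 * (cmod (f x))\<^sup>2)"
      using assms by (auto simp: square_integrable_def)
    show "AE x in unit_measure. norm ((cmod (f x * g x))\<^sup>2) \<le> norm (B\<^sup>2 * (cmod (f x))\<^sup>2)"
    proof (rule AE_I2)
      fix x
      have "(cmod (g x))\<^sup>2 \<le> B\<^sup>2"
        using assms(3)[of x] by (intro power_mono) auto
      then show "norm ((cmod (f x * g x))\<^sup>2) \<le> norm (B\<^sup>2 * (cmod (f x))\<^sup>2)"
        by (simp add: norm_mult power_mult_distrib mult.commute[of "(cmod (f x))\<^sup>2"] mult_right_mono)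
    qed
  qed auto
  then show ?thesis
    by (simp add: square_integrable_def)
qed

lemma square_integrable_const: "square_integrable (\<lambda>_. c)"
  by (rule square_integrable_bounded[where B = "cmod c"]) auto

lemma square_integrable_expi: "square_integrable (expi m)"
  by (rule square_integrable_bounded[where B = 1]) auto

lemma square_integrable_cmult: "square_integrable f \<Longrightarrow> square_integrable (\<lambda>x. c * f x)"
  using square_integrable_mult_bounded[of f "\<lambda>_. c" "cmod c"] by (simp add: mult.commute)

lemma square_integrable_diff: "square_integrable f \<Longrightarrow> square_integrable g \<Longrightarrow> square_integrable (\<lambda>x. f x - g x)"
  using square_integrable_add[of f "\<lambda>x. (- 1) * g x"] square_integrable_cmult[of g "- 1"] by simp

lemma square_integrable_sum:
  "(\<And>i. i \<in> S \<Longrightarrow> square_integrable (f i)) \<Longrightarrow> square_integrable (\<lambda>x. \<Sum>i\<in>S. f i x)"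
  by (induction S rule: infinite_finite_induct) (auto intro: square_integrable_add square_integrable_const)

lemma square_integrable_imp_integrable: "square_integrable f \<Longrightarrow> integrable unit_measure f"
  unfolding square_integrable_def
proof (rule Bochner_Integration.integrable_bound[of _ "\<lambda>x. (cmod (f x))\<^sup>2 + 1"])
  have "t \<le> t\<^sup>2 + 1" for t :: real
    using zero_le_power2[of t] zero_le_power2[of "t - 1"]
    by (simp only: power2_diff power_one mult_1_right)
  then show "AE x in unit_measure. norm (f x) \<le> norm ((cmod (f x))\<^sup>2 + 1)"
    by (auto intro!: AE_I2 intro: order_trans[OF _ abs_ge_self])
qed auto

lemma integral_sq_add_le:
  assumes "square_integrable f" "square_integrable g"
  shows "(LINT x|unit_measure. (cmod (f x + g x))\<^sup>2) \<le>
    2 * (LINT x|unit_measure. (cmod (f x))\<^sup>2) + 2 * (LINT x|unit_measure. (cmod (g x))\<^sup>2)"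
proof -
  have "(LINT x|unit_measure. (cmod (f x + g x))\<^sup>2) \<le>
      (LINT x|unit_measure. 2 * (cmod (f x))\<^sup>2 + 2 * (cmod (g x))\<^sup>2)"
    using assms square_integrable_add[OF assms]
    by (intro integral_mono) (auto simp: square_integrable_def norm_add_square_le)
  then show ?thesis
    using assms by (simp add: square_integrable_def)
qed

text \<open>The functions \<open>cnj (expi m)\<close> are orthonormal and the integrals of
  \<open>h * expi m\<close> are the coefficients of \<open>h\<close> along them, so completing the
  square leaves one error term per frequency. Taking \<open>d\<close> to be the coefficients gives
  Bessel's inequality; arbitrary \<open>d\<close> shows that no trigonometric polynomial with
  frequencies in \<open>S\<close> does better than the Fourier sum.\<close>

lemma fourier_distance:
  assumes h: "square_integrable h" and "finite S"
  shows "(LINT x|unit_measure. (cmod (h x - (\<Sum>m\<in>S. d m * cnj (expi m x))))\<^sup>2) =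
    (LINT x|unit_measure. (cmod (h x))\<^sup>2) - (\<Sum>m\<in>S. (cmod (LINT x|unit_measure. h x * expi m x))\<^sup>2)
      + (\<Sum>m\<in>S. (cmod ((LINT x|unit_measure. h x * expi m x) - d m))\<^sup>2)"
  using \<open>finite S\<close>
proof (induction S)
  case (insert m S)
  define r where "r x = h x - (\<Sum>m\<in>S. d m * cnj (expi m x))" for x
  define A where "A x = Re (cnj (d m) * (r x * expi m x))" for x
  let ?c = "LINT x|unit_measure. h x * expi m x"
  have sq_e: "square_integrable (\<lambda>x. d j * cnj (expi j x))" for j
    by (intro square_integrable_cmult) (simp add: expi_minus[symmetric] square_integrable_expi)
  have r: "square_integrable r"
    unfolding r_def by (intro square_integrable_diff h square_integrable_sum sq_e)
  have re: "integrable unit_measure (\<lambda>x. f x * expi m x)" if "square_integrable f" for f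
    using that by (intro square_integrable_imp_integrable square_integrable_mult_bounded[where B = 1]) auto
  \<comment> \<open>By orthogonality, subtracting the terms with frequencies in \<open>S\<close>
    does not change the coefficient at the new frequency \<open>m\<close>.\<close>
  have "(LINT x|unit_measure. (d j * cnj (expi j x)) * expi m x) = 0" if "j \<in> S" for j
  proof -
    have "(\<lambda>x. (d j * cnj (expi j x)) * expi m x) = (\<lambda>x. d j * expi (m - j) x)"
      using expi_add[of m "- j"] by (auto simp: expi_minus)
    then show ?thesis
      using that insert.hyps by (auto simp: integral_expi)
  qed
  then have "(LINT x|unit_measure. r x * expi m x) = ?c"
    unfolding r_def left_diff_distrib sum_distrib_right
    by (subst Bochner_Integration.integral_diff) (auto intro!: re h sq_e Bochner_Integration.integrable_sum
        simp: Bochner_Integration.integral_sum[OF re[OF sq_e]])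
  then have A: "(LINT x|unit_measure. A x) = Re (cnj (d m) * ?c)"
    unfolding A_def using re[OF r] by (subst integral_Re) auto
  have int_A: "integrable unit_measure A"
    unfolding A_def using re[OF r] by (intro integrable_Re) simp
  have "(cmod (h x - (\<Sum>m\<in>insert m S. d m * cnj (expi m x))))\<^sup>2 =
      (cmod (r x))\<^sup>2 + (cmod (d m))\<^sup>2 - 2 * A x" for x
  proof -
    have "h x - (\<Sum>m\<in>insert m S. d m * cnj (expi m x)) = r x - d m * cnj (expi m x)"
      using insert.hyps by (simp add: r_def)
    moreover have "(cmod (u - v))\<^sup>2 = (cmod u)\<^sup>2 + (cmod v)\<^sup>2 - 2 * Re (u * cnj v)" for u v
      unfolding cmod_power2 by (simp add: power2_eq_square algebra_simps)
    moreover have "cmod (d m * cnj (expi m x)) = cmod (d m)"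
      by (simp add: norm_mult)
    moreover have "r x * cnj (d m * cnj (expi m x)) = cnj (d m) * (r x * expi m x)"
      by simp
    ultimately show ?thesis
      by (simp only: A_def)
  qed
  then have "(LINT x|unit_measure. (cmod (h x - (\<Sum>m\<in>insert m S. d m * cnj (expi m x))))\<^sup>2) =
      (LINT x|unit_measure. (cmod (r x))\<^sup>2) + (cmod (d m))\<^sup>2 - 2 * Re (cnj (d m) * ?c)"
    using r int_A unfolding square_integrable_def A[symmetric] by simp
  moreover have "(cmod (?c - d m))\<^sup>2 = (cmod ?c)\<^sup>2 + (cmod (d m))\<^sup>2 - 2 * Re (cnj (d m) * ?c)"
    unfolding cmod_power2 by (simp add: power2_eq_square algebra_simps)
  moreover have "(LINT x|unit_measure. (cmod (r x))\<^sup>2) =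
    (LINT x|unit_measure. (cmod (h x))\<^sup>2) - (\<Sum>m\<in>S. (cmod (LINT x|unit_measure. h x * expi m x))\<^sup>2)
      + (\<Sum>m\<in>S. (cmod ((LINT x|unit_measure. h x * expi m x) - d m))\<^sup>2)"
    unfolding r_def by (rule insert.IH)
  ultimately show ?case
    using insert.hyps by simp
qed simp

section \<open>Density of trigonometric polynomials\<close>

text \<open>Terms are added one at a time and frequencies may repeat, which makes closure under sums
  and products a plain induction; \<open>trig_representation\<close> collects repeated frequencies
  afterwards. The conjugates match the expansion in \<open>fourier_distance\<close>.\<close>

inductive trig :: "(real \<Rightarrow> complex) \<Rightarrow> bool" where
  zero: "trig (\<lambda>_. 0)"
| step: "trig q \<Longrightarrow> trig (\<lambda>x. q x + d * cnj (expi m x))"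

lemma trig_add: "trig q \<Longrightarrow> trig p \<Longrightarrow> trig (\<lambda>x. p x + q x)"
  by (induction q rule: trig.induct) (auto simp: add.assoc[symmetric] intro: trig.step)

lemma trig_mult_expi: "trig q \<Longrightarrow> trig (\<lambda>x. q x * (d * cnj (expi m x)))"
proof (induction q rule: trig.induct)
  case (step q d' m')
  have "trig (\<lambda>x. q x * (d * cnj (expi m x)) + (d' * d) * cnj (expi (m' + m) x))"
    using step.IH by (rule trig.step)
  then show ?case
    by (simp add: expi_add algebra_simps)
qed (simp add: trig.zero)

lemma trig_mult: "trig q \<Longrightarrow> trig p \<Longrightarrow> trig (\<lambda>x. p x * q x)"
  by (induction q rule: trig.induct) (auto simp: distrib_left intro: trig.zero trig_add trig_mult_expi)

lemma trig_expi: "trig (\<lambda>x. d * expi m x)"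
  using trig.step[OF trig.zero, of d "- m"] by (simp add: expi_minus)

lemma trig_const: "trig (\<lambda>_. d)"
  using trig_expi[of d 0] by (simp add: expi_def)

lemma trig_representation:
  "trig q \<Longrightarrow> \<exists>S d. finite S \<and> q = (\<lambda>x. \<Sum>m\<in>S. d m * cnj (expi m x))"
proof (induction q rule: trig.induct)
  case zero
  show ?case
    by (rule exI[of _ "{}"]) auto
next
  case (step q d m)
  then obtain S e where S: "finite S" "q = (\<lambda>x. \<Sum>m\<in>S. e m * cnj (expi m x))"
    by blast
  \<comment> \<open>The frequency \<open>m\<close> may already occur in \<open>S\<close>, in which
    case the two coefficients add up.\<close>
  define e' where "e' j = (if j \<in> S then e j else 0) + (if j = m then d else 0)" for j
  have "(\<Sum>j\<in>insert m S. e' j * cnj (expi j x)) = q x + d * cnj (expi m x)" for x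
  proof -
    have "(\<Sum>j\<in>insert m S. e' j * cnj (expi j x)) =
        (\<Sum>j\<in>insert m S. if j \<in> S then e j * cnj (expi j x) else 0) +
        (\<Sum>j\<in>insert m S. if j = m then d * cnj (expi j x) else 0)"
      unfolding e'_def sum.distrib[symmetric] by (intro sum.cong) (auto simp: algebra_simps)
    also have "(\<Sum>j\<in>insert m S. if j \<in> S then e j * cnj (expi j x) else 0) = q x"
      unfolding S(2) using S(1) by (intro sum.mono_neutral_cong_right) auto
    finally show ?thesis
      using S(1) by simp
  qed
  then show ?case
    using S(1) by (intro exI[of _ "insert m S"] exI[of _ e']) auto
qed

lemma square_integrable_trig: "trig q \<Longrightarrow> square_integrable q"
  by (induction q rule: trig.induct)
    (auto intro!: square_integrable_const square_integrable_add square_integrable_cmult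
      simp: expi_minus[symmetric] square_integrable_expi)

text \<open>A real-linear functional of z is a complex combination of z and its conjugate, which on
  the circle are the frequencies 1 and -1; sums and products of trigonometric polynomials do the
  rest.\<close>

lemma trig_real_polynomial_function:
  "real_polynomial_function p \<Longrightarrow> trig (\<lambda>x. of_real (p (cis (2 * pi * x))))"
proof (induction p rule: real_polynomial_function.induct)
  case (linear f)
  interpret bounded_linear f
    by fact
  have f_eq: "f z = Re z * f 1 + Im z * f \<i>" for z
  proof -
    have "z = Re z *\<^sub>R 1 + Im z *\<^sub>R \<i>"
      by (simp add: complex_eq_iff)
    then have "f z = f (Re z *\<^sub>R 1 + Im z *\<^sub>R \<i>)"
      by simp
    then show ?thesis
      unfolding add scale by simp
  qed
  have "complex_of_real (f (cis (2 * pi * x))) =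
      (f 1 - \<i> * f \<i>) / 2 * expi 1 x + (f 1 + \<i> * f \<i>) / 2 * expi (- 1) x" for x
    unfolding f_eq[of "cis (2 * pi * x)"] by (simp add: expi_def complex_eq_iff add_divide_distrib[symmetric])
  then show ?case
    by (simp only:) (intro trig_add trig_expi)
next
  case (const c)
  show ?case
    by (rule trig_const)
next
  case (add f g)
  then show ?case
    by (simp add: trig_add)
next
  case (mult f g)
  then show ?case
    by (simp add: trig_mult)
qed

text \<open>Since \<open>g 0 = g 1\<close>, the function \<open>g\<close> descends to a function
  \<open>G\<close> on the unit circle. \<open>G\<close> is continuous because preimages of closed
  sets under it are images of compact subsets of [0,1], and Stone-Weierstrass on the circle provides
  the polynomial.\<close>

lemma trig_approx_continuous:
  fixes g :: "real \<Rightarrow> real"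
  assumes g: "continuous_on {0..1} g" "g 0 = g 1" and "e > 0"
  obtains q where "trig q" "\<And>x. x \<in> {0..1} \<Longrightarrow> cmod (of_real (g x) - q x) < e"
proof -
  define E where "E x = cis (2 * pi * x)" for x
  have E_eq: "g x = g y" if "x \<in> {0..1}" "y \<in> {0..1}" "E x = E y" for x y
  proof -
    have "E (x - y) = 1"
      using that(3) by (simp add: E_def right_diff_distrib cis_divide[symmetric])
    then have "cos (2 * pi * (x - y)) = 1"
      by (simp add: E_def complex_eq_iff)
    then obtain n :: int where "2 * pi * (x - y) = of_int n * (2 * pi)"
      unfolding cos_one_2pi_int by auto
    then have n: "x - y = of_int n"
      by simp
    then have "real_of_int n \<le> 1" "- 1 \<le> real_of_int n"
      using that by auto
    then consider "n = - 1" | "n = 0" | "n = 1"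
      by linarith
    then show ?thesis
      using n that g(2) by cases (auto simp: algebra_simps)
  qed
  define G where "G z = g (SOME x. x \<in> {0..1} \<and> E x = z)" for z
  have G: "G (E x) = g x" if "x \<in> {0..1}" for x
    unfolding G_def
  proof (rule someI2[of _ x])
    show "x \<in> {0..1} \<and> E x = E x"
      using that by simp
    show "g y = g x" if "y \<in> {0..1} \<and> E y = E x" for y
      using that \<open>x \<in> {0..1}\<close> by (intro E_eq) auto
  qed
  have surj: "\<exists>x\<in>{0..1}. E x = z" if "z \<in> sphere 0 1" for z
  proof -
    have "z = E (Arg2pi z / (2 * pi))"
      using that Arg2pi[of z] by (simp add: E_def cis_conv_exp dist_norm is_Arg_def)
    moreover have "Arg2pi z / (2 * pi) \<in> {0..1}"
      using Arg2pi[of z] by auto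
    ultimately show ?thesis
      by metis
  qed
  have E_sphere: "E x \<in> sphere 0 1" for x
    by (simp add: E_def)
  have "continuous_on (sphere 0 1) G"
  proof (subst continuous_on_closed_vimage; (intro allI impI)?)
    fix B :: "real set" assume "closed B"
    have "G -` B \<inter> sphere 0 1 = E ` ({0..1} \<inter> g -` B)"
    proof (intro equalityI subsetI)
      fix z assume z: "z \<in> G -` B \<inter> sphere 0 1"
      then obtain x where x: "x \<in> {0..1}" "E x = z"
        using surj by blast
      then have "x \<in> {0..1} \<inter> g -` B"
        using z G[OF x(1)] by simp
      then show "z \<in> E ` ({0..1} \<inter> g -` B)"
        using x(2) by blast
    next
      fix z assume "z \<in> E ` ({0..1} \<inter> g -` B)"
      then show "z \<in> G -` B \<inter> sphere 0 1"
        using G E_sphere by (elim imageE) simp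
    qed
    moreover have "closed (g -` B \<inter> {0..1})"
      using continuous_on_closed_vimage[of "{0..1}" g] g(1) \<open>closed B\<close> by blast
    then have "compact ({0..1} \<inter> (g -` B \<inter> {0..1}))"
      by (intro compact_Int_closed) auto
    then have "compact ({0..1} \<inter> g -` B)"
      by (simp add: Int_commute Int_left_commute)
    moreover have "continuous_on ({0..1} \<inter> g -` B) E"
      unfolding E_def by (intro continuous_intros)
    ultimately show "closed (G -` B \<inter> sphere 0 1)"
      by (simp add: compact_continuous_image compact_imp_closed)
  qed simp
  then obtain p where p: "real_polynomial_function p" "\<And>z. z \<in> sphere 0 1 \<Longrightarrow> \<bar>G z - p z\<bar> < e"
    using Stone_Weierstrass_real_polynomial_function[OF compact_sphere _ \<open>e > 0\<close>] by metis
  show ?thesis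
  proof (rule that[OF trig_real_polynomial_function[OF p(1)]])
    fix x :: real assume "x \<in> {0..1}"
    then have "\<bar>g x - p (E x)\<bar> < e"
      using p(2)[OF E_sphere[of x]] G by simp
    then show "cmod (of_real (g x) - of_real (p (cis (2 * pi * x)))) < e"
      unfolding E_def of_real_diff[symmetric] norm_of_real .
  qed
qed

definition trig_approx :: "(real \<Rightarrow> complex) \<Rightarrow> bool" where
  "trig_approx h \<longleftrightarrow> (\<forall>e>0. \<exists>q. trig q \<and> (LINT x|unit_measure. (cmod (h x - q x))\<^sup>2) < e)"

lemma trig_approx_limit:
  assumes h: "square_integrable h" and g: "\<And>n. square_integrable (g n)" "\<And>n. trig_approx (g n)"
    and lim: "(\<lambda>n. LINT x|unit_measure. (cmod (h x - g n x))\<^sup>2) \<longlonglongrightarrow> 0"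
  shows "trig_approx h"
  unfolding trig_approx_def
proof (intro allI impI)
  fix e :: real assume "e > 0"
  then obtain n where n: "(LINT x|unit_measure. (cmod (h x - g n x))\<^sup>2) < e / 4"
    using order_tendstoD(2)[OF lim, of "e / 4"] by (auto simp: eventually_sequentially)
  obtain q where q: "trig q" "(LINT x|unit_measure. (cmod (g n x - q x))\<^sup>2) < e / 4"
    using g(2)[of n] \<open>e > 0\<close> unfolding trig_approx_def by (metis divide_pos_pos zero_less_numeral)
  have "(LINT x|unit_measure. (cmod ((h x - g n x) + (g n x - q x)))\<^sup>2) < e"
    using integral_sq_add_le[OF square_integrable_diff[OF h g(1)[of n]]
        square_integrable_diff[OF g(1)[of n] square_integrable_trig[OF q(1)]]] n q(2) by linarith
  then show "\<exists>q. trig q \<and> (LINT x|unit_measure. (cmod (h x - q x))\<^sup>2) < e"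
    using q(1) by auto
qed

lemma trig_approx_continuous_fun:
  fixes g :: "real \<Rightarrow> complex"
  assumes g: "continuous_on {0..1} g" "g 0 = g 1"
  shows "trig_approx g"
  unfolding trig_approx_def
proof (intro allI impI)
  fix e :: real assume "e > 0"
  \<comment> \<open>Real and imaginary parts err by less than \<open>d\<close> each, so the squared
    error is at most (2d)^2 = e/2, which leaves room for the strict inequality.\<close>
  define d where "d = sqrt (e / 8)"
  have "d > 0"
    using \<open>e > 0\<close> by (simp add: d_def)
  obtain p where p: "trig p" "\<And>x. x \<in> {0..1} \<Longrightarrow> cmod (of_real (Re (g x)) - p x) < d"
    using trig_approx_continuous[of "\<lambda>x. Re (g x)" d] g \<open>d > 0\<close> by (auto intro: continuous_intros)
  obtain q where q: "trig q" "\<And>x. x \<in> {0..1} \<Longrightarrow> cmod (of_real (Im (g x)) - q x) < d"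
    using trig_approx_continuous[of "\<lambda>x. Im (g x)" d] g \<open>d > 0\<close> by (auto intro: continuous_intros)
  have "trig (\<lambda>x. p x + q x * \<i>)"
    by (intro trig_add trig_mult p q trig_const)
  moreover have "(LINT x|unit_measure. (cmod (g x - (p x + q x * \<i>)))\<^sup>2) \<le> (LINT x|unit_measure. e / 2)"
  proof (rule integral_mono_AE')
    have "(cmod (g x - (p x + q x * \<i>)))\<^sup>2 \<le> e / 2" if "x \<in> {0..<1}" for x
    proof -
      have "g x - (p x + q x * \<i>) = (of_real (Re (g x)) - p x) + (of_real (Im (g x)) - q x) * \<i>"
        by (simp add: complex_eq_iff)
      then have "cmod (g x - (p x + q x * \<i>)) \<le>
          cmod (of_real (Re (g x)) - p x) + cmod ((of_real (Im (g x)) - q x) * \<i>)"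
        by (simp only: norm_triangle_ineq)
      also have "\<dots> \<le> d + d"
        using p(2)[of x] q(2)[of x] that by (intro add_mono) (auto simp: norm_mult)
      finally have "cmod (g x - (p x + q x * \<i>)) \<le> 2 * d"
        by simp
      then have "(cmod (g x - (p x + q x * \<i>)))\<^sup>2 \<le> (2 * d)\<^sup>2"
        by (intro power_mono) auto
      also have "\<dots> = e / 2"
        using \<open>e > 0\<close> by (simp add: d_def power_mult_distrib)
      finally show ?thesis .
    qed
    then show "AE x in unit_measure. (cmod (g x - (p x + q x * \<i>)))\<^sup>2 \<le> e / 2"
      by (intro AE_I2) simp
  qed (use \<open>e > 0\<close> in auto)
  moreover have "(LINT x|unit_measure. e / 2) < e"
    using \<open>e > 0\<close> by simp
  ultimately show "\<exists>q. trig q \<and> (LINT x|unit_measure. (cmod (g x - q x))\<^sup>2) < e"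
    by (intro exI[of _ "\<lambda>x. p x + q x * \<i>"]) auto
qed

text \<open>Up to a null set \<open>h\<close> is a pointwise limit of continuous functions. These
  are made uniformly bounded and equal at both endpoints, so that dominated convergence and the
  continuous case apply.\<close>

lemma trig_approx_bounded:
  assumes h [measurable]: "h \<in> borel_measurable borel" and B: "\<And>x. cmod (h x) \<le> B" and "B > 0"
  shows "trig_approx h"
proof -
  have "h \<in> borel_measurable lebesgue"
    using h by (simp add: measurable_completion)
  then have "h measurable_on UNIV"
    by (intro lebesgue_measurable_imp_measurable_on) auto
  then obtain N g where N: "negligible N" and g: "\<And>n::nat. continuous_on UNIV (g n)"
    and lim: "\<And>x. x \<notin> N \<Longrightarrow> (\<lambda>n. g n x) \<longlonglongrightarrow> h x"
    unfolding measurable_on_def by auto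
  \<comment> \<open>Radial projection to the disc of radius \<open>B\<close>: continuous, bounded,
    and the identity on the values of \<open>h\<close>.\<close>
  define clip where "clip z = z * of_real (B / max B (cmod z))" for z :: complex
  have clip_le: "cmod (clip z) \<le> B" for z
    using \<open>B > 0\<close> by (auto simp: clip_def norm_mult norm_divide max_def field_simps)
  have clip_id: "clip z = z" if "cmod z \<le> B" for z
    using that \<open>B > 0\<close> by (simp add: clip_def)
  have clip_cont: "continuous_on UNIV clip"
    unfolding clip_def using \<open>B > 0\<close> by (intro continuous_intros) (auto simp: max_def)
  \<comment> \<open>A continuous cutoff vanishing at 0 and 1 and tending to 1 in between; it makes
    the endpoint values agree.\<close>
  define \<theta> where "\<theta> n x = min 1 (real n * (x * (1 - x)))" for n and x :: real
  have theta_lim: "(\<lambda>n. \<theta> n x) \<longlonglongrightarrow> 1" if "x \<in> {0<..<1}" for x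
  proof -
    obtain m where "1 / (x * (1 - x)) < real m"
      using reals_Archimedean2 by blast
    moreover have "0 < x * (1 - x)"
      using that by simp
    ultimately have "1 \<le> real n * (x * (1 - x))" if "n \<ge> m" for n
      using that by (simp add: pos_divide_less_eq)
        (meson less_imp_le mult_right_mono of_nat_mono order_trans)
    then have "eventually (\<lambda>n. 1 = \<theta> n x) sequentially"
      unfolding \<theta>_def by (auto simp: eventually_sequentially intro!: exI[of _ m])
    then show ?thesis
      by (rule Lim_transform_eventually[OF tendsto_const])
  qed
  have theta_le: "0 \<le> \<theta> n x" "\<theta> n x \<le> 1" if "x \<in> {0..<1}" for n x
    using that by (auto simp: \<theta>_def)
  define k where "k n x = of_real (\<theta> n x) * clip (g n x)" for n x
  have k_cont: "continuous_on UNIV (k n)" for n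
    unfolding k_def \<theta>_def
    by (intro continuous_intros continuous_on_compose2[OF clip_cont g]) auto
  have [measurable]: "k n \<in> borel_measurable unit_measure" for n
    using k_cont by (intro borel_measurable_unit borel_measurable_continuous_onI)
  have [measurable]: "h \<in> borel_measurable unit_measure"
    using h by (rule borel_measurable_unit)
  have k_le: "cmod (k n x) \<le> B" if "x \<in> {0..<1}" for n x
    using mult_mono[OF theta_le(2)[OF that, of n] clip_le[of "g n x"]] theta_le[OF that, of n]
    by (simp add: k_def norm_mult)
  show ?thesis
  proof (rule trig_approx_limit[where g = k])
    show "square_integrable h" "square_integrable (k n)" for n
      by (auto intro!: square_integrable_bounded[of _ B] B k_le)
    show "trig_approx (k n)" for n
      using continuous_on_subset[OF k_cont] by (intro trig_approx_continuous_fun) (auto simp: k_def \<theta>_def)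
    have "(\<lambda>n. LINT x|unit_measure. (cmod (h x - k n x))\<^sup>2) \<longlonglongrightarrow> (LINT x|unit_measure. 0)"
    proof (rule integral_dominated_convergence[where w = "\<lambda>_. (2 * B)\<^sup>2"])
      have "AE x in lborel. x \<notin> N"
        using N unfolding negligible_iff_null_sets
        by (metis AE_not_in AE_completion_iff)
      then have "AE x in lborel. x \<notin> N \<and> x \<noteq> 0"
        using AE_lborel_singleton[of 0] by eventually_elim auto
      then have "AE x in unit_measure. x \<notin> N \<and> x \<noteq> 0"
        by (rule AE_unit)
      moreover have "AE x in unit_measure. x \<in> {0..<1}"
        by (rule AE_I2) simp
      ultimately show "AE x in unit_measure. (\<lambda>n. (cmod (h x - k n x))\<^sup>2) \<longlonglongrightarrow> 0"
      proof eventually_elim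
        case (elim x)
        have "(\<lambda>n. clip (g n x)) \<longlonglongrightarrow> clip (h x)"
          using elim lim clip_cont by (intro isCont_tendsto_compose[of _ clip]) (auto simp: continuous_on_eq_continuous_at)
        then have "(\<lambda>n. k n x) \<longlonglongrightarrow> of_real 1 * h x"
          unfolding k_def clip_id[OF B] using theta_lim[of x] elim
          by (intro tendsto_intros) auto
        then have "(\<lambda>n. (cmod (h x - k n x))\<^sup>2) \<longlonglongrightarrow> (cmod (h x - of_real 1 * h x))\<^sup>2"
          by (intro tendsto_intros)
        then show ?case
          by simp
      qed
      show "AE x in unit_measure. norm ((cmod (h x - k n x))\<^sup>2) \<le> (2 * B)\<^sup>2" for n
      proof (rule AE_I2)
        fix x assume "x \<in> space unit_measure"
        then have "cmod (h x - k n x) \<le> 2 * B"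
          using norm_triangle_ineq4[of "h x" "k n x"] B[of x] k_le[of x n] by simp
        then show "norm ((cmod (h x - k n x))\<^sup>2) \<le> (2 * B)\<^sup>2"
          using power_mono[of "cmod (h x - k n x)" "2 * B" 2] by simp
      qed
    qed auto
    then show "(\<lambda>n. LINT x|unit_measure. (cmod (h x - k n x))\<^sup>2) \<longlonglongrightarrow> 0"
      by simp
  qed
qed

lemma trig_approx_square_integrable:
  assumes h: "h \<in> borel_measurable borel" and sq: "square_integrable h"
  shows "trig_approx h"
proof -
  define g where "g n x = (if cmod (h x) \<le> real n then h x else 0)" for n x
  have g: "g n \<in> borel_measurable borel" for n
  proof -
    have "(\<lambda>x. if cmod (h x) \<le> real n then h x else 0) \<in> borel_measurable borel"
      using h by measurable
    then show ?thesis
      by (simp add: g_def[abs_def])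
  qed
  show ?thesis
  proof (rule trig_approx_limit[OF sq, where g = g])
    show "square_integrable (g n)" for n
      by (rule square_integrable_bounded[where B = "real n"]) (auto simp: g_def[of _ "_::real"] intro!: borel_measurable_unit g)
    \<comment> \<open>The bound must be positive also for n = 0, hence the added 1.\<close>
    show "trig_approx (g n)" for n
      by (rule trig_approx_bounded[where B = "real n + 1"]) (auto simp: g_def[of _ "_::real"] intro!: g)
    have "(\<lambda>n. LINT x|unit_measure. (cmod (h x - g n x))\<^sup>2) \<longlonglongrightarrow> (LINT x|unit_measure. 0)"
    proof (rule integral_dominated_convergence[where w = "\<lambda>x. (cmod (h x))\<^sup>2"])
      show "integrable unit_measure (\<lambda>x. (cmod (h x))\<^sup>2)"
        using sq by (simp add: square_integrable_def)
      show "AE x in unit_measure. (\<lambda>n. (cmod (h x - g n x))\<^sup>2) \<longlonglongrightarrow> 0"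
      proof (rule AE_I2)
        fix x
        have "eventually (\<lambda>n. 0 = (cmod (h x - g n x))\<^sup>2) sequentially"
          using eventually_ge_at_top[of "nat \<lceil>cmod (h x)\<rceil>"]
          by eventually_elim (simp add: g_def nat_le_iff ceiling_le_iff)
        then show "(\<lambda>n. (cmod (h x - g n x))\<^sup>2) \<longlonglongrightarrow> 0"
          by (rule Lim_transform_eventually[OF tendsto_const])
      qed
      show "(\<lambda>x. (cmod (h x - g n x))\<^sup>2) \<in> borel_measurable unit_measure" for n
        using h g[of n] by (intro borel_measurable_unit) measurable
    qed (auto simp: g_def)
    then show "(\<lambda>n. LINT x|unit_measure. (cmod (h x - g n x))\<^sup>2) \<longlonglongrightarrow> 0"
      by simp
  qed
qed

text \<open>Bessel's inequality bounds every finite partial sum from above. If some trigonometric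
  polynomial with frequencies in \<open>S\<close> is within \<open>e\<close>, then the sum over
  \<open>S\<close>, and by positivity over every larger finite set, is within \<open>e\<close> of
  the norm square, which is unordered convergence.\<close>

theorem parseval:
  assumes h: "h \<in> borel_measurable borel" and sq: "square_integrable h"
  shows "((\<lambda>m. (cmod (LINT x|unit_measure. h x * expi m x))\<^sup>2) has_sum
    (LINT x|unit_measure. (cmod (h x))\<^sup>2)) UNIV"
proof -
  let ?c = "\<lambda>m. (cmod (LINT x|unit_measure. h x * expi m x))\<^sup>2"
  let ?I = "LINT x|unit_measure. (cmod (h x))\<^sup>2"
  have bessel: "sum ?c S \<le> ?I" if "finite S" for S
  proof -
    have "0 \<le> (LINT x|unit_measure. (cmod (h x - (\<Sum>m\<in>S. (LINT x|unit_measure. h x * expi m x) * cnj (expi m x))))\<^sup>2)"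
      by simp
    then show ?thesis
      unfolding fourier_distance[OF sq that] by simp
  qed
  show ?thesis
    unfolding has_sum_def tendsto_iff eventually_finite_subsets_at_top
  proof (intro allI impI)
    fix e :: real assume "e > 0"
    then obtain q where q: "trig q" "(LINT x|unit_measure. (cmod (h x - q x))\<^sup>2) < e"
      using trig_approx_square_integrable[OF h sq] by (auto simp: trig_approx_def)
    then obtain S d where S: "finite S" "q = (\<lambda>x. \<Sum>m\<in>S. d m * cnj (expi m x))"
      using trig_representation by blast
    have "0 \<le> (\<Sum>m\<in>S. (cmod ((LINT x|unit_measure. h x * expi m x) - d m))\<^sup>2)"
      by (intro sum_nonneg) simp
    then have S_close: "?I - sum ?c S < e"
      using q(2) unfolding S(2) fourier_distance[OF sq S(1)] by linarith
    have "dist (sum ?c T) ?I < e" if "finite T" "S \<subseteq> T" for T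
    proof -
      have "sum ?c S \<le> sum ?c T"
        using that by (intro sum_mono2) auto
      then show ?thesis
        using S_close bessel[OF that(1)] unfolding dist_real_def by linarith
    qed
    then show "\<exists>S. finite S \<and> S \<subseteq> UNIV \<and>
        (\<forall>T. finite T \<and> S \<subseteq> T \<and> T \<subseteq> UNIV \<longrightarrow> dist (sum ?c T) ?I < e)"
      using S(1) by blast
  qed
qed

section \<open>Partial translations between the rows\<close>

lemma frac_eqI_int_diff: "x - y \<in> \<int> \<Longrightarrow> frac x = frac y" for x y :: real
  by (metis Ints_cases add.commute diff_add_cancel frac_add_of_int_right)

lemma floor_eventually_at_right: "eventually (\<lambda>s. \<lfloor>(s - u) / a\<rfloor> = \<lfloor>(p - u) / a\<rfloor>) (at_right p)"
  if "a > 0" for a p u :: real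
proof -
  define b where "b = u + a * (of_int \<lfloor>(p - u) / a\<rfloor> + 1)"
  have "b > p"
    unfolding b_def using floor_correct[of "(p - u) / a"] that by (auto simp: field_simps)
  have "\<lfloor>(s - u) / a\<rfloor> = \<lfloor>(p - u) / a\<rfloor>" if "s > p" "s < b" for s
  proof (rule floor_unique)
    show "of_int \<lfloor>(p - u) / a\<rfloor> \<le> (s - u) / a"
      using that \<open>a > 0\<close> floor_correct[of "(p - u) / a"]
      by (smt (verit) divide_right_mono)
    show "(s - u) / a < of_int \<lfloor>(p - u) / a\<rfloor> + 1"
      using that \<open>a > 0\<close> by (simp add: b_def field_simps)
  qed
  then show ?thesis
    using \<open>b > p\<close> by (auto simp: eventually_at_right)
qed

text \<open>The left limit of the floor at y is \<lceil>y\<rceil> - 1. It is written through the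
  floor at the reflected point so that it combines with hops at \<open>- p\<close>.\<close>

lemma floor_eventually_at_left:
  "eventually (\<lambda>s. \<lfloor>(s - u) / a\<rfloor> = - \<lfloor>(- p + u) / a\<rfloor> - 1) (at_left p)"
  if "a > 0" for a p u :: real
proof -
  define n where "n = - \<lfloor>(- p + u) / a\<rfloor> - 1"
  define b where "b = u + a * of_int n"
  have *: "of_int n < (p - u) / a" "(p - u) / a \<le> of_int n + 1"
  proof -
    have "(- p + u) / a = - ((p - u) / a)"
      by (simp add: minus_divide_left)
    then show "of_int n < (p - u) / a" "(p - u) / a \<le> of_int n + 1"
      unfolding n_def using floor_correct[of "- ((p - u) / a)"] by linarith+
  qed
  have "b < p"
    using * \<open>a > 0\<close> by (simp add: b_def field_simps)
  have "\<lfloor>(s - u) / a\<rfloor> = n" if "s < p" "s > b" for s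
  proof (rule floor_unique)
    show "of_int n \<le> (s - u) / a"
      using that \<open>a > 0\<close> by (simp add: b_def field_simps)
    show "(s - u) / a < of_int n + 1"
      using that \<open>a > 0\<close> * by (smt (verit) divide_strict_right_mono)
  qed
  then show ?thesis
    using \<open>b < p\<close> unfolding n_def by (auto simp: eventually_at_left)
qed

lemma eventually_at_right_shift:
  "eventually P (at_right (p + q)) \<longleftrightarrow> eventually (\<lambda>s. P (s + q)) (at_right p)" for p q :: real
  by (subst at_right_to_0, subst (2) at_right_to_0) (simp add: eventually_filtermap ac_simps)

lemma eventually_at_left_shift:
  "eventually P (at_left (p + q)) \<longleftrightarrow> eventually (\<lambda>s. P (s + q)) (at_left p)" for p q :: real
  by (simp add: at_left_minus[of "p + q"] at_left_minus[of p] eventually_filtermap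
      eventually_at_right_shift[of _ "- p" "- q", simplified])

section \<open>Hops and the words formed from them\<close>

locale haar_gabor =
  fixes a c :: real
  assumes a_pos: "0 < a" and a_lt_1: "a < 1" and c_gt_1: "1 < c" and c_not_nat: "c \<notin> \<nat>"
begin

text \<open>Some cell has \<open>p \<in> [na + u, na + u + a)\<close> and \<open>p + k \<in> [na + w, na + w + a)\<close>: the maps \<open>f\<close>, \<open>g\<close> and
  their inverses are the cases \<open>(u, w) = (0, c)\<close>, \<open>(0, -c)\<close>, \<open>(c, 0)\<close>, \<open>(-c, 0)\<close>.\<close>

definition hop :: "real \<Rightarrow> real \<Rightarrow> int \<Rightarrow> real \<Rightarrow> bool" where
  "hop u w k p \<longleftrightarrow> \<lfloor>(p - u) / a\<rfloor> = \<lfloor>(p + of_int k - w) / a\<rfloor>"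

definition hops :: "(real \<times> real) set" where
  "hops = {(0, c), (0, - c), (c, 0), (- c, 0)}"

text \<open>A finite range that serves two purposes: every hop has length within
  \<open>a < 1\<close> of \<open>c\<close> or \<open>- c\<close> and hence lies in it, and for x in
  [-1, 1) it contains every k with x + k in the support [-c, c) of the window.\<close>

definition steps :: "int set" where
  "steps = {- (\<lceil>c\<rceil> + 1)..\<lceil>c\<rceil> + 1}"

lemma finite_steps [simp]: "finite steps"
  by (simp add: steps_def)

lemma uminus_steps [simp]: "- k \<in> steps \<longleftrightarrow> k \<in> steps"
  by (auto simp: steps_def)

lemma hops_uminus: "(u, w) \<in> hops \<Longrightarrow> (- u, - w) \<in> hops"
  by (auto simp: hops_def)

lemma hops_swap: "(u, w) \<in> hops \<Longrightarrow> (w, u) \<in> hops"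
  by (auto simp: hops_def)

lemma hop_iff:
  "hop u w k p \<longleftrightarrow> (let n = of_int \<lfloor>(p - u) / a\<rfloor> * a in n \<le> p + of_int k - w \<and> p + of_int k - w < n + a)"
  unfolding hop_def Let_def
  by (subst eq_commute, subst floor_eq_iff)
    (simp only: pos_le_divide_eq[OF a_pos] pos_divide_less_eq[OF a_pos] distrib_right mult_1)

lemma floor_bounds: "of_int \<lfloor>x / a\<rfloor> * a \<le> x" "x < of_int \<lfloor>x / a\<rfloor> * a + a"
  using floor_correct[of "x / a"]
  by (simp_all only: pos_le_divide_eq[OF a_pos] pos_divide_less_eq[OF a_pos] of_int_add of_int_1
      distrib_right mult_1)

lemma hop_bounds: "hop u w k p \<Longrightarrow> \<bar>of_int k - (w - u)\<bar> < a"
  using floor_bounds[of "p - u"] by (auto simp: hop_iff Let_def)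

text \<open>A half-open cell of length \<open>a < 1\<close> contains at most one point of a coset of
  the integers; this makes each hop relation a partial function.\<close>

lemma hop_unique: "hop u w k p \<Longrightarrow> hop u w l p \<Longrightarrow> k = l"
  using a_lt_1 by (auto simp: hop_iff Let_def)

lemma hop_inverse: "hop u w k p \<longleftrightarrow> hop w u (- k) (p + of_int k)"
  by (auto simp: hop_def)

lemma hop_steps:
  assumes "(u, w) \<in> hops" "hop u w k p" shows "k \<in> steps"
  using hop_bounds[OF assms(2)] assms(1) a_lt_1 c_gt_1
  unfolding steps_def hops_def by auto linarith+

lemma hop_periodic: "hop u w k (p + of_int n * a) \<longleftrightarrow> hop u w k p"
proof -
  have *: "(p + of_int n * a + z) / a = (p + z) / a + of_int n" for z
    using a_pos by (simp add: field_simps)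
  show ?thesis
    using *[of "- u"] *[of "of_int k - w"] unfolding hop_def by (simp add: algebra_simps)
qed

lemma hop_eventually_at_right: "eventually (\<lambda>s. hop u w k s \<longleftrightarrow> hop u w k p) (at_right p)"
  using floor_eventually_at_right[OF a_pos, of u p]
    floor_eventually_at_right[OF a_pos, of "w - of_int k" p]
  by eventually_elim (simp add: hop_def diff_diff_eq2)

text \<open>Points slightly to the left of p see the cells as closed on the right. Reflection turns
  these into cells closed on the left and changes the signs of \<open>u\<close>, \<open>w\<close>
  and \<open>k\<close>.\<close>

lemma hop_eventually_at_left:
  "eventually (\<lambda>s. hop u w k s \<longleftrightarrow> hop (- u) (- w) (- k) (- p)) (at_left p)"
  using floor_eventually_at_left[OF a_pos, of u p]
    floor_eventually_at_left[OF a_pos, of "w - of_int k" p]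
proof eventually_elim
  case (elim s)
  then have "hop u w k s \<longleftrightarrow> \<lfloor>(- p + u) / a\<rfloor> = \<lfloor>(- p + (w - of_int k)) / a\<rfloor>"
    unfolding hop_def diff_diff_eq2[symmetric] by auto
  then show ?case
    by (simp add: hop_def algebra_simps)
qed

text \<open>All words of length at most \<open>N\<close> in the four partial maps are defined at
  \<open>p\<close>. By \<open>hop_steps\<close> the bound k \<in> \<open>steps\<close> loses
  nothing, and it keeps the condition a finite combination of hop conditions, as limits and
  measurability require.\<close>

primrec good :: "nat \<Rightarrow> real \<Rightarrow> bool" where
  "good 0 p \<longleftrightarrow> True"
| "good (Suc N) p \<longleftrightarrow> (\<forall>(u, w)\<in>hops. \<exists>k\<in>steps. hop u w k p \<and> good N (p + of_int k))"

declare good.simps(2) [simp del]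

lemma good_antimono: "M \<le> N \<Longrightarrow> good N p \<Longrightarrow> good M p"
proof (induction M arbitrary: N p)
  case (Suc M)
  then obtain N' where N': "N = Suc N'" "M \<le> N'"
    by (metis Suc_le_D Suc_le_mono)
  have "\<exists>k\<in>steps. hop u w k p \<and> good M (p + of_int k)" if "(u, w) \<in> hops" for u w
    using Suc.prems(2) Suc.IH[OF N'(2)] that unfolding N'(1) good.simps(2) by blast
  then show ?case
    unfolding good.simps(2) by blast
qed simp_all

lemma good_periodic: "good N (p + of_int n * a) \<longleftrightarrow> good N p"
proof (induction N arbitrary: p)
  case (Suc N)
  have "good N (p + of_int n * a + of_int k) \<longleftrightarrow> good N (p + of_int k)" for k
    using Suc[of "p + of_int k"] by (simp only: ac_simps)
  then show ?case
    unfolding good.simps(2) hop_periodic by simp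
qed simp_all

lemma eventually_hops_steps:
  assumes "\<And>u w k. (u, w) \<in> hops \<Longrightarrow> k \<in> steps \<Longrightarrow> eventually (\<lambda>s. P u w k s) F"
  shows "eventually (\<lambda>s. \<forall>(u, w)\<in>hops. \<forall>k\<in>steps. P u w k s) F"
proof -
  have "finite hops"
    by (simp add: hops_def)
  then have "eventually (\<lambda>s. \<forall>uw\<in>hops. \<forall>k\<in>steps. P (fst uw) (snd uw) k s) F"
  proof (intro eventually_ball_finite ballI)
    fix uw k assume "uw \<in> hops" "k \<in> steps"
    then show "eventually (\<lambda>s. P (fst uw) (snd uw) k s) F"
      using assms[of "fst uw" "snd uw" k] by simp
  qed auto
  then show ?thesis
    by (rule eventually_mono) auto
qed

lemma good_eventually_at_right: "eventually (\<lambda>s. good N s \<longleftrightarrow> good N p) (at_right p)"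
proof (induction N arbitrary: p)
  case (Suc N)
  have "eventually (\<lambda>s. \<forall>(u, w)\<in>hops. \<forall>k\<in>steps. (hop u w k s \<longleftrightarrow> hop u w k p) \<and>
      (good N (s + of_int k) \<longleftrightarrow> good N (p + of_int k))) (at_right p)"
    using Suc[of "p + _"]
    by (intro eventually_hops_steps eventually_conj hop_eventually_at_right)
      (simp add: eventually_at_right_shift)
  then show ?case
  proof (rule eventually_mono)
    fix s
    assume "\<forall>(u, w)\<in>hops. \<forall>k\<in>steps. (hop u w k s \<longleftrightarrow> hop u w k p) \<and>
      (good N (s + of_int k) \<longleftrightarrow> good N (p + of_int k))"
    then have "(\<exists>k\<in>steps. hop u w k s \<and> good N (s + of_int k)) \<longleftrightarrow>
        (\<exists>k\<in>steps. hop u w k p \<and> good N (p + of_int k))" if "(u, w) \<in> hops" for u w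
      using that by blast
    then show "good (Suc N) s \<longleftrightarrow> good (Suc N) p"
      unfolding good.simps(2) by blast
  qed
qed simp_all

text \<open>The set of four hops is closed under (u, w) \<mapsto> (-u, -w), so a word started just
  left of \<open>p\<close> corresponds to the reflected word started at \<open>- p\<close>, with
  every step negated.\<close>

lemma good_eventually_at_left: "eventually (\<lambda>s. good N s \<longleftrightarrow> good N (- p)) (at_left p)"
proof (induction N arbitrary: p)
  case (Suc N)
  have "eventually (\<lambda>s. \<forall>(u, w)\<in>hops. \<forall>k\<in>steps. (hop u w k s \<longleftrightarrow> hop (- u) (- w) (- k) (- p)) \<and>
      (good N (s + of_int k) \<longleftrightarrow> good N (- p + of_int (- k)))) (at_left p)"
    using Suc[of "p + _"]
    by (intro eventually_hops_steps eventually_conj hop_eventually_at_left)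
      (simp add: eventually_at_left_shift)
  then show ?case
  proof (rule eventually_mono)
    fix s
    assume "\<forall>(u, w)\<in>hops. \<forall>k\<in>steps. (hop u w k s \<longleftrightarrow> hop (- u) (- w) (- k) (- p)) \<and>
      (good N (s + of_int k) \<longleftrightarrow> good N (- p + of_int (- k)))"
    then have step: "hop u w k s \<longleftrightarrow> hop (- u) (- w) (- k) (- p)"
      "good N (s + of_int k) \<longleftrightarrow> good N (- p + of_int (- k))"
      if "(u, w) \<in> hops" "k \<in> steps" for u w k
      using that by blast+
    show "good (Suc N) s \<longleftrightarrow> good (Suc N) (- p)"
    proof
      assume L: "good (Suc N) s"
      show "good (Suc N) (- p)"
        unfolding good.simps(2)
      proof (clarify)
        fix u w assume uw: "(u, w) \<in> hops"
        then obtain k where "k \<in> steps" "hop (- u) (- w) k s" "good N (s + of_int k)"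
          using L hops_uminus[OF uw] by (auto simp: good.simps(2))
        then show "\<exists>k\<in>steps. hop u w k (- p) \<and> good N (- p + of_int k)"
          using step[OF hops_uminus[OF uw], of k] by (intro bexI[of _ "- k"]) simp_all
      qed
    next
      assume R: "good (Suc N) (- p)"
      show "good (Suc N) s"
        unfolding good.simps(2)
      proof (clarify)
        fix u w assume uw: "(u, w) \<in> hops"
        then obtain k where "k \<in> steps" "hop (- u) (- w) k (- p)" "good N (- p + of_int k)"
          using R hops_uminus[OF uw] by (auto simp: good.simps(2))
        then show "\<exists>k\<in>steps. hop u w k s \<and> good N (s + of_int k)"
          using step[OF uw, of "- k"] by (intro bexI[of _ "- k"]) simp_all
      qed
    qed
  qed
qed simp_all

text \<open>Periodicity brings points that are good for larger and larger \<open>N\<close> into the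
  compact interval [0, a]. A monotone convergent subsequence approaches its limit l from one side:
  from the right, l is good for all \<open>N\<close>; from the left, l itself may fail, and the
  witness is -l.\<close>

lemma good_limit:
  assumes "\<And>N. \<exists>p. good N p"
  obtains p where "\<And>N. good N p"
proof -
  have "\<exists>p\<in>{0..a}. good N p" for N
  proof -
    obtain p where "good N p"
      using assms by blast
    then have "good N (p + of_int (- \<lfloor>p / a\<rfloor>) * a)"
      by (simp only: good_periodic)
    moreover have "p + of_int (- \<lfloor>p / a\<rfloor>) * a \<in> {0..a}"
      using floor_bounds[of p] by auto
    ultimately show ?thesis
      by blast
  qed
  then obtain q where q: "\<And>N. q N \<in> {0..a}" "\<And>N. good N (q N)"
    by metis
  obtain r where r: "strict_mono r" "monoseq (q \<circ> r)"
    using seq_monosub[of q] by (auto simp: o_def)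
  have "Bseq (q \<circ> r)"
    using q(1) by (intro BseqI'[where K = a]) (auto simp: abs_le_iff intro: order_trans)
  then have "convergent (q \<circ> r)"
    using r(2) by (rule Bseq_monoseq_convergent)
  then obtain l where l: "(q \<circ> r) \<longlonglongrightarrow> l"
    by (auto simp: convergent_def)
  have ev: "eventually (\<lambda>i. good N ((q \<circ> r) i)) sequentially" for N
    using good_antimono q(2) seq_suble[OF r(1)]
    by (intro eventually_sequentiallyI[of N]) (metis comp_apply order_trans)
  \<comment> \<open>If the subsequence hits l infinitely often, l inherits goodness directly;
    otherwise the approach is eventually strict and a one-sided limit applies.\<close>
  show ?thesis
  proof (cases "\<exists>\<^sub>F i in sequentially. (q \<circ> r) i = l")
    case True
    have "good N l" for N
      using frequently_eventually_frequently[OF True ev[of N]]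
      by (auto dest: frequently_ex)
    from that[OF this] show ?thesis .
  next
    case False
    then have ne: "eventually (\<lambda>i. (q \<circ> r) i \<noteq> l) sequentially"
      by (simp add: not_frequently)
    consider "\<And>i. (q \<circ> r) i \<ge> l" | "\<And>i. (q \<circ> r) i \<le> l"
      using monoseq_le[OF r(2) l] by blast
    then show ?thesis
    proof cases
      case 1
      then have "filterlim (q \<circ> r) (at_right l) sequentially"
        using l ne by (auto simp: filterlim_at elim!: eventually_mono simp: order_less_le)
      then have *: "eventually (\<lambda>i. good N ((q \<circ> r) i) \<longleftrightarrow> good N l) sequentially" for N
        using good_eventually_at_right by (rule eventually_compose_filterlim[rotated])
      have "eventually (\<lambda>i::nat. good N l) sequentially" for N
        using *[of N] ev[of N] by eventually_elim simp
      then have "good N l" for N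
        by simp
      from that[OF this] show ?thesis .
    next
      case 2
      then have "filterlim (q \<circ> r) (at_left l) sequentially"
        using l ne by (auto simp: filterlim_at elim!: eventually_mono simp: order_less_le)
      then have *: "eventually (\<lambda>i. good N ((q \<circ> r) i) \<longleftrightarrow> good N (- l)) sequentially" for N
        using good_eventually_at_left by (rule eventually_compose_filterlim[rotated])
      have "eventually (\<lambda>i::nat. good N (- l)) sequentially" for N
        using *[of N] ev[of N] by eventually_elim simp
      then have "good N (- l)" for N
        by simp
      from that[OF this] show ?thesis .
    qed
  qed
qed

end

section \<open>Symmetric invariant sets and hop-closed sets\<close>

context haar_gabor begin

text \<open>Including the inverse hops makes both partial translations bijections of
  \<open>Q\<close>, which matches the equalities, rather than inclusions, required of symmetric
  invariant sets.\<close>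

definition hop_closed :: "real set \<Rightarrow> bool" where
  "hop_closed Q \<longleftrightarrow> (\<forall>(u, w)\<in>hops. \<forall>p\<in>Q. \<exists>k. hop u w k p \<and> p + of_int k \<in> Q)"

section \<open>Domains of the hops in terms of positions modulo a\<close>

lemma frac_c_pos: "0 < frac c"
proof -
  have "c \<notin> \<int>"
  proof
    assume "c \<in> \<int>"
    then obtain n where "c = of_int n"
      by (rule Ints_cases)
    then have "c = of_nat (nat n)"
      using c_gt_1 by simp
    then show False
      using c_not_nat by (metis of_nat_in_Nats)
  qed
  then show ?thesis
    by (simp add: frac_gt_0_iff)
qed

lemma scaled_split: "p = a * of_int \<lfloor>p / a\<rfloor> + a * frac (p / a)"
  using a_pos by (simp add: frac_def right_diff_distrib)

lemma hop_0_iff: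
  "hop 0 w k p \<longleftrightarrow> 0 \<le> a * frac (p / a) + of_int k - w \<and> a * frac (p / a) + of_int k - w < a"
proof -
  have "of_int \<lfloor>p / a\<rfloor> * a = p - a * frac (p / a)"
    using scaled_split[of p] by (simp add: mult.commute)
  then show ?thesis
    unfolding hop_iff Let_def by auto
qed

lemma frac_scaled_shift: "frac ((p + z) / a) = frac (frac (p / a) + z / a)"
  by (rule frac_eqI_int_diff) (simp add: add_divide_distrib frac_def)

lemma hop_c_cases: "hop 0 c k p \<Longrightarrow> k = \<lfloor>c\<rfloor> \<or> k = \<lfloor>c\<rfloor> + 1"
  using hop_bounds[of 0 c k p] a_lt_1 frac_c_pos unfolding frac_def by linarith

lemma hop_minus_c_cases: "hop 0 (- c) k p \<Longrightarrow> k = - \<lfloor>c\<rfloor> \<or> k = - \<lfloor>c\<rfloor> - 1"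
  using hop_bounds[of 0 "- c" k p] a_lt_1 frac_c_pos unfolding frac_def by linarith

text \<open>This lemma and the next three identify the domains. With t = frac (p/a), the forward
  steps \<lfloor>c\<rfloor> and \<lfloor>c\<rfloor> + 1 are possible exactly for t in V and in U;
  the backward steps -\<lfloor>c\<rfloor> and -\<lfloor>c\<rfloor> - 1 exactly for 1 - t in the
  left-open versions of V and U.\<close>

lemma hop_floor_iff: "hop 0 c \<lfloor>c\<rfloor> p \<longleftrightarrow> frac c \<le> a * frac (p / a)"
  using frac_c_pos mult_strict_left_mono[OF frac_lt_1[of "p / a"] a_pos]
  unfolding hop_0_iff frac_def[of c] by (simp only: mult_1_right) linarith

lemma hop_floor_Suc_iff: "hop 0 c (\<lfloor>c\<rfloor> + 1) p \<longleftrightarrow> a * frac (p / a) < a + frac c - 1"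
  using frac_lt_1[of c] mult_nonneg_nonneg[OF less_imp_le[OF a_pos] frac_ge_0[of "p / a"]]
  unfolding hop_0_iff by (auto simp: frac_def[of c])

lemma hop_minus_floor_iff: "hop 0 (- c) (- \<lfloor>c\<rfloor>) p \<longleftrightarrow> a * frac (p / a) < a - frac c"
  using frac_c_pos mult_nonneg_nonneg[OF less_imp_le[OF a_pos] frac_ge_0[of "p / a"]]
  unfolding hop_0_iff by (auto simp: frac_def[of c])

lemma hop_minus_floor_Suc_iff: "hop 0 (- c) (- \<lfloor>c\<rfloor> - 1) p \<longleftrightarrow> 1 - frac c \<le> a * frac (p / a)"
  using frac_lt_1[of c] mult_strict_left_mono[OF frac_lt_1[of "p / a"] a_pos]
  unfolding hop_0_iff by (auto simp: frac_def[of c])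

section \<open>Identification of the hops with the two maps\<close>

context
  fixes x1 x2 \<alpha> :: real
  assumes x1_eq: "x1 = max ((a + frac c - 1) / a) 0"
    and x2_eq: "x2 = min (frac c / a) 1"
    and alpha_eq: "\<alpha> = (if x2 \<noteq> 1 then frac (of_int \<lfloor>c\<rfloor> / a) else frac (c / a))"
begin

text \<open>If a truncation in \<open>x1\<close> or \<open>x2\<close> is active, the corresponding
  interval U or V is empty and only the inequality survives; it still locates the hole.\<close>

lemma a_x1: "a + frac c - 1 \<le> a * x1" "0 < x1 \<Longrightarrow> a * x1 = a + frac c - 1"
  using a_pos by (auto simp: x1_eq max_def field_simps split: if_splits)

lemma a_x2: "a * x2 \<le> frac c" "x2 \<noteq> 1 \<Longrightarrow> a * x2 = frac c"
  using a_pos by (auto simp: x2_eq min_def field_simps split: if_splits)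

text \<open>This explains the two cases in \<alpha>. On U the rotation must be by
  (\<lfloor>c\<rfloor> + 1)/a modulo 1. If \<open>x2\<close> is not truncated, then x2 - x1 = (1 -
  a)/a, which adds 1/a to \<lfloor>c\<rfloor>/a modulo 1; if \<open>x2 = 1\<close>, then 1 - x1 = (1
  - frac c)/a, which must be added to c/a instead.\<close>

lemma alpha_shift_int:
  assumes "x1 > 0"
  shows "(of_int \<lfloor>c\<rfloor> + 1) / a - (\<alpha> + x2 - x1) \<in> \<int>"
proof (cases "x2 = 1")
  case True
  have "(of_int \<lfloor>c\<rfloor> + 1) / a - (\<alpha> + x2 - x1) = of_int \<lfloor>c / a\<rfloor>"
  proof -
    have "(of_int \<lfloor>c\<rfloor> + 1) / a + x1 = c / a + 1"
      using a_x1(2)[OF assms] a_pos by (simp add: frac_def field_simps)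
    then show ?thesis
      using True unfolding alpha_eq by (simp add: frac_def)
  qed
  then show ?thesis
    by simp
next
  case False
  then have "(of_int \<lfloor>c\<rfloor> + 1) / a - (\<alpha> + x2 - x1) = of_int (\<lfloor>of_int \<lfloor>c\<rfloor> / a\<rfloor> + 1)"
  proof -
    have "(of_int \<lfloor>c\<rfloor> + 1) / a - x2 + x1 = of_int \<lfloor>c\<rfloor> / a + 1"
      using a_x1(2)[OF assms] a_x2(2)[OF False] a_pos by (simp add: field_simps)
    then show ?thesis
      using False unfolding alpha_eq by (simp add: frac_def)
  qed
  then show ?thesis
    by (metis Ints_of_int)
qed

lemma alpha_int:
  assumes "x2 < 1" shows "of_int \<lfloor>c\<rfloor> / a - \<alpha> \<in> \<int>"
  using assms by (simp add: alpha_eq frac_def)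

text \<open>On U the hop has length \<lfloor>c\<rfloor> + 1 and on V it has length
  \<lfloor>c\<rfloor>; divided by \<open>a\<close> and taken modulo 1, these are the two rotations
  defining the map.\<close>

lemma Mmap_hop:
  assumes "frac (p / a) \<notin> {x1..<x2}"
  shows "\<exists>k. hop 0 c k p \<and> frac ((p + of_int k) / a) = Mmap \<alpha> x1 x2 (frac (p / a))"
proof -
  define t where "t = frac (p / a)"
  have t: "0 \<le> t" "t < 1"
    by (auto simp: t_def frac_lt_1)
  consider "t < x1" | "t \<ge> x2" "t \<ge> x1"
    using assms unfolding t_def[symmetric] by force
  then show ?thesis
  proof cases
    case 1
    then have "x1 > 0"
      using t by linarith
    have "a * t < a + frac c - 1"
      using mult_strict_left_mono[OF 1 a_pos] a_x1(2)[OF \<open>x1 > 0\<close>] by simp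
    moreover have "frac ((p + of_int (\<lfloor>c\<rfloor> + 1)) / a) = frac (t + \<alpha> + x2 - x1)"
    proof -
      have "t + of_int (\<lfloor>c\<rfloor> + 1) / a - (t + \<alpha> + x2 - x1) = (of_int \<lfloor>c\<rfloor> + 1) / a - (\<alpha> + x2 - x1)"
        by simp
      then show ?thesis
        unfolding frac_scaled_shift t_def[symmetric]
        by (intro frac_eqI_int_diff) (simp only: alpha_shift_int[OF \<open>x1 > 0\<close>])
    qed
    moreover have "Mmap \<alpha> x1 x2 t = frac (t + \<alpha> + x2 - x1)"
      using 1 t by (simp add: Mmap_def)
    ultimately show ?thesis
      unfolding t_def[symmetric]
      by (intro exI[of _ "\<lfloor>c\<rfloor> + 1"]) (simp only: hop_floor_Suc_iff t_def[symmetric])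
  next
    case 2
    then have "x2 < 1"
      using t by linarith
    then have "frac c \<le> a * t"
      using mult_left_mono[OF 2(1), of a] a_pos a_x2(2) by simp
    moreover have "frac ((p + of_int \<lfloor>c\<rfloor>) / a) = frac (t + \<alpha>)"
    proof -
      have "t + of_int \<lfloor>c\<rfloor> / a - (t + \<alpha>) = of_int \<lfloor>c\<rfloor> / a - \<alpha>"
        by simp
      then show ?thesis
        unfolding frac_scaled_shift t_def[symmetric]
        by (intro frac_eqI_int_diff) (simp only: alpha_int[OF \<open>x2 < 1\<close>])
    qed
    moreover have "Mmap \<alpha> x1 x2 t = frac (t + \<alpha>)"
      using 2 t by (simp add: Mmap_def)
    ultimately show ?thesis
      unfolding t_def[symmetric]
      by (intro exI[of _ "\<lfloor>c\<rfloor>"]) (simp only: hop_floor_iff t_def[symmetric])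
  qed
qed

lemma hop_c_not_hole:
  assumes "hop 0 c k p" shows "frac (p / a) \<notin> {x1..<x2}"
proof
  assume t: "frac (p / a) \<in> {x1..<x2}"
  then have "a * frac (p / a) < frac c" "a + frac c - 1 \<le> a * frac (p / a)"
  proof -
    have "a * x1 \<le> a * frac (p / a)" "a * frac (p / a) < a * x2"
      using t a_pos by simp_all
    then show "a * frac (p / a) < frac c" "a + frac c - 1 \<le> a * frac (p / a)"
      using a_x1(1) a_x2(1) by linarith+
  qed
  then show False
    using hop_c_cases[OF assms] assms hop_floor_iff[of p] hop_floor_Suc_iff[of p] by auto
qed

lemma frac_star_reflect: "1 - frac_star (1 - s) = frac s"
  by (simp add: frac_star_def)

text \<open>Conjugation by t \<mapsto> 1 - t reverses the rotations, replacing \<open>c\<close> by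
  \<open>- c\<close>, and turns the left-open intervals of the coherent map into the right-open ones
  on which the hops by \<open>- c\<close> are defined.\<close>

lemma Mmap_coherent_hop:
  assumes "1 - frac (p / a) \<notin> {x1<..x2}"
  shows "\<exists>k. hop 0 (- c) k p \<and>
    frac ((p + of_int k) / a) = 1 - Mmap_coherent \<alpha> x1 x2 (1 - frac (p / a))"
proof -
  define t where "t = frac (p / a)"
  have t: "0 \<le> t" "t < 1"
    by (auto simp: t_def frac_lt_1)
  consider "1 - t \<le> x1" | "1 - t > x2" "1 - t > x1"
    using assms unfolding t_def[symmetric] by force
  then show ?thesis
  proof cases
    case 1
    then have "x1 > 0"
      using t by linarith
    have "1 - frac c \<le> a * t"
      using mult_left_mono[OF 1, of a] a_pos a_x1(2)[OF \<open>x1 > 0\<close>] by (simp add: right_diff_distrib)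
    moreover have "frac ((p + of_int (- \<lfloor>c\<rfloor> - 1)) / a) = frac (t - \<alpha> - x2 + x1)"
    proof -
      have "t + of_int (- \<lfloor>c\<rfloor> - 1) / a - (t - \<alpha> - x2 + x1) = - ((of_int \<lfloor>c\<rfloor> + 1) / a - (\<alpha> + x2 - x1))"
        by (simp add: diff_divide_distrib add_divide_distrib)
      then show ?thesis
        unfolding frac_scaled_shift t_def[symmetric]
        by (intro frac_eqI_int_diff) (simp only: Ints_minus[OF alpha_shift_int[OF \<open>x1 > 0\<close>]])
    qed
    moreover have "Mmap_coherent \<alpha> x1 x2 (1 - t) = frac_star (1 - (t - \<alpha> - x2 + x1))"
    proof -
      have "1 - t \<in> {0<..x1}"
        using 1 t by simp
      moreover have "1 - t + \<alpha> + x2 - x1 = 1 - (t - \<alpha> - x2 + x1)"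
        by simp
      ultimately show ?thesis
        unfolding Mmap_coherent_def by (simp only: if_True)
    qed
    ultimately show ?thesis
      unfolding t_def[symmetric]
      by (intro exI[of _ "- \<lfloor>c\<rfloor> - 1"]) (simp only: hop_minus_floor_Suc_iff frac_star_reflect t_def[symmetric])
  next
    case 2
    then have "x2 < 1"
      using t by linarith
    have "a * t < a - frac c"
      using mult_strict_left_mono[OF 2(1) a_pos] a_x2(2) \<open>x2 < 1\<close> by (simp add: right_diff_distrib)
    moreover have "frac ((p + of_int (- \<lfloor>c\<rfloor>)) / a) = frac (t - \<alpha>)"
    proof -
      have "t + of_int (- \<lfloor>c\<rfloor>) / a - (t - \<alpha>) = - (of_int \<lfloor>c\<rfloor> / a - \<alpha>)"
        by simp
      then show ?thesis
        unfolding frac_scaled_shift t_def[symmetric]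
        by (intro frac_eqI_int_diff) (simp only: Ints_minus[OF alpha_int[OF \<open>x2 < 1\<close>]])
    qed
    moreover have "Mmap_coherent \<alpha> x1 x2 (1 - t) = frac_star (1 - (t - \<alpha>))"
    proof -
      have "1 - t \<notin> {0<..x1}" "1 - t \<notin> {x1<..x2}"
        using 2 by simp_all
      moreover have "1 - t + \<alpha> = 1 - (t - \<alpha>)"
        by simp
      ultimately show ?thesis
        unfolding Mmap_coherent_def by (simp only: if_False)
    qed
    ultimately show ?thesis
      unfolding t_def[symmetric]
      by (intro exI[of _ "- \<lfloor>c\<rfloor>"]) (simp only: hop_minus_floor_iff frac_star_reflect t_def[symmetric])
  qed
qed

lemma hop_minus_c_not_hole:
  assumes "hop 0 (- c) k p" shows "1 - frac (p / a) \<notin> {x1<..x2}"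
proof
  assume t: "1 - frac (p / a) \<in> {x1<..x2}"
  then have "a - frac c \<le> a * frac (p / a)" "a * frac (p / a) < 1 - frac c"
  proof -
    have "x1 < 1 - frac (p / a)" "1 - frac (p / a) \<le> x2"
      using t by (simp_all only: greaterThanAtMost_iff)
    then have "a * (1 - frac (p / a)) \<le> a * x2" "a * x1 < a * (1 - frac (p / a))"
      using a_pos by (simp_all only: mult_le_cancel_left_pos mult_less_cancel_left_pos)
    then show "a - frac c \<le> a * frac (p / a)" "a * frac (p / a) < 1 - frac c"
      using a_x1(1) a_x2(1) unfolding right_diff_distrib by linarith+
  qed
  then show False
    using hop_minus_c_cases[OF assms] assms unfolding not_less[symmetric]
    by (elim disjE) (simp_all only: hop_minus_floor_iff hop_minus_floor_Suc_iff not_less not_le)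
qed

text \<open>The reflection is moved from the set onto the map, so that both invariance conditions
  become image equations for the same set \<open>E\<close> and one argument serves both.\<close>

lemma sym_invariant_alt:
  "sym_invariant \<alpha> x1 x2 E \<longleftrightarrow> E \<subseteq> {0..<1} \<and> (\<forall>t\<in>E. t \<notin> {x1..<x2} \<and> 1 - t \<notin> {x1<..x2}) \<and>
     Mmap \<alpha> x1 x2 ` E = E \<and> (\<lambda>t. 1 - Mmap_coherent \<alpha> x1 x2 (1 - t)) ` E = E"
proof -
  have mem: "t \<in> reflect A \<longleftrightarrow> 1 - t \<in> A" for t A
  proof
    assume "1 - t \<in> A"
    then have "1 - (1 - t) \<in> reflect A"
      unfolding reflect_def by (rule imageI)
    then show "t \<in> reflect A"
      by simp
  qed (auto simp: reflect_def)
  have "(\<lambda>t. 1 - Mmap_coherent \<alpha> x1 x2 (1 - t)) ` E = reflect (Mmap_coherent \<alpha> x1 x2 ` reflect E)"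
    by (simp add: reflect_def image_image)
  then have "Mmap_coherent \<alpha> x1 x2 ` reflect E = reflect E \<longleftrightarrow>
      (\<lambda>t. 1 - Mmap_coherent \<alpha> x1 x2 (1 - t)) ` E = E"
    by (simp add: set_eq_iff mem) (metis diff_diff_eq2 add_diff_cancel_left')
  moreover have "E \<subseteq> {0..<1} - ({x1..<x2} \<union> reflect {x1<..x2}) \<longleftrightarrow>
      E \<subseteq> {0..<1} \<and> (\<forall>t\<in>E. t \<notin> {x1..<x2} \<and> 1 - t \<notin> {x1<..x2})"
    using mem[of _ "{x1<..x2}"] by blast
  ultimately show ?thesis
    unfolding sym_invariant_def by simp
qed

text \<open>The inclusion of the image of \<open>E\<close> in \<open>E\<close> yields the forward
  hop and surjectivity onto \<open>E\<close> the inverse hop. The map \<mu> stands for the given map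
  or for the reflected coherent map.\<close>

lemma invariant_imp_hop:
  assumes mu: "\<And>p. frac (p / a) \<in> E \<Longrightarrow> \<exists>k. hop u w k p \<and> frac ((p + of_int k) / a) = \<mu> (frac (p / a))"
    and E: "\<mu> ` E = E" "E \<subseteq> {0..<1}" and p: "frac (p / a) \<in> E"
  shows "\<exists>k. hop u w k p \<and> frac ((p + of_int k) / a) \<in> E"
    and "\<exists>k. hop w u k p \<and> frac ((p + of_int k) / a) \<in> E"
proof -
  show "\<exists>k. hop u w k p \<and> frac ((p + of_int k) / a) \<in> E"
    using mu[OF p] imageI[OF p, of \<mu>] E(1) by auto
  obtain t where t: "t \<in> E" "\<mu> t = frac (p / a)"
    using p E(1) by (metis (no_types, lifting) imageE)
  have ft: "frac (a * t / a) = t"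
    using t(1) E a_pos by (auto simp: frac_eq)
  then obtain k where k: "hop u w k (a * t)" "frac ((a * t + of_int k) / a) = frac (p / a)"
    using mu[of "a * t"] t by auto
  \<comment> \<open>The lift \<open>a * t\<close> of the preimage hops to a point that agrees with
    \<open>p\<close> only modulo \<open>a\<close>; after a shift by a multiple of \<open>a\<close>,
    under which hops are periodic, it hops to \<open>p\<close> itself.\<close>
  have "p / a - (a * t + of_int k) / a = of_int (\<lfloor>p / a\<rfloor> - \<lfloor>(a * t + of_int k) / a\<rfloor>)"
    using k(2) unfolding frac_def by simp
  then obtain n where n: "p / a - (a * t + of_int k) / a = of_int n"
    by blast
  then have p_eq: "p = a * t + of_int n * a + of_int k"
    using a_pos by (simp add: field_simps)
  have "hop w u (- k) p"
    using k(1) hop_inverse[of u w k "a * t + of_int n * a"] by (simp add: p_eq hop_periodic)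
  moreover have "frac ((p + of_int (- k)) / a) = frac (a * t / a)"
    using a_pos by (intro frac_eqI_int_diff) (simp add: p_eq add_divide_distrib)
  ultimately show "\<exists>k. hop w u k p \<and> frac ((p + of_int k) / a) \<in> E"
    using ft t(1) by (intro exI[of _ "- k"]) simp
qed

lemma sym_invariant_imp_hop_closed:
  assumes "sym_invariant \<alpha> x1 x2 E" shows "hop_closed {p. frac (p / a) \<in> E}"
proof -
  note E = assms[unfolded sym_invariant_alt]
  have c: "\<exists>k. hop 0 c k p \<and> frac ((p + of_int k) / a) = Mmap \<alpha> x1 x2 (frac (p / a))"
    if "frac (p / a) \<in> E" for p
    using that E by (intro Mmap_hop) blast
  have c': "\<exists>k. hop 0 (- c) k p \<and>
      frac ((p + of_int k) / a) = 1 - Mmap_coherent \<alpha> x1 x2 (1 - frac (p / a))"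
    if "frac (p / a) \<in> E" for p
    using that E by (intro Mmap_coherent_hop) blast
  show ?thesis
    unfolding hop_closed_def hops_def
    using invariant_imp_hop[OF c] invariant_imp_hop[where \<mu> = "\<lambda>t. 1 - Mmap_coherent \<alpha> x1 x2 (1 - t)", OF c'] E
    by auto
qed

lemma hop_imp_invariant:
  assumes mu: "\<And>p. p \<in> Q \<Longrightarrow> \<exists>k. hop u w k p \<and> frac ((p + of_int k) / a) = \<mu> (frac (p / a))"
    and Q: "\<And>p. p \<in> Q \<Longrightarrow> \<exists>k. hop u w k p \<and> p + of_int k \<in> Q"
      "\<And>p. p \<in> Q \<Longrightarrow> \<exists>k. hop w u k p \<and> p + of_int k \<in> Q"
  shows "\<mu> ` (\<lambda>p. frac (p / a)) ` Q = (\<lambda>p. frac (p / a)) ` Q"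
proof (intro equalityI subsetI; clarify)
  fix p assume "p \<in> Q"
  then obtain k where "hop u w k p" "p + of_int k \<in> Q"
    using Q by blast
  then show "\<mu> (frac (p / a)) \<in> (\<lambda>p. frac (p / a)) ` Q"
    using mu[OF \<open>p \<in> Q\<close>] hop_unique[of u w k p] by (force intro: image_eqI[of _ _ "p + of_int k"])
next
  fix p assume "p \<in> Q"
  then obtain k where k: "hop w u k p" "p + of_int k \<in> Q"
    using Q by blast
  then have "hop u w (- k) (p + of_int k)"
    using hop_inverse by blast
  then have "frac (p / a) = \<mu> (frac ((p + of_int k) / a))"
    using mu[OF k(2)] hop_unique[of u w "- k" "p + of_int k"] by force
  then show "frac (p / a) \<in> \<mu> ` (\<lambda>p. frac (p / a)) ` Q"
    using k by blast
qed

lemma hop_closed_imp_sym_invariant: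
  assumes "hop_closed Q"
  shows "sym_invariant \<alpha> x1 x2 ((\<lambda>p. frac (p / a)) ` Q)"
proof -
  have Q: "\<exists>k. hop u w k p \<and> p + of_int k \<in> Q" if "(u, w) \<in> hops" "p \<in> Q" for u w p
    using assms that by (auto simp: hop_closed_def)
  have h: "frac (p / a) \<notin> {x1..<x2}" "1 - frac (p / a) \<notin> {x1<..x2}" if "p \<in> Q" for p
    using Q[of 0 c p] Q[of 0 "- c" p] that hop_c_not_hole hop_minus_c_not_hole
    by (auto simp: hops_def)
  have "Mmap \<alpha> x1 x2 ` (\<lambda>p. frac (p / a)) ` Q = (\<lambda>p. frac (p / a)) ` Q"
    by (rule hop_imp_invariant[where u = 0 and w = c]) (auto simp: hops_def intro!: Mmap_hop Q h)
  moreover have "(\<lambda>t. 1 - Mmap_coherent \<alpha> x1 x2 (1 - t)) ` (\<lambda>p. frac (p / a)) ` Q = (\<lambda>p. frac (p / a)) ` Q"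
    by (rule hop_imp_invariant[where u = 0 and w = "- c"])
      (auto simp: hops_def intro!: Mmap_coherent_hop Q h)
  ultimately show ?thesis
    unfolding sym_invariant_alt using h by (auto simp: frac_lt_1)
qed

text \<open>From left to right, \<open>Q\<close> is the full preimage of the maximal set under p
  \<mapsto> frac (p/a), hence periodic; from right to left, the positions of \<open>Q\<close> modulo
  \<open>a\<close> form a symmetric invariant set.\<close>

lemma sym_max_invariant_set_nonempty_iff:
  "sym_max_invariant_set \<alpha> x1 x2 \<noteq> {} \<longleftrightarrow> (\<exists>Q. hop_closed Q \<and> Q \<noteq> {} \<and> (\<forall>p n. p + of_int n * a \<in> Q \<longleftrightarrow> p \<in> Q))"
proof
  let ?E = "sym_max_invariant_set \<alpha> x1 x2"
  assume "?E \<noteq> {}"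
  then obtain t where t: "t \<in> ?E"
    by blast
  have inv: "sym_invariant \<alpha> x1 x2 ?E"
    by (rule sym_invariant_sym_max_invariant_set)
  then have "frac (a * t / a) = t"
    using t a_pos by (auto simp: frac_eq sym_invariant_alt)
  moreover have "frac ((p + of_int n * a) / a) = frac (p / a)" for p n
    using a_pos by (intro frac_eqI_int_diff) (simp add: add_divide_distrib)
  ultimately show "\<exists>Q. hop_closed Q \<and> Q \<noteq> {} \<and> (\<forall>p n. p + of_int n * a \<in> Q \<longleftrightarrow> p \<in> Q)"
    using sym_invariant_imp_hop_closed[OF inv] t
    by (intro exI[of _ "{p. frac (p / a) \<in> ?E}"] conjI) (auto simp del: nonzero_mult_div_cancel_left
        nonzero_mult_div_cancel_right intro!: exI[of _ "a * t"])
next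
  assume "\<exists>Q. hop_closed Q \<and> Q \<noteq> {} \<and> (\<forall>p n. p + of_int n * a \<in> Q \<longleftrightarrow> p \<in> Q)"
  then obtain Q where "hop_closed Q" "Q \<noteq> {}"
    by blast
  then show "sym_max_invariant_set \<alpha> x1 x2 \<noteq> {}"
    using sym_max_invariant_set_greatest[OF hop_closed_imp_sym_invariant] by blast
qed

end

text \<open>A priori the step k depends on \<open>N\<close>; uniqueness of hops makes it the same
  for all \<open>N\<close>, so the target is again good for all \<open>N\<close>.\<close>

lemma hop_closed_good: "hop_closed {p. \<forall>N. good N p}"
  unfolding hop_closed_def
proof clarify
  fix u w p assume uw: "(u, w) \<in> hops" and p: "\<forall>N. good N p"
  have *: "\<exists>k. hop u w k p \<and> good N (p + of_int k)" for N
    using p[rule_format, of "Suc N"] uw by (auto simp: good.simps(2))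
  then obtain k where k: "hop u w k p"
    by blast
  have "good N (p + of_int k)" for N
    using *[of N] hop_unique[OF k] by auto
  then show "\<exists>k. hop u w k p \<and> p + of_int k \<in> {p. \<forall>N. good N p}"
    using k by blast
qed

lemma hop_closed_good_bound:
  assumes "\<And>Q. hop_closed Q \<Longrightarrow> (\<And>p n. p + of_int n * a \<in> Q \<longleftrightarrow> p \<in> Q) \<Longrightarrow> Q = {}"
  obtains N where "\<And>p. \<not> good N p"
proof -
  have "{p. \<forall>N. good N p} = {}"
    by (rule assms[OF hop_closed_good]) (simp add: good_periodic)
  then have "\<not> (\<forall>N. \<exists>p. good N p)"
    using good_limit by blast
  then show ?thesis
    using that by blast
qed

end

section \<open>The energy estimate\<close>

context haar_gabor begin

lemma pred_hop [measurable]: "Measurable.pred borel (\<lambda>p. hop u w k p)"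
  unfolding hop_def by measurable

lemma pred_good [measurable]: "Measurable.pred borel (\<lambda>p. good N p)"
proof (induction N)
  case (Suc N)
  have [measurable]: "Measurable.pred borel (\<lambda>p. good N (p + of_int k))" for k
    using measurable_compose[OF _ Suc, of "\<lambda>p. p + of_int k" borel] by simp
  have "Measurable.pred borel (\<lambda>p. \<exists>k\<in>steps. hop u w k p \<and> good N (p + of_int k))" for u w
    by (intro pred_intros_finite) (simp, measurable)
  then show ?case
    by (simp add: good.simps(2) hops_def)
qed simp

section \<open>Integration along partial translations\<close>

lemma hop_sum_eq:
  assumes "hop u w k p" "k \<in> steps"
  shows "(\<Sum>j\<in>steps. if hop u w j p then X j else 0) = X k"
proof -
  have "hop u w j p \<longleftrightarrow> j = k" for j
    using hop_unique[OF assms(1)] assms(1) by blast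
  then show ?thesis
    using assms(2) by simp
qed

text \<open>A sum over \<open>steps\<close> guarded by \<open>hop\<close> has at most one term. It
  encodes the value at the image of \<open>p\<close> under the partial map, read as 0 off the
  domain, without choosing an image.\<close>

lemma hop_sum_cases:
  fixes X :: "int \<Rightarrow> 'b::comm_monoid_add"
  assumes "(u, w) \<in> hops"
  obtains k where "hop u w k p" "k \<in> steps"
      "\<And>X. (\<Sum>j\<in>steps. if hop u w j p then X j else 0) = (X k :: 'b)"
  | "\<not> (\<exists>k. hop u w k p)" "\<And>X. (\<Sum>j\<in>steps. if hop u w j p then X j else 0) = (0 :: 'b)"
proof (cases "\<exists>k. hop u w k p")
  case True
  then obtain k where k: "hop u w k p"
    by blast
  then have "k \<in> steps"
    using hop_steps[OF assms] by blast
  then show ?thesis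
    using that(1)[OF k] hop_sum_eq[OF k] by blast
next
  case False
  then show ?thesis
    using that(2) by simp
qed

text \<open>Change of variables: on each piece of its domain a hop is a translation by an integer,
  and the inverse hop translates the image piece back.\<close>

lemma nn_integral_hop_swap:
  fixes f :: "real \<Rightarrow> real \<Rightarrow> ennreal"
  assumes f: "\<And>k. (\<lambda>p. f p (p + of_int k)) \<in> borel_measurable borel"
  shows "(\<integral>\<^sup>+p. (\<Sum>k\<in>steps. if hop u w k p then f p (p + of_int k) else 0) \<partial>lborel) =
    (\<integral>\<^sup>+p. (\<Sum>k\<in>steps. if hop w u k p then f (p + of_int k) p else 0) \<partial>lborel)"
proof -
  have f': "(\<lambda>p. f (p + of_int k) p) \<in> borel_measurable borel" for k
    using measurable_compose[OF _ f[of "- k"], of "\<lambda>p. p + of_int k" borel] by simp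
  have meas: "(\<lambda>p. if hop u w k p then f p (p + of_int k) else 0) \<in> borel_measurable borel" for k
    using f[of k] by measurable
  have meas': "(\<lambda>p. if hop w u k p then f (p + of_int k) p else 0) \<in> borel_measurable borel" for k
    using f'[of k] by measurable
  have "(\<integral>\<^sup>+p. (\<Sum>k\<in>steps. if hop u w k p then f p (p + of_int k) else 0) \<partial>lborel) =
      (\<Sum>k\<in>steps. \<integral>\<^sup>+p. (if hop u w k p then f p (p + of_int k) else 0) \<partial>lborel)"
    using meas by (intro nn_integral_sum) simp
  also have "\<dots> = (\<Sum>k\<in>steps. \<integral>\<^sup>+p. (if hop w u (- k) p then f (p + of_int (- k)) p else 0) \<partial>lborel)"
  proof (intro sum.cong refl)
    fix k
    have pk: "p + of_int k + of_int (- k) = p" for p :: real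
      by simp
    have "(\<integral>\<^sup>+p. (if hop w u (- k) p then f (p + of_int (- k)) p else 0) \<partial>lborel) =
        (\<integral>\<^sup>+p. (if hop w u (- k) (p + of_int k) then f (p + of_int k + of_int (- k)) (p + of_int k) else 0) \<partial>lborel)"
      by (subst nn_integral_shift[OF meas']) simp
    also have "\<dots> = (\<integral>\<^sup>+p. (if hop u w k p then f p (p + of_int k) else 0) \<partial>lborel)"
      unfolding hop_inverse[of u w k] pk ..
    finally show "(\<integral>\<^sup>+p. (if hop u w k p then f p (p + of_int k) else 0) \<partial>lborel) =
      (\<integral>\<^sup>+p. (if hop w u (- k) p then f (p + of_int (- k)) p else 0) \<partial>lborel)" ..
  qed
  also have "\<dots> = (\<Sum>k\<in>steps. \<integral>\<^sup>+p. (if hop w u k p then f (p + of_int k) p else 0) \<partial>lborel)"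
    by (rule sum.reindex_bij_witness[of _ uminus uminus]) auto
  also have "\<dots> = (\<integral>\<^sup>+p. (\<Sum>k\<in>steps. if hop w u k p then f (p + of_int k) p else 0) \<partial>lborel)"
    using meas' by (intro nn_integral_sum[symmetric]) simp
  finally show ?thesis .
qed

definition second_difference :: "(real \<Rightarrow> complex) \<Rightarrow> real \<Rightarrow> complex" where
  "second_difference v p = 2 * v p
     - (\<Sum>k\<in>steps. if hop 0 c k p then v (p + of_int k) else 0)
     - (\<Sum>k\<in>steps. if hop 0 (- c) k p then v (p + of_int k) else 0)"

context
  fixes v :: "real \<Rightarrow> complex"
  assumes v_meas [measurable]: "v \<in> borel_measurable borel"
    and v_finite: "(\<integral>\<^sup>+p. ennreal ((cmod (v p))\<^sup>2) \<partial>lborel) < \<infinity>"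
begin

definition lost :: "real \<Rightarrow> real \<Rightarrow> ennreal" where
  "lost u w = (\<integral>\<^sup>+p. (if \<exists>k\<in>steps. hop u w k p then 0 else ennreal ((cmod (v p))\<^sup>2)) \<partial>lborel)"

definition jump :: "real \<Rightarrow> real \<Rightarrow> ennreal" where
  "jump u w = (\<integral>\<^sup>+p. (\<Sum>k\<in>steps. if hop u w k p then ennreal ((cmod (v p - v (p + of_int k)))\<^sup>2) else 0) \<partial>lborel)"

definition bad_mass :: "nat \<Rightarrow> ennreal" where
  "bad_mass N = (\<integral>\<^sup>+p. (if good N p then 0 else ennreal ((cmod (v p))\<^sup>2)) \<partial>lborel)"

text \<open>Only the \<open>lost\<close> terms occur for all four hops: by \<open>jump_swap\<close>
  the \<open>jump\<close> of an inverse hop equals that of the hop.\<close>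

definition defect :: ennreal where
  "defect = lost 0 c + jump 0 c + lost 0 (- c) + jump 0 (- c) + lost c 0 + lost (- c) 0"

lemma pred_dom [measurable]: "Measurable.pred borel (\<lambda>p. \<exists>k\<in>steps. hop u w k p)"
  by (intro pred_intros_finite) (simp, measurable)

lemma jump_swap: "jump u w = jump w u"
  unfolding jump_def
proof (subst nn_integral_hop_swap)
  show "(\<lambda>p. ennreal ((cmod (v p - v (p + of_int k)))\<^sup>2)) \<in> borel_measurable borel" for k
    by measurable
qed (subst norm_minus_commute, rule refl)

text \<open>The points reached by a hop are exactly the domain of the inverse hop, and each is
  reached once; the remaining mass is what the inverse hop loses.\<close>

lemma arrived_add_lost:
  assumes "(u, w) \<in> hops"
  shows "(\<integral>\<^sup>+p. (\<Sum>k\<in>steps. if hop u w k p then ennreal ((cmod (v (p + of_int k)))\<^sup>2) else 0) \<partial>lborel) + lost w u =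
    (\<integral>\<^sup>+p. ennreal ((cmod (v p))\<^sup>2) \<partial>lborel)"
proof -
  have "(\<integral>\<^sup>+p. (\<Sum>k\<in>steps. if hop u w k p then ennreal ((cmod (v (p + of_int k)))\<^sup>2) else 0) \<partial>lborel) =
      (\<integral>\<^sup>+p. (\<Sum>k\<in>steps. if hop w u k p then ennreal ((cmod (v p))\<^sup>2) else 0) \<partial>lborel)"
    by (rule nn_integral_hop_swap) measurable
  moreover have "(\<Sum>k\<in>steps. if hop w u k p then ennreal ((cmod (v p))\<^sup>2) else 0) +
      (if \<exists>k\<in>steps. hop w u k p then 0 else ennreal ((cmod (v p))\<^sup>2)) = ennreal ((cmod (v p))\<^sup>2)" for p
    by (rule hop_sum_cases[OF hops_swap[OF assms], where ?'b = ennreal and p = p]) auto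
  ultimately show ?thesis
    unfolding lost_def by (simp add: nn_integral_add[symmetric])
qed

lemma lost_jump_eq:
  assumes "(u, w) \<in> hops"
  shows "lost u w + jump u w =
    (\<integral>\<^sup>+p. ennreal ((cmod (v p - (\<Sum>k\<in>steps. if hop u w k p then v (p + of_int k) else 0)))\<^sup>2) \<partial>lborel)"
proof -
  have "(if \<exists>k\<in>steps. hop u w k p then 0 else ennreal ((cmod (v p))\<^sup>2)) +
      (\<Sum>k\<in>steps. if hop u w k p then ennreal ((cmod (v p - v (p + of_int k)))\<^sup>2) else 0) =
      ennreal ((cmod (v p - (\<Sum>k\<in>steps. if hop u w k p then v (p + of_int k) else 0)))\<^sup>2)" for p
  proof (rule hop_sum_cases[OF assms, where ?'b = complex and p = p])
    fix k assume k: "hop u w k p" "k \<in> steps"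
    then show ?thesis
      unfolding hop_sum_eq[OF k] by auto
  next
    assume k: "\<not> (\<exists>k. hop u w k p)"
    then show ?thesis
      by simp
  qed
  then show ?thesis
    unfolding lost_def jump_def by (subst nn_integral_add[symmetric]) simp_all
qed

text \<open>With \<open>F w\<close> the transport of \<open>v\<close> along the hop to
  \<open>w\<close>, expanding the squares of \<open>v - F c\<close> and \<open>v - F (- c)\<close>
  and using that the mass of \<open>F w\<close> is that of \<open>v\<close> minus
  \<open>lost w 0\<close> shows that \<open>defect\<close> is twice the real inner product of
  \<open>v\<close> and the second difference. Young's inequality with weight \<epsilon> bounds it.
  To avoid subtraction in the extended reals, twice the mass of \<open>v\<close> stays on both sides
  until the end.\<close>

lemma defect_le:
  assumes "\<epsilon> > 0"
  shows "defect \<le> ennreal \<epsilon> * (\<integral>\<^sup>+p. ennreal ((cmod (v p))\<^sup>2) \<partial>lborel) +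
    ennreal (1 / \<epsilon>) * (\<integral>\<^sup>+p. ennreal ((cmod (second_difference v p))\<^sup>2) \<partial>lborel)"
proof -
  define F where "F w p = (\<Sum>k\<in>steps. if hop 0 w k p then v (p + of_int k) else 0)" for w p
  define D where "D p = second_difference v p" for p
  have D: "D p = 2 * v p - F c p - F (- c) p" for p
    by (simp add: D_def F_def second_difference_def)
  have [measurable]: "F w \<in> borel_measurable borel" for w
    unfolding F_def by measurable
  have [measurable]: "D \<in> borel_measurable borel"
    unfolding D[abs_def] by measurable
  have h: "(0, c) \<in> hops" "(0, - c) \<in> hops"
    by (auto simp: hops_def)
  let ?V = "\<integral>\<^sup>+p. ennreal ((cmod (v p))\<^sup>2) \<partial>lborel"
  let ?D = "\<integral>\<^sup>+p. ennreal ((cmod (D p))\<^sup>2) \<partial>lborel"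
  let ?F = "\<lambda>w. \<integral>\<^sup>+p. ennreal ((cmod (F w p))\<^sup>2) \<partial>lborel"
  have F: "?F w + lost w 0 = ?V" if "(0, w) \<in> hops" for w
  proof -
    have "ennreal ((cmod (F w p))\<^sup>2) =
        (\<Sum>k\<in>steps. if hop 0 w k p then ennreal ((cmod (v (p + of_int k)))\<^sup>2) else 0)" for p
    proof (rule hop_sum_cases[OF that, where ?'b = complex and p = p])
      fix k assume k: "hop 0 w k p" "k \<in> steps"
      show ?thesis
        unfolding F_def hop_sum_eq[OF k] by (rule refl)
    qed (auto simp: F_def)
    then show ?thesis
      using arrived_add_lost[OF that] by simp
  qed
  have "(cmod (v p - F c p))\<^sup>2 + (cmod (v p - F (- c) p))\<^sup>2 + 2 * (cmod (v p))\<^sup>2 \<le>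
      (cmod (F c p))\<^sup>2 + (cmod (F (- c) p))\<^sup>2 + \<epsilon> * (cmod (v p))\<^sup>2 + (1 / \<epsilon>) * (cmod (D p))\<^sup>2" for p
  proof -
    have sq: "(cmod (x - y))\<^sup>2 = (cmod x)\<^sup>2 + (cmod y)\<^sup>2 - 2 * (x \<bullet> y)" for x y :: complex
      unfolding power2_norm_eq_inner by (simp add: inner_diff_left inner_diff_right inner_commute)
    \<comment> \<open>Young's inequality, in the form that the square of the norm of sqrt \<epsilon>
      v - D / sqrt \<epsilon> is nonnegative.\<close>
    have "2 * (v p \<bullet> D p) \<le> \<epsilon> * (cmod (v p))\<^sup>2 + (1 / \<epsilon>) * (cmod (D p))\<^sup>2"
    proof -
      have "0 \<le> (cmod (sqrt \<epsilon> *\<^sub>R v p - (1 / sqrt \<epsilon>) *\<^sub>R D p))\<^sup>2"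
        by simp
      then show ?thesis
        unfolding sq using assms by (simp add: power_mult_distrib power_divide)
    qed
    moreover have "v p \<bullet> D p = 2 * (cmod (v p))\<^sup>2 - v p \<bullet> F c p - v p \<bullet> F (- c) p"
    proof -
      have "D p = 2 *\<^sub>R v p - F c p - F (- c) p"
        by (simp add: D scaleR_conv_of_real)
      then show ?thesis
        by (simp add: inner_diff_right power2_norm_eq_inner)
    qed
    ultimately show ?thesis
      unfolding sq by linarith
  qed
  then have "ennreal ((cmod (v p - F c p))\<^sup>2) + ennreal ((cmod (v p - F (- c) p))\<^sup>2) + 2 * ennreal ((cmod (v p))\<^sup>2) \<le>
      ennreal ((cmod (F c p))\<^sup>2) + ennreal ((cmod (F (- c) p))\<^sup>2) + ennreal \<epsilon> * ennreal ((cmod (v p))\<^sup>2)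
        + ennreal (1 / \<epsilon>) * ennreal ((cmod (D p))\<^sup>2)" for p
    using assms by (simp add: ennreal_plus[symmetric] ennreal_mult[symmetric]
        ennreal_numeral[symmetric] del: ennreal_plus ennreal_numeral)
  then have "(\<integral>\<^sup>+p. ennreal ((cmod (v p - F c p))\<^sup>2) + ennreal ((cmod (v p - F (- c) p))\<^sup>2) + 2 * ennreal ((cmod (v p))\<^sup>2) \<partial>lborel) \<le>
      (\<integral>\<^sup>+p. ennreal ((cmod (F c p))\<^sup>2) + ennreal ((cmod (F (- c) p))\<^sup>2) + ennreal \<epsilon> * ennreal ((cmod (v p))\<^sup>2)
        + ennreal (1 / \<epsilon>) * ennreal ((cmod (D p))\<^sup>2) \<partial>lborel)"
    by (intro nn_integral_mono)
  then have "(lost 0 c + jump 0 c) + (lost 0 (- c) + jump 0 (- c)) + 2 * ?V \<le>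
      ?F c + ?F (- c) + ennreal \<epsilon> * ?V + ennreal (1 / \<epsilon>) * ?D"
    unfolding lost_jump_eq[OF h(1)] lost_jump_eq[OF h(2)] F_def[symmetric]
    by (simp add: nn_integral_add nn_integral_cmult)
  then have "(lost 0 c + jump 0 c) + (lost 0 (- c) + jump 0 (- c)) + 2 * ?V + (lost c 0 + lost (- c) 0) \<le>
      ?F c + ?F (- c) + ennreal \<epsilon> * ?V + ennreal (1 / \<epsilon>) * ?D + (lost c 0 + lost (- c) 0)"
    by (rule add_right_mono)
  also have "\<dots> = (?F c + lost c 0) + (?F (- c) + lost (- c) 0) + (ennreal \<epsilon> * ?V + ennreal (1 / \<epsilon>) * ?D)"
    by (simp only: ac_simps)
  also have "\<dots> = 2 * ?V + (ennreal \<epsilon> * ?V + ennreal (1 / \<epsilon>) * ?D)"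
    unfolding F[OF h(1)] F[OF h(2)] by (simp add: mult_2)
  finally have "2 * ?V + defect \<le> 2 * ?V + (ennreal \<epsilon> * ?V + ennreal (1 / \<epsilon>) * ?D)"
    unfolding defect_def by (simp only: ac_simps)
  \<comment> \<open>Finite mass is what allows the common summand to be cancelled.\<close>
  moreover have "2 * ?V < \<infinity>"
    using v_finite by (simp add: ennreal_mult_less_top)
  ultimately show ?thesis
    unfolding D_def by (auto simp: ennreal_add_left_cancel_le)
qed

text \<open>Either the hop is undefined at \<open>p\<close>, which \<open>lost\<close> accounts for,
  or it leads to a bad point q, and the value at \<open>p\<close> is compared with the value at q at
  the cost of a \<open>jump\<close>. Hops are injective, so each bad q is counted at most
  once.\<close>

lemma bad_step:
  assumes "(u, w) \<in> hops"
  shows "(\<integral>\<^sup>+p. (if \<exists>k\<in>steps. hop u w k p \<and> good N (p + of_int k) then 0 else ennreal ((cmod (v p))\<^sup>2)) \<partial>lborel)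
    \<le> lost u w + 2 * jump u w + 2 * bad_mass N"
proof -
  have [measurable]: "Measurable.pred borel (\<lambda>p. good N (p + of_int k))" for k
    using measurable_compose[OF _ pred_good, of "\<lambda>p. p + of_int k" borel] by simp
  have [measurable]: "(\<lambda>p. if good N (p + of_int k) then 0 else ennreal ((cmod (v (p + of_int k)))\<^sup>2)) \<in> borel_measurable borel" for k
    by measurable
  have split: "ennreal ((cmod x)\<^sup>2) \<le> 2 * ennreal ((cmod (x - y))\<^sup>2) + 2 * ennreal ((cmod y)\<^sup>2)" for x y :: complex
  proof -
    have "(cmod x)\<^sup>2 \<le> 2 * (cmod (x - y))\<^sup>2 + 2 * (cmod y)\<^sup>2"
      using norm_add_square_le[of "x - y" y] by simp
    then show ?thesis
      by (simp add: ennreal_plus[symmetric] ennreal_mult[symmetric]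
        ennreal_numeral[symmetric] del: ennreal_plus ennreal_numeral)
  qed
  have "(if \<exists>k\<in>steps. hop u w k p \<and> good N (p + of_int k) then 0 else ennreal ((cmod (v p))\<^sup>2)) \<le>
      (if \<exists>k\<in>steps. hop u w k p then 0 else ennreal ((cmod (v p))\<^sup>2)) +
      2 * (\<Sum>k\<in>steps. if hop u w k p then ennreal ((cmod (v p - v (p + of_int k)))\<^sup>2) else 0) +
      2 * (\<Sum>k\<in>steps. if hop u w k p then (if good N (p + of_int k) then 0 else ennreal ((cmod (v (p + of_int k)))\<^sup>2)) else 0)" for p
    by (rule hop_sum_cases[OF assms, where ?'b = ennreal and p = p]) (auto intro: split)
  then have "(\<integral>\<^sup>+p. (if \<exists>k\<in>steps. hop u w k p \<and> good N (p + of_int k) then 0 else ennreal ((cmod (v p))\<^sup>2)) \<partial>lborel)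
      \<le> (\<integral>\<^sup>+p. (if \<exists>k\<in>steps. hop u w k p then 0 else ennreal ((cmod (v p))\<^sup>2)) +
      2 * (\<Sum>k\<in>steps. if hop u w k p then ennreal ((cmod (v p - v (p + of_int k)))\<^sup>2) else 0) +
      2 * (\<Sum>k\<in>steps. if hop u w k p then (if good N (p + of_int k) then 0 else ennreal ((cmod (v (p + of_int k)))\<^sup>2)) else 0) \<partial>lborel)"
    by (intro nn_integral_mono)
  also have "\<dots> = lost u w + 2 * jump u w + 2 * (\<integral>\<^sup>+p. (\<Sum>k\<in>steps. if hop u w k p then
      (if good N (p + of_int k) then 0 else ennreal ((cmod (v (p + of_int k)))\<^sup>2)) else 0) \<partial>lborel)"
    unfolding lost_def jump_def by (simp add: nn_integral_add nn_integral_cmult)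
  also have "(\<integral>\<^sup>+p. (\<Sum>k\<in>steps. if hop u w k p then
      (if good N (p + of_int k) then 0 else ennreal ((cmod (v (p + of_int k)))\<^sup>2)) else 0) \<partial>lborel) =
      (\<integral>\<^sup>+p. (\<Sum>k\<in>steps. if hop w u k p then (if good N p then 0 else ennreal ((cmod (v p))\<^sup>2)) else 0) \<partial>lborel)"
    by (rule nn_integral_hop_swap) measurable
  also have "\<dots> \<le> bad_mass N"
    unfolding bad_mass_def
  proof (rule nn_integral_mono)
    fix p
    show "(\<Sum>k\<in>steps. if hop w u k p then (if good N p then 0 else ennreal ((cmod (v p))\<^sup>2)) else 0) \<le>
        (if good N p then 0 else ennreal ((cmod (v p))\<^sup>2))"
      by (rule hop_sum_cases[OF hops_swap[OF assms], where ?'b = ennreal and p = p]) auto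
  qed
  finally show ?thesis
    by (simp add: add_left_mono mult_left_mono)
qed

text \<open>A point that is bad at \<open>N + 1\<close> fails for one of four hops. Summing
  \<open>bad_step\<close> over them gives at most 4 \<open>defect\<close> + 8
  \<open>bad_mass N\<close>, since each \<open>jump\<close> occurs with total factor 4; the constant
  12 = 4 + 8 absorbs both terms.\<close>

lemma bad_mass_le: "bad_mass N \<le> of_nat (12 ^ N) * defect"
proof (induction N)
  case 0
  then show ?case
    by (simp add: bad_mass_def)
next
  case (Suc N)
  let ?f = "\<lambda>u w p. (if \<exists>k\<in>steps. hop u w k p \<and> good N (p + of_int k) then 0 else ennreal ((cmod (v p))\<^sup>2))"
  have [measurable]: "Measurable.pred borel (\<lambda>p. good N (p + of_int k))" for k
    using measurable_compose[OF _ pred_good, of "\<lambda>p. p + of_int k" borel] by simp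
  have [measurable]: "Measurable.pred borel (\<lambda>p. \<exists>k\<in>steps. hop u w k p \<and> good N (p + of_int k))" for u w
    by (intro pred_intros_finite) (simp, measurable)
  have "bad_mass (Suc N) \<le> (\<integral>\<^sup>+p. ?f 0 c p + ?f 0 (- c) p + ?f c 0 p + ?f (- c) 0 p \<partial>lborel)"
    unfolding bad_mass_def
    by (intro nn_integral_mono) (auto simp: good.simps(2) hops_def ac_simps intro: add_increasing)
  also have "\<dots> = (\<integral>\<^sup>+p. ?f 0 c p \<partial>lborel) + (\<integral>\<^sup>+p. ?f 0 (- c) p \<partial>lborel) +
      (\<integral>\<^sup>+p. ?f c 0 p \<partial>lborel) + (\<integral>\<^sup>+p. ?f (- c) 0 p \<partial>lborel)"
    by (simp add: nn_integral_add)
  also have "\<dots> \<le> (lost 0 c + 2 * jump 0 c + 2 * bad_mass N) + (lost 0 (- c) + 2 * jump 0 (- c) + 2 * bad_mass N) +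
      (lost c 0 + 2 * jump 0 c + 2 * bad_mass N) + (lost (- c) 0 + 2 * jump 0 (- c) + 2 * bad_mass N)"
    using bad_step[of 0 c N] bad_step[of 0 "- c" N] bad_step[of c 0 N] bad_step[of "- c" 0 N]
    unfolding jump_swap[of c 0] jump_swap[of "- c" 0]
    by (intro add_mono) (auto simp: hops_def)
  also have "\<dots> = (lost 0 c + lost 0 (- c) + lost c 0 + lost (- c) 0 + 4 * jump 0 c + 4 * jump 0 (- c)) + 8 * bad_mass N"
  proof -
    have "4 * x = 2 * x + 2 * x" "8 * x = (2 * x + 2 * x) + (2 * x + 2 * x)" for x :: ennreal
      by (simp_all add: distrib_right[symmetric])
    then show ?thesis
      by (simp only: add.assoc add.commute add.left_commute)
  qed
  also have "\<dots> \<le> 4 * defect + 8 * bad_mass N"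
  proof (rule add_right_mono)
    have le: "x \<le> 4 * x" for x :: ennreal
      using mult_right_mono[of 1 4 x] by simp
    have "lost 0 c + lost 0 (- c) + lost c 0 + lost (- c) 0 + 4 * jump 0 c + 4 * jump 0 (- c)
        \<le> 4 * lost 0 c + 4 * lost 0 (- c) + 4 * lost c 0 + 4 * lost (- c) 0 + 4 * jump 0 c + 4 * jump 0 (- c)"
      by (intro add_mono order_refl le)
    also have "\<dots> = 4 * defect"
      unfolding defect_def by (simp add: algebra_simps)
    finally show "lost 0 c + lost 0 (- c) + lost c 0 + lost (- c) 0 + 4 * jump 0 c + 4 * jump 0 (- c) \<le> 4 * defect" .
  qed
  also have "\<dots> \<le> 4 * defect + 8 * (of_nat (12 ^ N) * defect)"
    using Suc by (intro add_left_mono mult_left_mono) auto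
  also have "\<dots> = of_nat (4 + 8 * 12 ^ N) * defect"
    by (simp add: distrib_right mult.assoc)
  also have "\<dots> \<le> of_nat (12 ^ Suc N) * defect"
  proof (intro mult_right_mono of_nat_mono)
    have "1 \<le> (12 :: nat) ^ N"
      by simp
    then show "4 + 8 * 12 ^ N \<le> (12 :: nat) ^ Suc N"
      unfolding power_Suc by linarith
  qed simp
  finally show ?case .
qed

text \<open>All points are bad, so with K = 12^N the total mass V is at most K times the defect. The
  choice \<epsilon> = 1/(2K) makes the mass term on the right equal to V/2, which is absorbed
  because V is finite; 2K^2 doubles to 4K^2.\<close>

lemma energy_estimate:
  assumes "\<And>p. \<not> good N p"
  shows "(\<integral>\<^sup>+p. ennreal ((cmod (v p))\<^sup>2) \<partial>lborel) \<le>
    ennreal (4 * (12 ^ N)\<^sup>2) * (\<integral>\<^sup>+p. ennreal ((cmod (second_difference v p))\<^sup>2) \<partial>lborel)"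
proof -
  define K :: real where "K = 12 ^ N"
  have K: "K \<ge> 1"
    by (simp add: K_def)
  define D where "D = (\<integral>\<^sup>+p. ennreal ((cmod (second_difference v p))\<^sup>2) \<partial>lborel)"
  define V where "V = (\<integral>\<^sup>+p. ennreal ((cmod (v p))\<^sup>2) \<partial>lborel)"
  have "V = bad_mass N"
    using assms by (simp add: V_def bad_mass_def)
  also have "\<dots> \<le> ennreal K * defect"
    using bad_mass_le[of N] by (simp add: K_def ennreal_power[symmetric] flip: ennreal_numeral)
  also have "\<dots> \<le> ennreal K * (ennreal (1 / (2 * K)) * V + ennreal (1 / (1 / (2 * K))) * D)"
    unfolding D_def V_def using K by (intro mult_left_mono defect_le) auto
  finally have le: "V \<le> ennreal K * (ennreal (1 / (2 * K)) * V + ennreal (2 * K) * D)"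
    by simp
  show ?thesis
    unfolding D_def[symmetric] V_def[symmetric] K_def[symmetric]
  proof (cases D)
    case top
    then show "V \<le> ennreal (4 * K\<^sup>2) * D"
      using K by (simp add: ennreal_mult_top)
  next
    case (real d)
    obtain r where r: "V = ennreal r" "r \<ge> 0"
      using v_finite unfolding V_def[symmetric] by (cases V) auto
    have "ennreal (1 / (2 * K)) * ennreal r = ennreal (1 / (2 * K) * r)"
      "ennreal (2 * K) * ennreal d = ennreal (2 * K * d)"
      using K real r by (intro ennreal_mult[symmetric]; simp)+
    then have "ennreal K * (ennreal (1 / (2 * K)) * V + ennreal (2 * K) * D) =
        ennreal K * (ennreal (1 / (2 * K) * r) + ennreal (2 * K * d))"
      unfolding r(1) real(2) by (simp only:)
    also have "\<dots> = ennreal (K * (1 / (2 * K) * r + 2 * K * d))"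
      using K real r by (subst ennreal_plus[symmetric]; (subst ennreal_mult[symmetric])?) auto
    finally have "ennreal r \<le> ennreal (K * (1 / (2 * K) * r + 2 * K * d))"
      using le unfolding r(1) by simp
    then have "r \<le> K * (1 / (2 * K) * r + 2 * K * d)"
      using K real r by (subst (asm) ennreal_le_iff) auto
    then have "r \<le> 4 * K\<^sup>2 * d"
      using K by (simp add: power2_eq_square algebra_simps)
    then show "V \<le> ennreal (4 * K\<^sup>2) * D"
      using K real r by (simp add: ennreal_mult[symmetric] ennreal_leI)
  qed
qed

end
end

section \<open>Rows of the Gabor system\<close>

lemma haar_window_measurable [measurable]: "haar_window c \<in> borel_measurable borel"
  unfolding haar_window_def[abs_def] by measurable

lemma haar_window_le: "cmod (haar_window c x) \<le> 1"
  by (auto simp: haar_window_def indicator_def)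

lemma cnj_haar_window: "cnj (haar_window c x) = haar_window c x"
  by (auto simp: haar_window_def indicator_def)

lemma haar_window_outside: "x \<notin> {- c..<c} \<Longrightarrow> haar_window c x = 0"
  by (auto simp: haar_window_def indicator_def)

text \<open>This allows points to be thickened to intervals on their right without changing window
  values.\<close>

lemma haar_window_right_constant:
  assumes "c > 0"
  shows "\<exists>\<epsilon>>0. \<forall>x\<in>{0..<\<epsilon>}. haar_window c (y + x) = haar_window c y"
proof -
  consider "y < - c" | "- c \<le> y" "y < 0" | "0 \<le> y" "y < c" | "c \<le> y"
    by linarith
  then show ?thesis
  proof cases
    case 1
    then show ?thesis
      using assms by (intro exI[of _ "- c - y"]) (auto simp: haar_window_def indicator_def)
  next
    case 2
    then show ?thesis
      using assms by (intro exI[of _ "- y"]) (auto simp: haar_window_def indicator_def)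
  next
    case 3
    then show ?thesis
      using assms by (intro exI[of _ "c - y"]) (auto simp: haar_window_def indicator_def)
  next
    case 4
    then show ?thesis
      using assms by (intro exI[of _ 1]) (auto simp: haar_window_def indicator_def)
  qed
qed

lemma expi_add_arg: "expi m (x + y) = expi m x * expi m y"
  by (simp add: expi_def cis_mult algebra_simps)

lemma L2_measurable: "F \<in> L2 \<Longrightarrow> F \<in> borel_measurable borel"
  by (simp add: L2_def)

lemma L2_nn_integral:
  assumes "F \<in> L2"
  shows "(\<integral>\<^sup>+x. ennreal ((cmod (F x))\<^sup>2) \<partial>lborel) = ennreal ((L2_norm F)\<^sup>2)"
proof -
  have "(\<integral>\<^sup>+x. ennreal ((cmod (F x))\<^sup>2) \<partial>lborel) = ennreal (\<integral>x. (cmod (F x))\<^sup>2 \<partial>lborel)"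
    using assms by (intro nn_integral_eq_integral) (auto simp: L2_def)
  then show ?thesis
    by (simp add: L2_norm_def real_sqrt_pow2 integral_nonneg_AE)
qed

lemma integral_lborel_shift:
  fixes f :: "real \<Rightarrow> 'a::euclidean_space"
  shows "(\<integral>x. f (x + t) \<partial>lborel) = (\<integral>x. f x \<partial>lborel)"
  using lborel_integral_real_affine[of 1 f t] by (simp add: add.commute)

lemma integrable_lborel_shift:
  fixes f :: "real \<Rightarrow> 'a::euclidean_space"
  shows "integrable lborel f \<Longrightarrow> integrable lborel (\<lambda>x. f (x + t))"
  using lborel_integrable_real_affine[of f 1 t] by (simp add: add.commute)

lemma integrable_unit: "integrable lborel f \<Longrightarrow> integrable unit_measure f"
  for f :: "real \<Rightarrow> 'a::euclidean_space"
  unfolding unit_measure_def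
  by (subst integrable_restrict_space) (auto intro: integrable_mult_indicator)

context haar_gabor begin

abbreviation H :: "real \<Rightarrow> complex" where
  "H \<equiv> haar_window c"

text \<open>The periodization of F(x + na) H(x). The range \<open>steps\<close> covers the support
  of the window not only on the unit interval but for x in [-1, 1), because differences of
  consecutive rows evaluate one of them at negative arguments.\<close>

definition row :: "(real \<Rightarrow> complex) \<Rightarrow> int \<Rightarrow> real \<Rightarrow> complex" where
  "row F n x = (\<Sum>k\<in>steps. F (x + of_int k + of_int n * a) * H (x + of_int k))"

lemma integral_periodize:
  fixes \<phi> :: "real \<Rightarrow> complex"
  assumes int: "integrable lborel \<phi>" and supp: "\<And>x. x \<notin> {- c..<c} \<Longrightarrow> \<phi> x = 0"
  shows "(\<integral>x. \<phi> x \<partial>lborel) = (LINT x|unit_measure. (\<Sum>k\<in>steps. \<phi> (x + of_int k)))"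
proof -
  have piece: "(LINT x|unit_measure. \<phi> (x + of_int k)) =
      (\<integral>x. indicator {of_int k..<of_int k + 1} x *\<^sub>R \<phi> x \<partial>lborel)" for k :: int
  proof -
    have "(LINT x|unit_measure. \<phi> (x + of_int k)) = (\<integral>x. indicator {0..<1} x *\<^sub>R \<phi> (x + of_int k) \<partial>lborel)"
      unfolding unit_measure_def by (subst integral_restrict_space) auto
    also have "\<dots> = (\<integral>x. indicator {of_int k..<of_int k + 1} (x + of_int k) *\<^sub>R \<phi> (x + of_int k) \<partial>lborel)"
      by (intro Bochner_Integration.integral_cong) (auto simp: indicator_def)
    also have "\<dots> = (\<integral>x. indicator {of_int k..<of_int k + 1} x *\<^sub>R \<phi> x \<partial>lborel)"
      by (rule integral_lborel_shift)
    finally show ?thesis .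
  qed
  have "(LINT x|unit_measure. (\<Sum>k\<in>steps. \<phi> (x + of_int k))) =
      (\<Sum>k\<in>steps. LINT x|unit_measure. \<phi> (x + of_int k))"
    by (intro Bochner_Integration.integral_sum integrable_unit integrable_lborel_shift int)
  also have "\<dots> = (\<integral>x. (\<Sum>k\<in>steps. indicator {of_int k..<of_int k + 1} x *\<^sub>R \<phi> x) \<partial>lborel)"
    unfolding piece
    by (intro Bochner_Integration.integral_sum[symmetric] integrable_mult_indicator int) auto
  also have "\<dots> = (\<integral>x. \<phi> x \<partial>lborel)"
  proof (intro Bochner_Integration.integral_cong refl)
    fix x
    show "(\<Sum>k\<in>steps. indicator {of_int k..<of_int k + 1} x *\<^sub>R \<phi> x) = \<phi> x"
    proof (cases "x \<in> {- c..<c}")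
      case True
      then have "\<lfloor>x\<rfloor> \<in> steps"
        unfolding steps_def by (auto simp: le_floor_iff floor_le_iff) linarith+
      moreover have "(\<Sum>k\<in>steps. indicator {of_int k..<of_int k + 1} x *\<^sub>R \<phi> x) =
          (\<Sum>k\<in>steps. if k = \<lfloor>x\<rfloor> then \<phi> x else 0)"
        by (intro sum.cong refl) (auto simp: indicator_def floor_unique)
      ultimately show ?thesis
        by simp
    next
      case False
      then show ?thesis
        using supp by simp
    qed
  qed
  finally show ?thesis ..
qed

text \<open>A bound on the number of rows that see a given point: an interval of length
  2(\<lceil>c\<rceil> + 1) + 1 contains at most this many multiples of \<open>a\<close>.\<close>

definition overlap :: real where
  "overlap = (2 * of_int (\<lceil>c\<rceil> + 1) + 1) / a + 1"

lemma ceiling_c_gt_1: "1 < \<lceil>c\<rceil>"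
  using c_gt_1 by (simp add: less_ceiling_iff)

lemma overlap_nonneg: "0 \<le> overlap"
proof -
  have "0 \<le> (2 * of_int (\<lceil>c\<rceil> + 1) + 1) / a"
    using ceiling_c_gt_1 a_pos by (intro divide_nonneg_pos) simp_all
  then show ?thesis
    by (simp add: overlap_def)
qed

lemma gabor_L2: "gabor_system (haar_window c) a k \<in> L2"
proof -
  obtain m n where k: "k = (m, n)"
    by (cases k)
  have meas: "gabor_system (haar_window c) a k \<in> borel_measurable borel"
    unfolding k gabor_system_def split by measurable
  have "cmod (gabor_system (haar_window c) a k x) \<le> indicator {of_int n * a - c..<of_int n * a + c} x" for x
    using haar_window_le[of c "x - of_int n * a"] haar_window_outside[of "x - of_int n * a" c]
    by (cases "x \<in> {of_int n * a - c..<of_int n * a + c}") (auto simp: k gabor_system_def norm_mult)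
  then have le: "(cmod (gabor_system (haar_window c) a k x))\<^sup>2 \<le> (indicator {of_int n * a - c..<of_int n * a + c} x)\<^sup>2" for x
    by (intro power_mono) auto
  have "integrable lborel (\<lambda>x. (cmod (gabor_system (haar_window c) a k x))\<^sup>2)"
  proof (rule Bochner_Integration.integrable_bound)
    show "integrable lborel (indicator {of_int n * a - c..<of_int n * a + c} :: real \<Rightarrow> real)"
      by (intro integrable_real_indicator) (auto intro!: emeasure_bounded_finite[unfolded infinity_ennreal_def])
    show "(\<lambda>x. (cmod (gabor_system (haar_window c) a k x))\<^sup>2) \<in> borel_measurable lborel"
      using meas by measurable
    show "AE x in lborel. norm ((cmod (gabor_system (haar_window c) a k x))\<^sup>2) \<le>
        norm (indicator {of_int n * a - c..<of_int n * a + c} x :: real)"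
    proof (rule AE_I2)
      fix x :: real
      have "(indicator A x :: real)\<^sup>2 = indicator A x" for A
        by (simp add: indicator_def)
      then show "norm ((cmod (gabor_system (haar_window c) a k x))\<^sup>2) \<le>
          norm (indicator {of_int n * a - c..<of_int n * a + c} x :: real)"
        using le[of x] by simp
    qed
  qed
  then show ?thesis
    using meas by (simp add: L2_def)
qed

context
  fixes F :: "real \<Rightarrow> complex"
  assumes F: "F \<in> L2"
begin

lemma F_measurable [measurable]: "F \<in> borel_measurable borel"
  using F by (rule L2_measurable)

lemma F_norm_square: "integrable lborel (\<lambda>x. (cmod (F x))\<^sup>2)"
  using F by (simp add: L2_def)

lemma row_measurable [measurable]: "row F n \<in> borel_measurable borel"
  unfolding row_def[abs_def] by measurable

lemma row_square_integrable: "square_integrable (row F n)"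
  unfolding row_def[abs_def]
proof (intro square_integrable_sum square_integrable_mult_bounded[where B = 1] haar_window_le)
  fix k :: int
  have "integrable lborel (\<lambda>x. (cmod (F (x + (of_int k + of_int n * a))))\<^sup>2)"
    using F_norm_square by (rule integrable_lborel_shift)
  then show "square_integrable (\<lambda>x. F (x + of_int k + of_int n * a))"
    unfolding square_integrable_def
    by (intro conjI borel_measurable_unit integrable_unit) (simp_all add: add.assoc)
  show "(\<lambda>x. H (x + of_int k)) \<in> borel_measurable unit_measure"
    by (intro borel_measurable_unit) measurable
qed

lemma integrable_window: "integrable lborel (\<lambda>x. F (x + t) * H x * expi m x)"
proof (rule Bochner_Integration.integrable_bound)
  show "integrable lborel (\<lambda>x. (cmod (F (x + t)))\<^sup>2 + indicator {- c..<c} x)"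
    using integrable_lborel_shift[OF F_norm_square]
    by (intro Bochner_Integration.integrable_add integrable_real_indicator)
      (auto intro!: emeasure_bounded_finite[unfolded infinity_ennreal_def])
  show "AE x in lborel. norm (F (x + t) * H x * expi m x) \<le> norm ((cmod (F (x + t)))\<^sup>2 + indicator {- c..<c} x :: real)"
  proof (rule AE_I2)
    fix x
    have le: "u \<le> u\<^sup>2 + 1" for u :: real
      using zero_le_power2[of u] zero_le_power2[of "u - 1"]
      by (simp only: power2_diff power_one mult_1_right)
    show "norm (F (x + t) * H x * expi m x) \<le> norm ((cmod (F (x + t)))\<^sup>2 + indicator {- c..<c} x :: real)"
    proof (cases "x \<in> {- c..<c}")
      case True
      have "norm (F (x + t) * H x * expi m x) \<le> cmod (F (x + t)) * 1"
        unfolding norm_mult norm_expi mult_1_right by (intro mult_left_le haar_window_le) auto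
      also have "\<dots> \<le> (cmod (F (x + t)))\<^sup>2 + 1"
        using le by simp
      finally show ?thesis
        using True by simp
    qed (simp add: haar_window_outside)
  qed
qed measurable

text \<open>Translation by na turns the exponential into itself times a unimodular constant, which
  the absolute value removes; then \<open>expi m\<close> is 1-periodic and passes through the
  periodization.\<close>

lemma coefficient_eq_row:
  "cmod (L2_inner F (gabor_system (haar_window c) a (m, n))) = cmod (LINT x|unit_measure. row F n x * expi m x)"
proof -
  let ?\<phi> = "\<lambda>x. F (x + of_int n * a) * H x * expi m x"
  have "cnj (exp (- 2 * of_real pi * \<i> * of_int m * of_real x)) = expi m x" for x
    by (simp add: expi_def cis_conv_exp exp_cnj mult_ac)
  then have "L2_inner F (gabor_system (haar_window c) a (m, n)) =
      (\<integral>x. F x * (expi m x * H (x - of_int n * a)) \<partial>lborel)"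
    unfolding L2_inner_def gabor_system_def by (simp add: cnj_haar_window)
  also have "\<dots> = (\<integral>x. F (x + of_int n * a) * (expi m (x + of_int n * a) * H (x + of_int n * a - of_int n * a)) \<partial>lborel)"
    by (rule integral_lborel_shift[symmetric])
  also have "\<dots> = (\<integral>x. expi m (of_int n * a) * ?\<phi> x \<partial>lborel)"
    by (intro Bochner_Integration.integral_cong) (auto simp: expi_add_arg mult_ac)
  also have "\<dots> = expi m (of_int n * a) * (\<integral>x. ?\<phi> x \<partial>lborel)"
    by simp
  also have "(\<integral>x. ?\<phi> x \<partial>lborel) = (LINT x|unit_measure. (\<Sum>k\<in>steps. ?\<phi> (x + of_int k)))"
    by (rule integral_periodize[OF integrable_window]) (simp add: haar_window_outside)
  also have "\<dots> = (LINT x|unit_measure. row F n x * expi m x)"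
    unfolding row_def sum_distrib_right expi_shift_int ..
  finally show ?thesis
    by (simp add: norm_mult)
qed

section \<open>Row energies and the upper frame bound\<close>

definition row_energy :: "int \<Rightarrow> ennreal" where
  "row_energy n = (\<integral>\<^sup>+x. ennreal ((cmod (row F n x))\<^sup>2) \<partial>unit_measure)"

lemma row_energy_eq: "row_energy n = ennreal (LINT x|unit_measure. (cmod (row F n x))\<^sup>2)"
  unfolding row_energy_def using row_square_integrable
  by (intro nn_integral_eq_integral) (auto simp: square_integrable_def)

lemma row_energy_has_sum:
  "((\<lambda>m. (cmod (L2_inner F (gabor_system (haar_window c) a (m, n))))\<^sup>2) has_sum enn2real (row_energy n)) UNIV"
proof -
  have "enn2real (row_energy n) = (LINT x|unit_measure. (cmod (row F n x))\<^sup>2)"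
    unfolding row_energy_eq by (simp add: integral_nonneg_AE)
  then show ?thesis
    unfolding coefficient_eq_row using parseval[OF row_measurable row_square_integrable] by simp
qed

lemma row_sq_le:
  "(cmod (row F n x))\<^sup>2 \<le> of_nat (card steps) * (\<Sum>k\<in>steps. (cmod (F (x + of_int k + of_int n * a)))\<^sup>2)"
proof -
  have "cmod (row F n x) \<le> (\<Sum>k\<in>steps. 1 * cmod (F (x + of_int k + of_int n * a)))"
    unfolding row_def by (intro sum_norm_le) (auto simp: norm_mult intro: mult_left_le haar_window_le)
  then have "(cmod (row F n x))\<^sup>2 \<le> (\<Sum>k\<in>steps. 1 * cmod (F (x + of_int k + of_int n * a)))\<^sup>2"
    by (intro power_mono) auto
  also have "\<dots> \<le> (\<Sum>k\<in>steps. 1\<^sup>2) * (\<Sum>k\<in>steps. (cmod (F (x + of_int k + of_int n * a)))\<^sup>2)"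
    by (rule Cauchy_Schwarz_ineq_sum)
  finally show ?thesis
    by simp
qed

lemma row_energy_le:
  "row_energy n \<le> of_nat (card steps) * (\<integral>\<^sup>+y. ennreal ((cmod (F y))\<^sup>2) *
      indicator {y. y - of_int n * a \<in> {- of_int (\<lceil>c\<rceil> + 1)..<of_int (\<lceil>c\<rceil> + 1) + 1}} y \<partial>lborel)"
proof -
  let ?N = "\<lambda>y. ennreal ((cmod (F y))\<^sup>2)"
  let ?I = "\<lambda>k. {of_int k + of_int n * a..<of_int k + of_int n * a + 1}"
  have "row_energy n \<le> (\<integral>\<^sup>+x. of_nat (card steps) * (\<Sum>k\<in>steps. ?N (x + of_int k + of_int n * a)) \<partial>unit_measure)"
    unfolding row_energy_def
  proof (rule nn_integral_mono)
    fix x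
    have "ennreal ((cmod (row F n x))\<^sup>2) \<le>
        ennreal (of_nat (card steps) * (\<Sum>k\<in>steps. (cmod (F (x + of_int k + of_int n * a)))\<^sup>2))"
      by (intro ennreal_leI row_sq_le)
    also have "\<dots> = of_nat (card steps) * (\<Sum>k\<in>steps. ?N (x + of_int k + of_int n * a))"
      by (simp add: ennreal_mult sum_nonneg ennreal_of_nat_eq_real_of_nat sum_ennreal)
    finally show "ennreal ((cmod (row F n x))\<^sup>2) \<le> of_nat (card steps) * (\<Sum>k\<in>steps. ?N (x + of_int k + of_int n * a))" .
  qed
  also have "\<dots> = of_nat (card steps) * (\<Sum>k\<in>steps. \<integral>\<^sup>+x. ?N (x + of_int k + of_int n * a) \<partial>unit_measure)"
  proof -
    have meas: "(\<lambda>x. ?N (x + of_int k + of_int n * a)) \<in> borel_measurable unit_measure" for k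
      by (rule borel_measurable_unit) measurable
    then have "(\<lambda>x. \<Sum>k\<in>steps. ?N (x + of_int k + of_int n * a)) \<in> borel_measurable unit_measure"
      by (intro borel_measurable_sum)
    then show ?thesis
      by (simp only: nn_integral_cmult nn_integral_sum[OF meas])
  qed
  also have "(\<Sum>k\<in>steps. \<integral>\<^sup>+x. ?N (x + of_int k + of_int n * a) \<partial>unit_measure) =
      (\<Sum>k\<in>steps. \<integral>\<^sup>+y. ?N y * indicator (?I k) y \<partial>lborel)"
  proof (intro sum.cong refl)
    fix k
    have "(\<integral>\<^sup>+x. ?N (x + of_int k + of_int n * a) \<partial>unit_measure) =
        (\<integral>\<^sup>+x. ?N (x + of_int k + of_int n * a) * indicator {0..<1} x \<partial>lborel)"
      unfolding unit_measure_def by (subst nn_integral_restrict_space) auto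
    also have "\<dots> = (\<integral>\<^sup>+x. ?N (x + (of_int k + of_int n * a)) * indicator (?I k) (x + (of_int k + of_int n * a)) \<partial>lborel)"
      by (intro nn_integral_cong) (auto simp: indicator_def add.assoc)
    also have "\<dots> = (\<integral>\<^sup>+y. ?N y * indicator (?I k) y \<partial>lborel)"
      by (rule nn_integral_shift) measurable
    finally show "(\<integral>\<^sup>+x. ?N (x + of_int k + of_int n * a) \<partial>unit_measure) = (\<integral>\<^sup>+y. ?N y * indicator (?I k) y \<partial>lborel)" .
  qed
  also have "\<dots> = (\<integral>\<^sup>+y. (\<Sum>k\<in>steps. ?N y * indicator (?I k) y) \<partial>lborel)"
    by (rule nn_integral_sum[symmetric]) measurable
  also have "\<dots> \<le> (\<integral>\<^sup>+y. ?N y *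
      indicator {y. y - of_int n * a \<in> {- of_int (\<lceil>c\<rceil> + 1)..<of_int (\<lceil>c\<rceil> + 1) + 1}} y \<partial>lborel)"
  proof (rule nn_integral_mono)
    fix y
    have iff: "?N y * indicator (?I k) y = (if k = \<lfloor>y - of_int n * a\<rfloor> then ?N y else 0)" for k
    proof -
      have "y \<in> ?I k \<longleftrightarrow> \<lfloor>y - of_int n * a\<rfloor> = k"
        unfolding floor_eq_iff by auto
      then show ?thesis
        by (auto simp: indicator_def)
    qed
    have "\<lfloor>y - of_int n * a\<rfloor> \<in> steps \<longleftrightarrow>
        y - of_int n * a \<in> {- of_int (\<lceil>c\<rceil> + 1)..<of_int (\<lceil>c\<rceil> + 1) + 1}"
      unfolding steps_def by (auto simp: le_floor_iff floor_le_iff)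
    then show "(\<Sum>k\<in>steps. ?N y * indicator (?I k) y) \<le> ?N y *
        indicator {y. y - of_int n * a \<in> {- of_int (\<lceil>c\<rceil> + 1)..<of_int (\<lceil>c\<rceil> + 1) + 1}} y"
      unfolding iff by (auto simp: indicator_def)
  qed
  finally show ?thesis
    by (simp add: mult_left_mono)
qed

text \<open>Cauchy-Schwarz bounds each row energy by the mass of \<open>F\<close> on an interval
  around na; by Tonelli, each point is counted at most \<open>overlap\<close> times.\<close>

lemma row_energy_sum_le:
  "(\<integral>\<^sup>+n. row_energy n \<partial>count_space UNIV) \<le>
    of_nat (card steps) * ennreal overlap * (\<integral>\<^sup>+y. ennreal ((cmod (F y))\<^sup>2) \<partial>lborel)"
proof -
  let ?N = "\<lambda>y. ennreal ((cmod (F y))\<^sup>2)"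
  let ?K = "of_int (\<lceil>c\<rceil> + 1) :: real"
  let ?J = "\<lambda>n. {y. y - of_int n * a \<in> {- ?K..<?K + 1}}"
  have J: "?J n \<in> sets borel" for n :: int
    by measurable
  have count: "emeasure (count_space UNIV) {n. y \<in> ?J n} \<le> ennreal overlap" for y
  proof -
    let ?A = "{\<lceil>(y - ?K - 1) / a\<rceil>..\<lfloor>(y + ?K) / a\<rfloor>}"
    have "n \<in> ?A" if "y \<in> ?J n" for n
    proof -
      have "of_int n * a \<le> y + ?K" "y - ?K - 1 \<le> of_int n * a"
        using that by auto
      then have "of_int n \<le> (y + ?K) / a" "(y - ?K - 1) / a \<le> of_int n"
        using a_pos by (simp_all only: pos_le_divide_eq pos_divide_le_eq)
      then show ?thesis
        by (simp add: le_floor_iff ceiling_le_iff)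
    qed
    then have sub: "{n. y \<in> ?J n} \<subseteq> ?A"
      by blast
    have "emeasure (count_space UNIV) {n. y \<in> ?J n} \<le> emeasure (count_space UNIV) ?A"
      using sub by (intro emeasure_mono) auto
    also have "\<dots> = ennreal (real (card ?A))"
      by (subst emeasure_count_space_finite) (simp_all add: ennreal_of_nat_eq_real_of_nat)
    also have "\<dots> \<le> ennreal overlap"
    proof (rule ennreal_leI)
      have "real (card ?A) \<le> (y + ?K) / a - (y - ?K - 1) / a + 1"
        using a_pos ceiling_c_gt_1 by (intro card_int_interval_le divide_right_mono) simp_all
      also have "\<dots> = overlap"
        using a_pos by (simp add: overlap_def diff_divide_distrib[symmetric])
      finally show "real (card ?A) \<le> overlap" .
    qed
    finally show ?thesis .
  qed
  have "(\<integral>\<^sup>+n. (\<integral>\<^sup>+y. ?N y * indicator (?J n) y \<partial>lborel) \<partial>count_space UNIV) =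
      (\<integral>\<^sup>+y. (\<integral>\<^sup>+n. ?N y * indicator (?J n) y \<partial>count_space UNIV) \<partial>lborel)"
    using J by (intro nn_integral_count_space_nn_integral[symmetric]) (simp, measurable)
  also have "\<dots> \<le> (\<integral>\<^sup>+y. ?N y * ennreal overlap \<partial>lborel)"
  proof (rule nn_integral_mono)
    fix y
    have "(\<integral>\<^sup>+n. ?N y * indicator (?J n) y \<partial>count_space UNIV) =
        ?N y * (\<integral>\<^sup>+n. indicator {n. y \<in> ?J n} n \<partial>count_space UNIV)"
      by (subst nn_integral_cmult[symmetric]) (auto simp: indicator_def intro!: nn_integral_cong)
    also have "\<dots> \<le> ?N y * ennreal overlap"
      using count[of y] by (intro mult_left_mono) (simp_all add: nn_integral_indicator)
    finally show "(\<integral>\<^sup>+n. ?N y * indicator (?J n) y \<partial>count_space UNIV) \<le> ?N y * ennreal overlap" .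
  qed
  also have "\<dots> = (\<integral>\<^sup>+y. ?N y \<partial>lborel) * ennreal overlap"
    by (rule nn_integral_multc) measurable
  finally have le: "(\<integral>\<^sup>+n. (\<integral>\<^sup>+y. ?N y * indicator (?J n) y \<partial>lborel) \<partial>count_space UNIV) \<le>
      (\<integral>\<^sup>+y. ?N y \<partial>lborel) * ennreal overlap" .
  have "(\<integral>\<^sup>+n. row_energy n \<partial>count_space UNIV) \<le>
      (\<integral>\<^sup>+n. of_nat (card steps) * (\<integral>\<^sup>+y. ?N y * indicator (?J n) y \<partial>lborel) \<partial>count_space UNIV)"
    by (intro nn_integral_mono row_energy_le)
  also have "\<dots> = of_nat (card steps) * (\<integral>\<^sup>+n. (\<integral>\<^sup>+y. ?N y * indicator (?J n) y \<partial>lborel) \<partial>count_space UNIV)"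
    by (rule nn_integral_cmult) simp
  also have "\<dots> \<le> of_nat (card steps) * ((\<integral>\<^sup>+y. ?N y \<partial>lborel) * ennreal overlap)"
    by (intro mult_left_mono le) simp
  finally show ?thesis
    by (simp only: mult_ac)
qed

section \<open>Differences of consecutive rows\<close>

text \<open>The shift by 1 moves the summation range by one index; the indices gained and dropped at
  its ends lie outside the support of the window.\<close>

lemma row_periodic:
  assumes "- 1 \<le> x" "x < 0"
  shows "row F n (x + 1) = row F n x"
proof -
  define \<phi> where "\<phi> k = F (x + of_int k + of_int n * a) * H (x + of_int k)" for k
  define K where "K = \<lceil>c\<rceil> + 1"
  have K: "c \<le> of_int K - 1"
    by (simp add: K_def)
  have "row F n (x + 1) = (\<Sum>k\<in>{- K..K}. \<phi> (k + 1))"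
    unfolding row_def \<phi>_def steps_def K_def by (simp add: ac_simps)
  also have "\<dots> = (\<Sum>k\<in>{- K + 1..K + 1}. \<phi> k)"
    by (rule sum.reindex_bij_witness[of _ "\<lambda>k. k - 1" "\<lambda>k. k + 1"]) auto
  also have "\<dots> = (\<Sum>k\<in>{- K + 1..K}. \<phi> k)"
  proof (rule sum.mono_neutral_right)
    show "\<forall>k\<in>{- K + 1..K + 1} - {- K + 1..K}. \<phi> k = 0"
    proof
      fix k assume "k \<in> {- K + 1..K + 1} - {- K + 1..K}"
      then have "k = K + 1"
        by auto
      then have "x + of_int k \<notin> {- c..<c}"
        using assms K by auto
      then show "\<phi> k = 0"
        by (simp add: \<phi>_def haar_window_outside)
    qed
  qed auto
  also have "\<dots> = (\<Sum>k\<in>{- K..K}. \<phi> k)"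
  proof (rule sum.mono_neutral_left)
    show "\<forall>k\<in>{- K..K} - {- K + 1..K}. \<phi> k = 0"
    proof
      fix k assume "k \<in> {- K..K} - {- K + 1..K}"
      then have "k = - K"
        by auto
      then have "x + of_int k \<notin> {- c..<c}"
        using assms K by auto
      then show "\<phi> k = 0"
        by (simp add: \<phi>_def haar_window_outside)
    qed
  qed auto
  also have "\<dots> = row F n x"
    unfolding row_def \<phi>_def steps_def K_def ..
  finally show ?thesis .
qed

lemma second_difference_eq_row:
  assumes n: "n = \<lfloor>p / a\<rfloor>"
  shows "second_difference F p = row F n (p - of_int n * a) - row F (n + 1) (p - of_int n * a - a)"
proof -
  define t where "t = p - of_int n * a"
  have t: "0 \<le> t" "t < a"
    using floor_bounds[of p] by (auto simp: t_def n)
  have hop: "hop 0 w k p \<longleftrightarrow> w \<le> t + of_int k \<and> t + of_int k < w + a" for w k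
    unfolding hop_iff Let_def t_def n by auto
  \<comment> \<open>As \<open>a < 1\<close>, the only point of \<open>p + k\<close> in the cell of
    \<open>p\<close> is \<open>p\<close> itself.\<close>
  have zero: "0 \<le> t + of_int k \<and> t + of_int k < a \<longleftrightarrow> k = 0" for k :: int
  proof
    assume "0 \<le> t + of_int k \<and> t + of_int k < a"
    then have "- 1 < real_of_int k" "real_of_int k < 1"
      using t a_lt_1 by linarith+
    then show "k = 0"
      by linarith
  qed (use t in auto)
  have zero_step: "0 \<in> steps"
    using ceiling_c_gt_1 unfolding steps_def atLeastAtMost_iff by linarith
  have summand: "F (p + of_int k) * H (t + of_int k) - F (p + of_int k) * H (t - a + of_int k) =
      2 * (if k = 0 then F p else 0) - (if hop 0 c k p then F (p + of_int k) else 0)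
        - (if hop 0 (- c) k p then F (p + of_int k) else 0)" for k
  proof -
    \<comment> \<open>Differencing with step \<open>a\<close> turns the jumps -1, 2, -1 of the
      window at -c, 0, c into plateaus of width \<open>a\<close> with these heights.\<close>
    have "H s - H (s - a) = 2 * (if 0 \<le> s \<and> s < a then 1 else 0) - (if c \<le> s \<and> s < c + a then 1 else 0)
        - (if - c \<le> s \<and> s < - c + a then 1 else 0)" for s
      using a_pos a_lt_1 c_gt_1 unfolding haar_window_def indicator_def by auto
    from this[of "t + of_int k"]
    have "H (t + of_int k) - H (t - a + of_int k) = 2 * (if k = 0 then 1 else 0)
        - (if hop 0 c k p then 1 else 0) - (if hop 0 (- c) k p then 1 else 0)"
      unfolding hop zero by (simp add: algebra_simps)
    then have "F (p + of_int k) * (H (t + of_int k) - H (t - a + of_int k)) = F (p + of_int k) *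
        (2 * (if k = 0 then 1 else 0) - (if hop 0 c k p then 1 else 0) - (if hop 0 (- c) k p then 1 else 0))"
      by simp
    then show ?thesis
      by (auto simp: right_diff_distrib)
  qed
  have "row F n t - row F (n + 1) (t - a) =
      (\<Sum>k\<in>steps. F (p + of_int k) * H (t + of_int k) - F (p + of_int k) * H (t - a + of_int k))"
    unfolding row_def sum_subtractf[symmetric] by (intro sum.cong refl) (simp add: t_def algebra_simps)
  also have "\<dots> = second_difference F p"
    unfolding summand second_difference_def sum_subtractf sum_distrib_left[symmetric]
    using zero_step by simp
  finally show ?thesis
    by (simp add: t_def)
qed

text \<open>Each \<open>p\<close> lies in one cell and thus involves two rows. The square of a
  difference costs a factor 2, and summation over the cells meets every row twice, hence 4.\<close>

lemma second_difference_energy_le: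
  "(\<integral>\<^sup>+p. ennreal ((cmod (second_difference F p))\<^sup>2) \<partial>lborel) \<le> 4 * (\<integral>\<^sup>+n. row_energy n \<partial>count_space UNIV)"
proof -
  let ?R = "\<lambda>n x. ennreal ((cmod (row F n x))\<^sup>2)"
  define G where "G n s = (2 * ?R n s + 2 * ?R (n + 1) (s - a)) * indicator {0..<a} s" for n s
  have [measurable]: "G n \<in> borel_measurable borel" for n
    unfolding G_def[abs_def] by measurable
  have le: "ennreal ((cmod (second_difference F p))\<^sup>2) \<le> (\<integral>\<^sup>+n. G n (p - of_int n * a) \<partial>count_space UNIV)" for p
  proof -
    define m where "m = \<lfloor>p / a\<rfloor>"
    let ?x = "row F m (p - of_int m * a)" and ?y = "row F (m + 1) (p - of_int m * a - a)"
    have "(cmod (?x - ?y))\<^sup>2 \<le> 2 * (cmod ?x)\<^sup>2 + 2 * (cmod ?y)\<^sup>2"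
      using norm_add_square_le[of ?x "- ?y"] by simp
    then have "ennreal ((cmod (?x - ?y))\<^sup>2) \<le> ennreal (2 * (cmod ?x)\<^sup>2 + 2 * (cmod ?y)\<^sup>2)"
      by (rule ennreal_leI)
    also have "\<dots> = 2 * ennreal ((cmod ?x)\<^sup>2) + 2 * ennreal ((cmod ?y)\<^sup>2)"
      by (simp add: ennreal_mult)
    also have "\<dots> = G m (p - of_int m * a)"
      using floor_bounds[of p] by (simp add: G_def m_def)
    also have "\<dots> = (\<integral>\<^sup>+n. G n (p - of_int n * a) * indicator {m} n \<partial>count_space UNIV)"
      by simp
    also have "\<dots> \<le> (\<integral>\<^sup>+n. G n (p - of_int n * a) \<partial>count_space UNIV)"
      by (intro nn_integral_mono) (auto simp: indicator_def)
    finally show ?thesis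
      unfolding second_difference_eq_row[OF m_def] .
  qed
  have row_le: "(\<integral>\<^sup>+x. ?R n x * indicator A x \<partial>lborel) \<le> row_energy n" if "A \<subseteq> {0..<1}" for A n
    unfolding row_energy_def unit_measure_def using that
    by (subst nn_integral_restrict_space) (auto intro!: nn_integral_mono mult_left_mono simp: indicator_def)
  have G_le: "(\<integral>\<^sup>+p. G n (p - of_int n * a) \<partial>lborel) \<le> 2 * row_energy n + 2 * row_energy (n + 1)" for n
  proof -
    have "(\<integral>\<^sup>+p. G n (p - of_int n * a) \<partial>lborel) = (\<integral>\<^sup>+s. G n s \<partial>lborel)"
      using nn_integral_shift[of "G n" "- of_int n * a"] by simp
    also have "\<dots> = (\<integral>\<^sup>+s. 2 * (?R n s * indicator {0..<a} s) + 2 * (?R (n + 1) (s - a) * indicator {0..<a} s) \<partial>lborel)"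
      unfolding G_def by (simp add: distrib_right mult.assoc)
    also have "\<dots> = 2 * (\<integral>\<^sup>+s. ?R n s * indicator {0..<a} s \<partial>lborel) +
        2 * (\<integral>\<^sup>+s. ?R (n + 1) (s - a) * indicator {0..<a} s \<partial>lborel)"
      by (simp add: nn_integral_add nn_integral_cmult)
    \<comment> \<open>Row n + 1 is needed on [-a, 0); periodicity moves this to [1 - a, 1), inside
      the unit interval.\<close>
    also have "(\<integral>\<^sup>+s. ?R (n + 1) (s - a) * indicator {0..<a} s \<partial>lborel) =
        (\<integral>\<^sup>+s. ?R (n + 1) (s + (1 - a)) * indicator {1 - a..<1} (s + (1 - a)) \<partial>lborel)"
    proof (intro nn_integral_cong)
      fix s
      show "?R (n + 1) (s - a) * indicator {0..<a} s = ?R (n + 1) (s + (1 - a)) * indicator {1 - a..<1} (s + (1 - a))"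
        using row_periodic[of "s - a" "n + 1"] a_lt_1 by (auto simp: indicator_def algebra_simps)
    qed
    also have "\<dots> = (\<integral>\<^sup>+s. ?R (n + 1) s * indicator {1 - a..<1} s \<partial>lborel)"
      by (rule nn_integral_shift) measurable
    also have "2 * (\<integral>\<^sup>+s. ?R n s * indicator {0..<a} s \<partial>lborel) + 2 * \<dots> \<le> 2 * row_energy n + 2 * row_energy (n + 1)"
      using a_lt_1 by (intro add_mono mult_left_mono row_le) auto
    finally show ?thesis .
  qed
  have "(\<integral>\<^sup>+p. ennreal ((cmod (second_difference F p))\<^sup>2) \<partial>lborel) \<le>
      (\<integral>\<^sup>+p. (\<integral>\<^sup>+n. G n (p - of_int n * a) \<partial>count_space UNIV) \<partial>lborel)"
    by (intro nn_integral_mono le)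
  also have "\<dots> = (\<integral>\<^sup>+n. (\<integral>\<^sup>+p. G n (p - of_int n * a) \<partial>lborel) \<partial>count_space UNIV)"
    by (intro nn_integral_count_space_nn_integral) (simp, measurable)
  also have "\<dots> \<le> (\<integral>\<^sup>+n. 2 * row_energy n + 2 * row_energy (n + 1) \<partial>count_space UNIV)"
    by (intro nn_integral_mono G_le)
  also have "\<dots> = 2 * (\<integral>\<^sup>+n. row_energy n \<partial>count_space UNIV) + 2 * (\<integral>\<^sup>+n. row_energy (n + 1) \<partial>count_space UNIV)"
    by (simp add: nn_integral_add nn_integral_cmult)
  also have "(\<integral>\<^sup>+n. row_energy (n + 1) \<partial>count_space UNIV) = (\<integral>\<^sup>+n. row_energy n \<partial>count_space UNIV)"
    by (rule nn_integral_bij_count_space) (rule bij_betwI[of _ _ _ "\<lambda>n. n - 1"], auto)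
  also have "2 * (\<integral>\<^sup>+n. row_energy n \<partial>count_space UNIV) + 2 * (\<integral>\<^sup>+n. row_energy n \<partial>count_space UNIV) =
      4 * (\<integral>\<^sup>+n. row_energy n \<partial>count_space UNIV)"
    by (simp add: distrib_right[symmetric])
  finally show ?thesis .
qed

lemma row_energy_sum_finite: "(\<integral>\<^sup>+n. row_energy n \<partial>count_space UNIV) < \<infinity>"
  using row_energy_sum_le unfolding L2_nn_integral[OF F]
  by (rule le_less_trans) (simp add: ennreal_mult_less_top of_nat_less_top)

text \<open>Parseval sums over the modulations m for each fixed n. Nonnegativity and finite total
  energy permit the summation over n and the exchange of the two indices.\<close>

lemma gabor_has_sum:
  obtains s where "s \<ge> 0" "ennreal s = (\<integral>\<^sup>+n. row_energy n \<partial>count_space UNIV)"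
    "((\<lambda>k. (cmod (L2_inner F (gabor_system (haar_window c) a k)))\<^sup>2) has_sum s) UNIV"
proof -
  let ?r = "\<lambda>n. enn2real (row_energy n)"
  let ?f = "\<lambda>(n, m). (cmod (L2_inner F (gabor_system (haar_window c) a (m, n))))\<^sup>2"
  have r: "ennreal (?r n) = row_energy n" for n
    by (simp add: row_energy_eq integral_nonneg_AE)
  have int: "integrable (count_space UNIV) ?r"
    using row_energy_sum_finite by (intro integrableI_nonneg) (auto simp: r)
  then have abs: "Infinite_Set_Sum.abs_summable_on ?r UNIV"
    by (simp add: Infinite_Set_Sum.abs_summable_on_def)
  then have summable: "?r summable_on UNIV"
    using abs_summable_equivalent abs_summable_summable by blast
  have "(\<integral>\<^sup>+n. row_energy n \<partial>count_space UNIV) = ennreal (infsum ?r UNIV)"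
    using nn_integral_eq_integral[OF int] infsetsum_infsum[OF abs] by (simp add: r infsetsum_def)
  moreover have "0 \<le> infsum ?r UNIV"
    by (intro infsum_nonneg) simp
  moreover have "((\<lambda>k. (cmod (L2_inner F (gabor_system (haar_window c) a k)))\<^sup>2) has_sum infsum ?r UNIV) UNIV"
  proof -
    have "?f summable_on Sigma UNIV (\<lambda>_. UNIV)"
      by (rule summable_on_SigmaI[where g = ?r]) (use row_energy_has_sum summable in auto)
    then have "(?f has_sum infsum ?r UNIV) (Sigma UNIV (\<lambda>_. UNIV))"
      by (intro has_sum_SigmaI[where g = ?r]) (use row_energy_has_sum summable in auto)
    then have "((\<lambda>(m, n). ?f (n, m)) has_sum infsum ?r UNIV) (UNIV \<times> UNIV)"
      by (subst (asm) has_sum_swap)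
    then show ?thesis
      by (simp add: case_prod_unfold)
  qed
  ultimately show ?thesis
    using that by metis
qed

end

declare F_measurable [measurable del] row_measurable [measurable del]

lemma frame_if_no_good:
  assumes "\<And>p. \<not> good N p"
  shows "is_frame UNIV (gabor_system (haar_window c) a)"
  unfolding is_frame_def
proof (intro conjI ballI gabor_L2)
  \<comment> \<open>The factor 4 from \<open>second_difference_energy_le\<close> times the constant
    4 (12^N)^2 of the energy estimate.\<close>
  define C :: real where "C = 16 * (12 ^ N)\<^sup>2"
  have C: "C > 0"
    by (simp add: C_def)
  define B where "B = real (card steps) * overlap + 1"
  have overlap: "0 \<le> overlap"
    by (rule overlap_nonneg)
  then have B: "B > 0"
    by (simp add: B_def add_nonneg_pos)
  have "(\<lambda>k. (cmod (L2_inner f (gabor_system (haar_window c) a k)))\<^sup>2) summable_on UNIV \<and>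
      1 / C * (L2_norm f)\<^sup>2 \<le> (\<Sum>\<^sub>\<infinity>k\<in>UNIV. (cmod (L2_inner f (gabor_system (haar_window c) a k)))\<^sup>2) \<and>
      (\<Sum>\<^sub>\<infinity>k\<in>UNIV. (cmod (L2_inner f (gabor_system (haar_window c) a k)))\<^sup>2) \<le> B * (L2_norm f)\<^sup>2"
    if f: "f \<in> L2" for f
  proof -
    obtain s where s: "s \<ge> 0" "ennreal s = (\<integral>\<^sup>+n. row_energy f n \<partial>count_space UNIV)"
      "((\<lambda>k. (cmod (L2_inner f (gabor_system (haar_window c) a k)))\<^sup>2) has_sum s) UNIV"
      using gabor_has_sum[OF f] by blast
    have "ennreal ((L2_norm f)\<^sup>2) \<le> ennreal (4 * (12 ^ N)\<^sup>2) *
        (\<integral>\<^sup>+p. ennreal ((cmod (second_difference f p))\<^sup>2) \<partial>lborel)"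
      using energy_estimate[OF L2_measurable[OF f] _ assms] unfolding L2_nn_integral[OF f] by simp
    also have "\<dots> \<le> ennreal (4 * (12 ^ N)\<^sup>2) * (4 * ennreal s)"
      unfolding s(2) by (intro mult_left_mono second_difference_energy_le f) simp
    also have "4 * ennreal s = ennreal (4 * s)"
      using s(1) by (simp add: ennreal_mult)
    also have "ennreal (4 * (12 ^ N)\<^sup>2) * ennreal (4 * s) = ennreal (4 * (12 ^ N)\<^sup>2 * (4 * s))"
      using s(1) by (intro ennreal_mult[symmetric]) auto
    also have "4 * (12 ^ N)\<^sup>2 * (4 * s) = C * s"
      by (simp add: C_def)
    finally have lower: "(L2_norm f)\<^sup>2 \<le> C * s"
      using C s(1) by (simp add: ennreal_le_iff)
    have "ennreal s \<le> of_nat (card steps) * ennreal overlap * ennreal ((L2_norm f)\<^sup>2)"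
      using row_energy_sum_le[OF f] unfolding s(2) L2_nn_integral[OF f] .
    also have "\<dots> = ennreal (real (card steps) * overlap * (L2_norm f)\<^sup>2)"
      using overlap by (simp add: ennreal_mult ennreal_of_nat_eq_real_of_nat)
    finally have "s \<le> real (card steps) * overlap * (L2_norm f)\<^sup>2"
      using overlap by (simp add: ennreal_le_iff)
    also have "\<dots> \<le> B * (L2_norm f)\<^sup>2"
      by (intro mult_right_mono) (auto simp: B_def)
    finally have upper: "s \<le> B * (L2_norm f)\<^sup>2" .
    have sum: "(\<Sum>\<^sub>\<infinity>k\<in>UNIV. (cmod (L2_inner f (gabor_system (haar_window c) a k)))\<^sup>2) = s"
      using s(3) by (rule infsumI)
    show ?thesis
      unfolding sum using s(3) lower upper C by (auto simp: summable_on_def field_simps)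
  qed
  then show "\<exists>A B. 0 < A \<and> 0 < B \<and> (\<forall>f\<in>L2.
      (\<lambda>k. (cmod (L2_inner f (gabor_system (haar_window c) a k)))\<^sup>2) summable_on UNIV \<and>
      A * (L2_norm f)\<^sup>2 \<le> (\<Sum>\<^sub>\<infinity>k\<in>UNIV. (cmod (L2_inner f (gabor_system (haar_window c) a k)))\<^sup>2) \<and>
      (\<Sum>\<^sub>\<infinity>k\<in>UNIV. (cmod (L2_inner f (gabor_system (haar_window c) a k)))\<^sup>2) \<le> B * (L2_norm f)\<^sup>2)"
    using B C by (intro exI[of _ "1 / C"] exI[of _ B]) auto
qed auto

end

section \<open>Hop-closed sets obstruct the lower frame bound\<close>

locale haar_hop_closed = haar_gabor +
  fixes Q :: "real set" and p0 :: real
  assumes closed: "hop_closed Q" and p0: "p0 \<in> Q"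
begin

section \<open>Counting points of the invariant set in one coset of the integers\<close>

definition pt :: "int \<Rightarrow> real" where
  "pt j = p0 + of_int j"

definition J :: "int set" where
  "J = {j. pt j \<in> Q}"

definition window :: "real \<Rightarrow> real \<Rightarrow> int set" where
  "window lo hi = {j \<in> J. lo \<le> pt j \<and> pt j < hi}"

lemma pt_add: "pt (j + k) = pt j + of_int k"
  by (simp add: pt_def)

lemma zero_in_J: "0 \<in> J"
  using p0 by (simp add: J_def pt_def)

lemma hop_J:
  assumes "(u, w) \<in> hops" "j \<in> J"
  obtains k where "hop u w k (pt j)" "j + k \<in> J"
  using closed assms unfolding hop_closed_def J_def by (fastforce simp: pt_add)

lemma window_subset: "window lo hi \<subseteq> {\<lceil>lo - p0\<rceil>..\<lfloor>hi - p0\<rfloor>}"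
  by (auto simp: window_def pt_def le_floor_iff ceiling_le_iff)

lemma finite_window [simp]: "finite (window lo hi)"
  using window_subset by (rule finite_subset) simp

lemma card_window_le: "lo \<le> hi \<Longrightarrow> real (card (window lo hi)) \<le> hi - lo + 1"
  using card_mono[OF _ window_subset[of lo hi]] card_int_interval_le[of "lo - p0" "hi - p0"] by simp

lemma card_window_split:
  assumes "lo \<le> mid" "mid \<le> hi"
  shows "card (window lo hi) = card (window lo mid) + card (window mid hi)"
proof -
  have "window lo hi = window lo mid \<union> window mid hi"
    using assms by (auto simp: window_def)
  moreover have "window lo mid \<inter> window mid hi = {}"
    by (auto simp: window_def)
  ultimately show ?thesis
    by (simp add: card_Un_disjoint)
qed

lemma floor_iff_window: "\<lfloor>(pt j - w) / a\<rfloor> = n \<longleftrightarrow> of_int n * a + w \<le> pt j \<and> pt j < of_int n * a + w + a"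
proof -
  have "\<lfloor>(pt j - w) / a\<rfloor> = n \<longleftrightarrow> of_int n * a \<le> pt j - w \<and> pt j - w < (of_int n + 1) * a"
    by (simp only: floor_eq_iff pos_le_divide_eq[OF a_pos] pos_divide_less_eq[OF a_pos])
  then show ?thesis
    by (auto simp: distrib_right)
qed

lemma card_cell_le_1: "card (window x (x + a)) \<le> Suc 0"
proof -
  have "i = j" if "i \<in> window x (x + a)" "j \<in> window x (x + a)" for i j
  proof -
    have "\<bar>real_of_int i - real_of_int j\<bar> < 1"
      using that a_lt_1 by (auto simp: window_def pt_def)
    then show ?thesis
      by linarith
  qed
  then show ?thesis
    by (subst card_le_Suc0_iff_eq) auto
qed

text \<open>Both cells contain at most one point of \<open>J\<close>, so it suffices that one is
  nonempty exactly when the other is, which the hop and its inverse give.\<close>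

lemma card_cell_eq:
  assumes "(0, w) \<in> hops"
  shows "card (window (of_int n * a + w) (of_int n * a + w + a)) = card (window (of_int n * a) (of_int n * a + a))"
proof -
  let ?A = "window (of_int n * a) (of_int n * a + a)"
  let ?B = "window (of_int n * a + w) (of_int n * a + w + a)"
  have "?B \<noteq> {}" if ne: "?A \<noteq> {}"
  proof -
    obtain j where "j \<in> ?A"
      using ne by blast
    then have j: "j \<in> J" "\<lfloor>(pt j - 0) / a\<rfloor> = n"
      using floor_iff_window[of j 0 n] by (auto simp: window_def)
    then obtain k where "hop 0 w k (pt j)" "j + k \<in> J"
      using hop_J[OF assms] by blast
    then have "j + k \<in> ?B"
      using j floor_iff_window[of "j + k" w n] by (simp add: window_def hop_def pt_add)
    then show ?thesis
      by blast
  qed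
  moreover have "?A \<noteq> {}" if ne: "?B \<noteq> {}"
  proof -
    obtain j where "j \<in> ?B"
      using ne by blast
    then have j: "j \<in> J" "\<lfloor>(pt j - w) / a\<rfloor> = n"
      using floor_iff_window[of j w n] by (auto simp: window_def)
    then obtain k where "hop w 0 k (pt j)" "j + k \<in> J"
      using hop_J[OF hops_swap[OF assms]] by blast
    then have "j + k \<in> ?A"
      using j floor_iff_window[of "j + k" 0 n] by (simp add: window_def hop_def pt_add)
    then show ?thesis
      by blast
  qed
  ultimately have "card ?A = 0 \<longleftrightarrow> card ?B = 0"
    by auto
  then show ?thesis
    using card_cell_le_1[of "of_int n * a"] card_cell_le_1[of "of_int n * a + w"] by linarith
qed

text \<open>The points on which the window translated by na equals 1; \<open>behind\<close> counts
  those on which it equals -1. Their difference is the row sum of the indicator of \<open>Q\<close>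
  on the coset.\<close>

definition ahead :: "int \<Rightarrow> nat" where
  "ahead n = card (window (of_int n * a) (of_int n * a + c))"

definition behind :: "int \<Rightarrow> nat" where
  "behind n = card (window (of_int n * a - c) (of_int n * a))"

lemma hops_0: "(0, c) \<in> hops" "(0, - c) \<in> hops" "(c, 0) \<in> hops" "(- c, 0) \<in> hops"
  by (auto simp: hops_def)

lemma int_shift_invariant: "(\<And>n :: int. f (n + 1) = f n) \<Longrightarrow> f n = f 0"
  by (induction n rule: int_induct[where k = 0]) (simp, simp, metis diff_add_cancel)

text \<open>Advancing by \<open>a\<close> drops the cell at na and gains the cell at na + c, and the
  hop by \<open>c\<close> shows that these have equally many points.\<close>

lemma ahead_const: "ahead n = ahead 0"
proof (rule int_shift_invariant)
  fix n :: int
  let ?y = "of_int n * a"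
  have "card (window ?y (?y + c)) + card (window (?y + c) (?y + c + a)) =
      card (window ?y (?y + a)) + card (window (?y + a) (?y + c + a))"
    using card_window_split[of ?y "?y + c" "?y + c + a"] card_window_split[of ?y "?y + a" "?y + c + a"]
      a_pos c_gt_1 by simp
  then show "ahead (n + 1) = ahead n"
    using card_cell_eq[OF hops_0(1), of n] by (simp add: ahead_def algebra_simps)
qed

lemma behind_const: "behind n = behind 0"
proof (rule int_shift_invariant)
  fix n :: int
  let ?y = "of_int n * a"
  have "card (window (?y - c) ?y) + card (window ?y (?y + a)) =
      card (window (?y - c) (?y - c + a)) + card (window (?y - c + a) (?y + a))"
    using card_window_split[of "?y - c" ?y "?y + a"] card_window_split[of "?y - c" "?y - c + a" "?y + a"]
      a_pos c_gt_1 by simp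
  then show "behind (n + 1) = behind n"
    using card_cell_eq[OF hops_0(2), of n] by (simp add: behind_def algebra_simps)
qed

text \<open>The cell has length \<open>a < 1\<close>, so the integer point just below
  \<open>pt j\<close> lies to its left: the left end of the cell cuts the coset at the index
  \<open>j\<close>.\<close>

lemma pt_ge_iff:
  assumes "\<lfloor>(pt j - w) / a\<rfloor> = n" shows "of_int n * a + w \<le> pt i \<longleftrightarrow> j \<le> i"
proof
  assume *: "of_int n * a + w \<le> pt i"
  show "j \<le> i"
  proof (rule ccontr)
    assume "\<not> j \<le> i"
    then have "real_of_int i \<le> real_of_int j - 1"
      by simp
    then show False
      using * assms[unfolded floor_iff_window] a_lt_1 unfolding pt_def by linarith
  qed
next
  assume "j \<le> i"
  then have "pt j \<le> pt i"
    by (simp add: pt_def)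
  then show "of_int n * a + w \<le> pt i"
    using assms[unfolded floor_iff_window] by linarith
qed

text \<open>In the increasing enumeration of \<open>J\<close>, the hop by \<open>c\<close> therefore
  advances every point by the same number of places, although \<open>k\<close> varies with
  \<open>j\<close>.\<close>

lemma card_hop_ahead:
  assumes "hop 0 c k (pt j)" shows "card (J \<inter> {j..<j + k}) = ahead 0"
proof -
  define n where "n = \<lfloor>(pt j - 0) / a\<rfloor>"
  have "\<lfloor>(pt (j + k) - c) / a\<rfloor> = n"
    using assms by (simp add: hop_def pt_add n_def)
  then have "window (of_int n * a) (of_int n * a + c) = J \<inter> {j..<j + k}"
    using pt_ge_iff[of j 0 n] pt_ge_iff[of "j + k" c n] by (auto simp: window_def n_def not_le[symmetric])
  then show ?thesis
    using ahead_const[of n] by (simp add: ahead_def)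
qed

lemma card_hop_behind:
  assumes "hop 0 (- c) (- l) (pt j)" shows "card (J \<inter> {j - l..<j}) = behind 0"
proof -
  define n where "n = \<lfloor>(pt j - 0) / a\<rfloor>"
  have "\<lfloor>(pt (j - l) - (- c)) / a\<rfloor> = n"
    using assms pt_add[of j "- l"] by (simp add: hop_def n_def)
  then have "window (of_int n * a - c) (of_int n * a) = J \<inter> {j - l..<j}"
    using pt_ge_iff[of j 0 n] pt_ge_iff[of "j - l" "- c" n] by (auto simp: window_def n_def not_le[symmetric])
  then show ?thesis
    using behind_const[of n] by (simp add: behind_def)
qed

lemma hop_from:
  assumes "(0, w) \<in> hops" "i \<in> J"
  obtains j k where "j \<in> J" "i = j + k" "hop 0 w k (pt j)"
proof -
  obtain k where k: "hop w 0 k (pt i)" "i + k \<in> J"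
    using hop_J[OF hops_swap[OF assms(1)] assms(2)] .
  then have "hop 0 w (- k) (pt (i + k))"
    using hop_inverse[of w 0 k "pt i"] by (simp add: pt_add)
  then show ?thesis
    using that[of "i + k" "- k"] k(2) by simp
qed

section \<open>Equality of the forward and backward index shifts\<close>

definition pos :: "int \<Rightarrow> real" where
  "pos j = a * frac (pt j / a)"

lemma pos_bounds: "0 \<le> pos j" "pos j < a"
  using a_pos frac_lt_1[of "pt j / a"] by (simp_all add: pos_def)

lemma pos_eqI:
  assumes "pt j = of_int n * a + x" "0 \<le> x" "x < a" shows "pos j = x"
proof -
  have "\<lfloor>pt j / a\<rfloor> = n"
    using floor_iff_window[of j 0 n] assms by simp
  then show ?thesis
    using a_pos assms(1) by (simp add: pos_def frac_def right_diff_distrib)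
qed

lemma pt_eq_pos: "pt j = of_int \<lfloor>pt j / a\<rfloor> * a + pos j"
  using a_pos by (simp add: pos_def frac_def right_diff_distrib)

text \<open>Positions modulo \<open>a\<close> of consecutive integers differ by \<open>1 - a\<close> as long as they avoid an
  interval of length \<open>1/2\<close>, so they cannot avoid it forever.\<close>

lemma not_all_low:
  assumes "\<And>j. j \<in> J \<Longrightarrow> j + 1 \<in> J \<and> pos j < a - 1 / 2"
  shows False
proof -
  have "int m \<in> J \<and> pos (int m) = pos 0 + real m * (1 - a)" for m
  proof (induction m)
    case (Suc m)
    have low: "pos (int m) < a - 1 / 2" and J: "int m + 1 \<in> J"
      using assms Suc by blast+
    \<comment> \<open>The low bound forces a > 1/2 and pos + 1 - a < 1/2 < a, so the next integer
      point lies in the next cell at this position.\<close>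
    have "pos (int m + 1) = pos (int m) + (1 - a)"
    proof (rule pos_eqI)
      show "pt (int m + 1) = of_int (\<lfloor>pt (int m) / a\<rfloor> + 1) * a + (pos (int m) + (1 - a))"
        using pt_eq_pos[of "int m"] unfolding pt_add by (simp add: distrib_right)
    qed (use low pos_bounds[of "int m"] a_lt_1 in linarith)+
    then show ?case
      using Suc J by (simp add: distrib_right add.commute)
  qed (simp add: zero_in_J)
  then have "real m * (1 - a) < 1" for m
    using pos_bounds(2)[of "int m"] pos_bounds(1)[of 0] a_lt_1 by (smt (verit))
  moreover obtain m where "1 / (1 - a) < real m"
    using reals_Archimedean2 by blast
  ultimately show False
    using a_lt_1 by (metis less_asym pos_divide_less_eq diff_gt_0_iff_gt)
qed

lemma not_all_high:
  assumes "\<And>j. j \<in> J \<Longrightarrow> j - 1 \<in> J \<and> 1 / 2 \<le> pos j"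
  shows False
proof -
  have "- int m \<in> J \<and> pos (- int m) = pos 0 - real m * (1 - a)" for m
  proof (induction m)
    case (Suc m)
    have high: "1 / 2 \<le> pos (- int m)" and J: "- int m - 1 \<in> J"
      using assms Suc by blast+
    \<comment> \<open>Here 1/2 \<le> pos < a gives pos - (1 - a) \<ge> a - 1/2 > 0, so the previous
      integer point lies in the previous cell.\<close>
    have "pos (- int m - 1) = pos (- int m) - (1 - a)"
    proof (rule pos_eqI)
      show "pt (- int m - 1) = of_int (\<lfloor>pt (- int m) / a\<rfloor> - 1) * a + (pos (- int m) - (1 - a))"
        using pt_eq_pos[of "- int m"] pt_add[of "- int m" "- 1"] by (simp add: left_diff_distrib)
    qed (use high pos_bounds[of "- int m"] a_lt_1 in linarith)+
    moreover have "- int (Suc m) = - int m - 1"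
      by simp
    ultimately show ?case
      using Suc J by (simp only:) (simp add: distrib_right)
  qed (simp add: zero_in_J)
  then have "real m * (1 - a) < 1" for m
    using pos_bounds(1)[of "- int m"] pos_bounds(2)[of 0] a_lt_1 by (smt (verit))
  moreover obtain m where "1 / (1 - a) < real m"
    using reals_Archimedean2 by blast
  ultimately show False
    using a_lt_1 by (metis less_asym pos_divide_less_eq diff_gt_0_iff_gt)
qed

text \<open>The forward hop out of \<open>j\<close> and the backward hop out of its target span
  intervals with the same right end, so the one containing more points of \<open>J\<close> is
  longer.\<close>

lemma steps_order:
  assumes "hop 0 c k (pt j)" "hop 0 (- c) (- l) (pt (j + k))"
  shows "behind 0 < ahead 0 \<Longrightarrow> l < k" "ahead 0 < behind 0 \<Longrightarrow> k < l"
proof -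
  have A: "card (J \<inter> {j..<j + k}) = ahead 0" and B: "card (J \<inter> {j + k - l..<j + k}) = behind 0"
    using card_hop_ahead[OF assms(1)] card_hop_behind[OF assms(2)] .
  show "l < k" if "behind 0 < ahead 0"
  proof (rule ccontr)
    assume "\<not> l < k"
    then have "card (J \<inter> {j..<j + k}) \<le> card (J \<inter> {j + k - l..<j + k})"
      by (intro card_mono) auto
    then show False
      using that A B by simp
  qed
  show "k < l" if "ahead 0 < behind 0"
  proof (rule ccontr)
    assume "\<not> k < l"
    then have "card (J \<inter> {j + k - l..<j + k}) \<le> card (J \<inter> {j..<j + k})"
      by (intro card_mono) auto
    then show False
      using that A B by simp
  qed
qed

text \<open>Both lengths are \<lfloor>c\<rfloor> or \<lfloor>c\<rfloor> + 1, so a strict inequality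
  determines them, and a forward hop followed by a backward hop moves every index by 1 in a fixed
  direction. The domain conditions then bound all positions: if \<open>ahead\<close> is larger, by
  the minimum of a + frac c - 1 and a - frac c, which is at most their mean a - 1/2; otherwise from
  below by the maximum of frac c and 1 - frac c, at least 1/2.\<close>

lemma ahead_eq_behind: "ahead 0 = behind 0"
proof (rule ccontr)
  assume "ahead 0 \<noteq> behind 0"
  then consider "behind 0 < ahead 0" | "ahead 0 < behind 0"
    by linarith
  then show False
  proof cases
    case 1
    have *: "k = \<lfloor>c\<rfloor> + 1 \<and> l = \<lfloor>c\<rfloor>" if "hop 0 c k (pt j)" "hop 0 (- c) (- l) (pt (j + k))" for j k l
      using steps_order(1)[OF that 1] hop_c_cases[OF that(1)] hop_minus_c_cases[OF that(2)] by linarith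
    show False
    proof (rule not_all_low)
      fix j assume "j \<in> J"
      obtain k where k: "hop 0 c k (pt j)" "j + k \<in> J"
        using hop_J[OF hops_0(1) \<open>j \<in> J\<close>] .
      obtain l where l: "hop 0 (- c) l (pt (j + k))" "j + k + l \<in> J"
        using hop_J[OF hops_0(2) k(2)] .
      have kl: "k = \<lfloor>c\<rfloor> + 1" "l = - \<lfloor>c\<rfloor>"
        using *[OF k(1), of "- l"] l(1) by auto
      have "pos j < a + frac c - 1"
        using k(1) unfolding kl hop_floor_Suc_iff pos_def .
      moreover have "pos j < a - frac c"
      proof -
        \<comment> \<open>The length of a backward hop is determined only after a forward hop, so
          \<open>j\<close> is first presented as the target of one.\<close>
        obtain i k' where i: "i \<in> J" "j = i + k'" "hop 0 c k' (pt i)"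
          using hop_from[OF hops_0(1) \<open>j \<in> J\<close>] .
        obtain l' where l': "hop 0 (- c) l' (pt j)"
          using hop_J[OF hops_0(2) \<open>j \<in> J\<close>] .
        have "l' = - \<lfloor>c\<rfloor>"
          using *[OF i(3), of "- l'"] l' i(2) by auto
        then show ?thesis
          using l' hop_minus_floor_iff[of "pt j"] by (simp add: pos_def)
      qed
      ultimately show "j + 1 \<in> J \<and> pos j < a - 1 / 2"
        using l(2) kl by simp
    qed
  next
    case 2
    have *: "k = \<lfloor>c\<rfloor> \<and> l = \<lfloor>c\<rfloor> + 1" if "hop 0 c k (pt j)" "hop 0 (- c) (- l) (pt (j + k))" for j k l
      using steps_order(2)[OF that 2] hop_c_cases[OF that(1)] hop_minus_c_cases[OF that(2)] by linarith
    show False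
    proof (rule not_all_high)
      fix j assume "j \<in> J"
      obtain k where k: "hop 0 c k (pt j)" "j + k \<in> J"
        using hop_J[OF hops_0(1) \<open>j \<in> J\<close>] .
      obtain l where l: "hop 0 (- c) l (pt (j + k))" "j + k + l \<in> J"
        using hop_J[OF hops_0(2) k(2)] .
      have kl: "k = \<lfloor>c\<rfloor>" "l = - \<lfloor>c\<rfloor> - 1"
        using *[OF k(1), of "- l"] l(1) by auto
      have "frac c \<le> pos j"
        using k(1) unfolding kl hop_floor_iff pos_def .
      moreover have "1 - frac c \<le> pos j"
      proof -
        obtain i k' where i: "i \<in> J" "j = i + k'" "hop 0 c k' (pt i)"
          using hop_from[OF hops_0(1) \<open>j \<in> J\<close>] .
        obtain l' where l': "hop 0 (- c) l' (pt j)"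
          using hop_J[OF hops_0(2) \<open>j \<in> J\<close>] .
        have "l' = - \<lfloor>c\<rfloor> - 1"
          using *[OF i(3), of "- l'"] l' i(2) by auto
        then show ?thesis
          using l' hop_minus_floor_Suc_iff[of "pt j"] by (simp add: pos_def)
      qed
      ultimately show "j - 1 \<in> J \<and> 1 / 2 \<le> pos j"
        using l(2) kl by simp
    qed
  qed
qed

section \<open>Truncated indicators and boundary rows\<close>

lemma infinite_J: "infinite J"
proof
  assume fin: "finite J"
  obtain k where k: "hop 0 c k (pt (Max J))" "Max J + k \<in> J"
    using hop_J[OF hops_0(1) Max_in[OF fin]] zero_in_J by blast
  have "k > 0"
    using hop_c_cases[OF k(1)] c_gt_1 by auto
  moreover have "Max J + k \<le> Max J"
    using fin k(2) by (rule Max_ge)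
  ultimately show False
    by simp
qed

definition block :: "int \<Rightarrow> int set" where
  "block R = J \<inter> {- R..<R}"

definition weight :: "int \<Rightarrow> int \<Rightarrow> complex" where
  "weight R n = (\<Sum>j\<in>block R. H (pt j - of_int n * a))"

lemma finite_block [simp]: "finite (block R)"
  by (simp add: block_def)

lemma block_large: "\<exists>R. M \<le> card (block R)"
proof -
  obtain S where S: "S \<subseteq> J" "finite S" "card S = M"
    using infinite_arbitrarily_large[OF infinite_J] by metis
  obtain L where L: "\<And>j. j \<in> S \<Longrightarrow> \<bar>j\<bar> \<le> L"
    using finite_imageI[OF S(2), of abs] by (metis Max_ge imageI)
  have "S \<subseteq> block (L + 1)"
    using S(1) L by (force simp: block_def)
  then have "M \<le> card (block (L + 1))"
    using S(3) card_mono[OF finite_block] by blast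
  then show ?thesis ..
qed

lemma weight_eq:
  "weight R n = of_nat (card (block R \<inter> window (of_int n * a) (of_int n * a + c)))
     - of_nat (card (block R \<inter> window (of_int n * a - c) (of_int n * a)))"
proof -
  have "H (pt j - of_int n * a) = (if j \<in> window (of_int n * a) (of_int n * a + c) then 1 else 0)
      - (if j \<in> window (of_int n * a - c) (of_int n * a) then 1 else 0)" if "j \<in> block R" for j
    using that by (auto simp: haar_window_def indicator_def window_def block_def)
  then have "weight R n = (\<Sum>j\<in>block R. if j \<in> window (of_int n * a) (of_int n * a + c) then 1 else 0)
      - (\<Sum>j\<in>block R. if j \<in> window (of_int n * a - c) (of_int n * a) then 1 else 0)"
    unfolding weight_def sum_subtractf[symmetric] by (intro sum.cong) auto
  then show ?thesis
    by (simp add: sum.If_cases Int_def)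
qed

lemma weight_le: "cmod (weight R n) \<le> 2 * c + 2"
proof -
  let ?A = "window (of_int n * a) (of_int n * a + c)" and ?B = "window (of_int n * a - c) (of_int n * a)"
  have "cmod (weight R n) \<le> real (card (block R \<inter> ?A)) + real (card (block R \<inter> ?B))"
    unfolding weight_eq using norm_triangle_ineq4 by (metis norm_of_nat)
  also have "\<dots> \<le> real (card ?A) + real (card ?B)"
    by (intro add_mono of_nat_mono card_mono) auto
  also have "\<dots> \<le> 2 * c + 2"
    using card_window_le[of "of_int n * a" "of_int n * a + c"] card_window_le[of "of_int n * a - c" "of_int n * a"]
      c_gt_1 by simp
  finally show ?thesis .
qed

text \<open>The rows whose window meets or touches an end of the truncation interval; their number
  is bounded independently of \<open>R\<close>.\<close>

definition boundary :: "int \<Rightarrow> int set" where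
  "boundary R = {n. \<bar>of_int n * a - (p0 - of_int R)\<bar> \<le> c} \<union> {n. \<bar>of_int n * a - (p0 + of_int R)\<bar> \<le> c}"

text \<open>Away from the two ends, the window lies either inside the truncation interval, where the
  row sum is \<open>ahead\<close> minus \<open>behind\<close> and hence 0, or outside it, where no
  point is counted.\<close>

lemma weight_eq_0:
  assumes "n \<notin> boundary R" shows "weight R n = 0"
proof -
  let ?y = "of_int n * a"
  have block_iff: "j \<in> block R \<longleftrightarrow> j \<in> J \<and> p0 - of_int R \<le> pt j \<and> pt j < p0 + of_int R" for j
  proof -
    have "p0 - of_int R \<le> pt j \<longleftrightarrow> - R \<le> j" "pt j < p0 + of_int R \<longleftrightarrow> j < R"
      unfolding pt_def by linarith+
    then show ?thesis
      by (auto simp: block_def)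
  qed
  have "c < \<bar>?y - (p0 - of_int R)\<bar>" "c < \<bar>?y - (p0 + of_int R)\<bar>"
    using assms by (auto simp: boundary_def)
  then consider "p0 - of_int R \<le> ?y - c" "?y + c \<le> p0 + of_int R" | "?y + c \<le> p0 - of_int R" | "p0 + of_int R \<le> ?y - c"
    by linarith
  then show ?thesis
  proof cases
    case 1
    then have "block R \<inter> window ?y (?y + c) = window ?y (?y + c)" "block R \<inter> window (?y - c) ?y = window (?y - c) ?y"
      using c_gt_1 by (auto simp: block_iff window_def)
    then show ?thesis
      unfolding weight_eq using ahead_const[of n] behind_const[of n] ahead_eq_behind
      by (simp add: ahead_def behind_def)
  next
    case 2
    then have "block R \<inter> window ?y (?y + c) = {}" "block R \<inter> window (?y - c) ?y = {}"
      using c_gt_1 by (auto simp: block_iff window_def)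
    then show ?thesis
      unfolding weight_eq by simp
  next
    case 3
    then have "block R \<inter> window ?y (?y + c) = {}" "block R \<inter> window (?y - c) ?y = {}"
      using c_gt_1 by (auto simp: block_iff window_def)
    then show ?thesis
      unfolding weight_eq by simp
  qed
qed

lemma boundary_card: "finite (boundary R)" "real (card (boundary R)) \<le> 2 * (2 * c / a + 1)"
proof -
  have part: "finite {n. \<bar>of_int n * a - y\<bar> \<le> c} \<and> real (card {n. \<bar>of_int n * a - y\<bar> \<le> c}) \<le> 2 * c / a + 1" for y
  proof -
    have sub: "{n. \<bar>of_int n * a - y\<bar> \<le> c} \<subseteq> {\<lceil>(y - c) / a\<rceil>..\<lfloor>(y + c) / a\<rfloor>}"
      using a_pos by (auto simp: le_floor_iff ceiling_le_iff pos_le_divide_eq pos_divide_le_eq abs_le_iff)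
    have "real (card {n. \<bar>of_int n * a - y\<bar> \<le> c}) \<le> real (card {\<lceil>(y - c) / a\<rceil>..\<lfloor>(y + c) / a\<rfloor>})"
      using card_mono[OF _ sub] by simp
    also have "\<dots> \<le> (y + c) / a - (y - c) / a + 1"
      using a_pos c_gt_1 by (intro card_int_interval_le divide_right_mono) auto
    also have "\<dots> = 2 * c / a + 1"
      by (simp add: diff_divide_distrib[symmetric])
    finally show ?thesis
      using finite_subset[OF sub] by simp
  qed
  show "finite (boundary R)"
    unfolding boundary_def using part by blast
  have "real (card (boundary R)) \<le> real (card {n. \<bar>of_int n * a - (p0 - of_int R)\<bar> \<le> c}) +
      real (card {n. \<bar>of_int n * a - (p0 + of_int R)\<bar> \<le> c})"
    unfolding boundary_def of_nat_add[symmetric] by (intro of_nat_mono card_Un_le)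
  also have "\<dots> \<le> (2 * c / a + 1) + (2 * c / a + 1)"
    by (intro add_mono part[THEN conjunct2])
  finally show "real (card (boundary R)) \<le> 2 * (2 * c / a + 1)"
    by (simp only: mult_2)
qed

text \<open>Each pair of a point and a row has its own positive \<epsilon>, and the minimum over
  finitely many pairs works, since rows far from the block see no points.\<close>

lemma block_right_constant:
  obtains \<epsilon> where "0 < \<epsilon>" "\<epsilon> \<le> 1"
    "\<And>j n x. j \<in> block R \<Longrightarrow> x \<in> {0..<\<epsilon>} \<Longrightarrow> H (pt j + x - of_int n * a) = H (pt j - of_int n * a)"
proof -
  \<comment> \<open>For rows beyond \<open>N\<close> every block point is at distance at least c + 1
    from na; the extra 1 absorbs the shift by x < 1, so both window values vanish.\<close>
  define N where "N = \<lceil>(\<bar>p0\<bar> + \<bar>of_int R\<bar> + c + 1) / a\<rceil>"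
  define P where "P j n \<epsilon> \<longleftrightarrow> 0 < \<epsilon> \<and>
      (\<forall>x\<in>{0..<\<epsilon>}. H (pt j - of_int n * a + x) = H (pt j - of_int n * a))" for j n and \<epsilon> :: real
  have "\<exists>\<epsilon>. P j n \<epsilon>" for j n
    unfolding P_def using c_gt_1 by (intro haar_window_right_constant) simp
  then obtain e' where e': "\<And>j n. P j n (e' j n)"
    by metis
  define e where "e z = e' (fst z) (snd z)" for z
  have e: "0 < e (j, n)" "\<And>x. x \<in> {0..<e (j, n)} \<Longrightarrow> H (pt j - of_int n * a + x) = H (pt j - of_int n * a)" for j n
    using e'[of j n] by (simp_all add: P_def e_def)
  define \<epsilon> where "\<epsilon> = Min (insert 1 (e ` (block R \<times> {- N..N})))"
  have fin: "finite (insert 1 (e ` (block R \<times> {- N..N})))"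
    by simp
  show ?thesis
  proof (rule that[of \<epsilon>])
    show "0 < \<epsilon>"
      unfolding \<epsilon>_def using e(1) by (subst Min_gr_iff) auto
    show "\<epsilon> \<le> 1"
      unfolding \<epsilon>_def by (rule Min_le[OF fin]) simp
    fix j n x assume j: "j \<in> block R" and x: "x \<in> {0..<\<epsilon>}"
    show "H (pt j + x - of_int n * a) = H (pt j - of_int n * a)"
    proof (cases "n \<in> {- N..N}")
      case True
      have "\<epsilon> \<le> e (j, n)"
        unfolding \<epsilon>_def using j True by (intro Min_le[OF fin]) auto
      then have "x \<in> {0..<e (j, n)}"
        using x by simp
      then have "H (pt j - of_int n * a + x) = H (pt j - of_int n * a)"
        by (rule e(2))
      then show ?thesis
        by (simp add: algebra_simps)
    next
      case False
      let ?L = "\<bar>p0\<bar> + \<bar>of_int R\<bar> + c + 1"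
      have "?L / a \<le> of_int N"
        by (simp add: N_def)
      then have "?L \<le> of_int N * a"
        using a_pos by (simp add: pos_divide_le_eq)
      also have "\<dots> \<le> \<bar>of_int n\<bar> * a"
        using False a_pos by (intro mult_right_mono) auto
      finally have "?L \<le> \<bar>of_int n * a\<bar>"
        using a_pos by (simp add: abs_mult)
      moreover have "\<bar>real_of_int j\<bar> \<le> \<bar>of_int R\<bar>"
        using j by (auto simp: block_def)
      then have "\<bar>pt j\<bar> \<le> \<bar>p0\<bar> + \<bar>of_int R\<bar>"
        unfolding pt_def by linarith
      ultimately have "c + 1 \<le> \<bar>pt j - of_int n * a\<bar>"
        by linarith
      moreover have "0 \<le> x" "x < 1"
        using x \<open>\<epsilon> \<le> 1\<close> by auto
      ultimately have "pt j - of_int n * a \<notin> {- c..<c}" "pt j + x - of_int n * a \<notin> {- c..<c}"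
        by auto
      then show ?thesis
        by (simp only: haar_window_outside[of _ c] not_False_eq_True)
    qed
  qed
qed

section \<open>Thickened truncations as test functions\<close>

context
  fixes R :: int and \<epsilon> :: real
  assumes eps: "0 < \<epsilon>" "\<epsilon> \<le> 1"
    and eps_const: "\<And>j n x. j \<in> block R \<Longrightarrow> x \<in> {0..<\<epsilon>} \<Longrightarrow> H (pt j + x - of_int n * a) = H (pt j - of_int n * a)"
begin

definition bumps :: "real \<Rightarrow> complex" where
  "bumps x = (\<Sum>j\<in>block R. indicator {pt j..<pt j + \<epsilon>} x)"

lemma bumps_sq: "(cmod (bumps x))\<^sup>2 = (\<Sum>j\<in>block R. indicator {pt j..<pt j + \<epsilon>} x)"
proof (cases "\<exists>j\<in>block R. x \<in> {pt j..<pt j + \<epsilon>}")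
  case True
  then obtain j where j: "j \<in> block R" "x \<in> {pt j..<pt j + \<epsilon>}"
    by blast
  have "x \<in> {pt i..<pt i + \<epsilon>} \<longleftrightarrow> i = j" for i
  proof
    assume "x \<in> {pt i..<pt i + \<epsilon>}"
    then have "\<bar>real_of_int i - real_of_int j\<bar> < 1"
      using j(2) eps unfolding pt_def by auto
    then show "i = j"
      by linarith
  qed (use j in auto)
  then have "bumps x = (\<Sum>i\<in>block R. if i = j then 1 else 0)"
    "(\<Sum>i\<in>block R. indicator {pt i..<pt i + \<epsilon>} x) = (\<Sum>i\<in>block R. if i = j then 1 else 0 :: real)"
    unfolding bumps_def by (auto simp: indicator_def simp del: atLeastLessThan_iff intro!: sum.cong)
  then show ?thesis
    using j(1) by simp
next
  case False
  then have "bumps x = 0" "(\<Sum>j\<in>block R. indicator {pt j..<pt j + \<epsilon>} x) = (0 :: real)"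
    unfolding bumps_def by (auto simp: indicator_def simp del: atLeastLessThan_iff intro!: sum.neutral)
  then show ?thesis
    by simp
qed

lemma emeasure_interval: "emeasure lborel {y..<y + \<epsilon>} < \<infinity>"
  by (rule emeasure_bounded_finite) simp

lemma bumps_L2: "bumps \<in> L2" and bumps_norm: "(L2_norm bumps)\<^sup>2 = \<epsilon> * card (block R)"
proof -
  have int: "integrable lborel (indicator {pt j..<pt j + \<epsilon>} :: real \<Rightarrow> real)" for j
    using emeasure_interval by (intro integrable_real_indicator) auto
  have "integrable lborel (\<lambda>x. (cmod (bumps x))\<^sup>2)"
    unfolding bumps_sq using int by (intro Bochner_Integration.integrable_sum)
  moreover have "bumps \<in> borel_measurable borel"
    unfolding bumps_def[abs_def] by measurable
  ultimately show "bumps \<in> L2"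
    by (simp add: L2_def)
  have "(\<integral>x. (cmod (bumps x))\<^sup>2 \<partial>lborel) = (\<Sum>j\<in>block R. \<integral>x. indicator {pt j..<pt j + \<epsilon>} x \<partial>lborel)"
    unfolding bumps_sq using int by (intro Bochner_Integration.integral_sum)
  also have "\<dots> = \<epsilon> * card (block R)"
    using eps by simp
  finally show "(L2_norm bumps)\<^sup>2 = \<epsilon> * card (block R)"
    using eps by (simp add: L2_norm_def)
qed

text \<open>The window is constant on each bump, and the bumps are integer translates of one
  another, so they share the same exponential integral up to no phase at all. The coefficient
  factors into the row sum and a Fourier coefficient of a single short interval.\<close>

lemma bumps_coefficient:
  "cmod (L2_inner bumps (gabor_system (haar_window c) a (m, n))) =
    cmod (weight R n) * cmod (LINT x|unit_measure. indicator {0..<\<epsilon>} x * expi m x)"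
proof -
  let ?e = "\<integral>x. indicator {0..<\<epsilon>} x *\<^sub>R expi m x \<partial>lborel"
  have int: "integrable lborel (\<lambda>x. indicator {y..<y + \<epsilon>} x *\<^sub>R expi m x)" for y
  proof (rule Bochner_Integration.integrable_bound)
    show "integrable lborel (indicator {y..<y + \<epsilon>} :: real \<Rightarrow> real)"
      using emeasure_interval by (intro integrable_real_indicator) auto
  qed (auto simp: indicator_def)
  have piece: "(\<integral>x. indicator {pt j..<pt j + \<epsilon>} x *\<^sub>R expi m x \<partial>lborel) = expi m p0 * ?e" for j
  proof -
    have "(\<integral>x. indicator {pt j..<pt j + \<epsilon>} x *\<^sub>R expi m x \<partial>lborel) =
        (\<integral>x. indicator {pt j..<pt j + \<epsilon>} (x + pt j) *\<^sub>R expi m (x + pt j) \<partial>lborel)"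
      by (rule integral_lborel_shift[symmetric])
    also have "\<dots> = (\<integral>x. expi m p0 * (indicator {0..<\<epsilon>} x *\<^sub>R expi m x) \<partial>lborel)"
    proof (intro Bochner_Integration.integral_cong refl)
      fix x
      have "expi m (x + pt j) = expi m x * expi m p0"
        using expi_shift_int[of m "x + p0" j] by (simp add: pt_def expi_add_arg add.assoc)
      then show "indicator {pt j..<pt j + \<epsilon>} (x + pt j) *\<^sub>R expi m (x + pt j) =
          expi m p0 * (indicator {0..<\<epsilon>} x *\<^sub>R expi m x)"
        by (auto simp: indicator_def)
    qed
    also have "\<dots> = expi m p0 * ?e"
      by (rule integral_mult_right_zero)
    finally show ?thesis .
  qed
  have "cnj (exp (- 2 * of_real pi * \<i> * of_int m * of_real x)) = expi m x" for x
    by (simp add: expi_def cis_conv_exp exp_cnj mult_ac)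
  then have "L2_inner bumps (gabor_system (haar_window c) a (m, n)) =
      (\<integral>x. bumps x * (expi m x * H (x - of_int n * a)) \<partial>lborel)"
    unfolding L2_inner_def gabor_system_def by (simp add: cnj_haar_window)
  also have "\<dots> = (\<integral>x. (\<Sum>j\<in>block R. H (pt j - of_int n * a) * (indicator {pt j..<pt j + \<epsilon>} x *\<^sub>R expi m x)) \<partial>lborel)"
  proof (intro Bochner_Integration.integral_cong refl)
    fix x
    have "indicator {pt j..<pt j + \<epsilon>} x * (expi m x * H (x - of_int n * a)) =
        H (pt j - of_int n * a) * (indicator {pt j..<pt j + \<epsilon>} x *\<^sub>R expi m x)" if "j \<in> block R" for j
    proof (cases "x \<in> {pt j..<pt j + \<epsilon>}")
      case True
      then have "H (x - of_int n * a) = H (pt j - of_int n * a)"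
        using eps_const[OF that, of "x - pt j" n] by auto
      then show ?thesis
        using True by simp
    qed simp
    then show "bumps x * (expi m x * H (x - of_int n * a)) =
        (\<Sum>j\<in>block R. H (pt j - of_int n * a) * (indicator {pt j..<pt j + \<epsilon>} x *\<^sub>R expi m x))"
      unfolding bumps_def sum_distrib_right by (intro sum.cong) auto
  qed
  also have "\<dots> = (\<Sum>j\<in>block R. H (pt j - of_int n * a) * (expi m p0 * ?e))"
    by (simp only: Bochner_Integration.integral_sum[OF integrable_mult_right[OF int]]
        integral_mult_right_zero piece)
  also have "\<dots> = weight R n * (expi m p0 * ?e)"
    unfolding weight_def sum_distrib_right ..
  finally have "cmod (L2_inner bumps (gabor_system (haar_window c) a (m, n))) = cmod (weight R n) * cmod ?e"
    by (simp add: norm_mult)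
  moreover have "(LINT x|unit_measure. indicator {0..<\<epsilon>} x * expi m x) = ?e"
    unfolding unit_measure_def using eps
    by (subst integral_restrict_space) (auto intro!: Bochner_Integration.integral_cong simp: indicator_def)
  ultimately show ?thesis
    by simp
qed

lemma bumps_row_energy: "row_energy bumps n = ennreal ((cmod (weight R n))\<^sup>2 * \<epsilon>)"
proof -
  have meas: "(indicator {0..<\<epsilon>} :: real \<Rightarrow> complex) \<in> borel_measurable borel"
    by measurable
  have sq: "square_integrable (indicator {0..<\<epsilon>})"
    by (rule square_integrable_bounded[where B = 1]) (auto intro: borel_measurable_unit[OF meas] simp: indicator_def)
  have "(LINT x|unit_measure. (cmod (indicator {0..<\<epsilon>} x))\<^sup>2) = (\<integral>x. indicator {0..<\<epsilon>} x \<partial>lborel)"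
  proof -
    have "indicator {0..<1} x *\<^sub>R (cmod (indicator {0..<\<epsilon>} x))\<^sup>2 = (indicator {0..<\<epsilon>} x :: real)" for x :: real
      using eps by (cases "x \<in> {0..<\<epsilon>}") auto
    then show ?thesis
      unfolding unit_measure_def by (subst integral_restrict_space) simp_all
  qed
  also have "\<dots> = \<epsilon>"
    using eps by simp
  finally have "((\<lambda>m. (cmod (LINT x|unit_measure. indicator {0..<\<epsilon>} x * expi m x))\<^sup>2) has_sum \<epsilon>) UNIV"
    using parseval[OF meas sq] by simp
  then have "((\<lambda>m. (cmod (weight R n))\<^sup>2 * (cmod (LINT x|unit_measure. indicator {0..<\<epsilon>} x * expi m x))\<^sup>2) has_sum
      (cmod (weight R n))\<^sup>2 * \<epsilon>) UNIV"
    by (rule has_sum_cmult_right)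
  then have "((\<lambda>m. (cmod (L2_inner bumps (gabor_system (haar_window c) a (m, n))))\<^sup>2) has_sum
      (cmod (weight R n))\<^sup>2 * \<epsilon>) UNIV"
    unfolding bumps_coefficient power_mult_distrib .
  then have "enn2real (row_energy bumps n) = (cmod (weight R n))\<^sup>2 * \<epsilon>"
    using row_energy_has_sum[OF bumps_L2] by (rule has_sum_unique[rotated])
  then show ?thesis
    using row_energy_eq[OF bumps_L2, of n] by (metis enn2real_ennreal ennreal_enn2real ennreal_less_top)
qed

text \<open>Only boundary rows contribute, each with energy at most (2c + 2)^2 \<epsilon>; the bound
  depends on \<open>R\<close> only through \<epsilon>.\<close>

lemma bumps_coefficients_sum:
  assumes "((\<lambda>k. (cmod (L2_inner bumps (gabor_system (haar_window c) a k)))\<^sup>2) has_sum s) UNIV"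
  shows "s \<le> (2 * c + 2)\<^sup>2 * (2 * (2 * c / a + 1)) * \<epsilon>"
proof -
  obtain s' where s': "s' \<ge> 0" "ennreal s' = (\<integral>\<^sup>+n. row_energy bumps n \<partial>count_space UNIV)"
    "((\<lambda>k. (cmod (L2_inner bumps (gabor_system (haar_window c) a k)))\<^sup>2) has_sum s') UNIV"
    using gabor_has_sum[OF bumps_L2] by blast
  have "s = s'"
    using assms s'(3) by (rule has_sum_unique)
  have "ennreal s' = (\<Sum>n\<in>boundary R. row_energy bumps n)"
    unfolding s'(2) using boundary_card(1)
    by (intro nn_integral_count_space') (auto simp: bumps_row_energy weight_eq_0)
  also have "\<dots> = ennreal (\<Sum>n\<in>boundary R. (cmod (weight R n))\<^sup>2 * \<epsilon>)"
    unfolding bumps_row_energy using eps by (intro sum_ennreal) auto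
  finally have "s' = (\<Sum>n\<in>boundary R. (cmod (weight R n))\<^sup>2 * \<epsilon>)"
    using s'(1) eps by (subst (asm) ennreal_inj) (auto intro: sum_nonneg)
  also have "\<dots> \<le> (\<Sum>n\<in>boundary R. (2 * c + 2)\<^sup>2 * \<epsilon>)"
    using eps by (intro sum_mono mult_right_mono power_mono weight_le) auto
  also have "\<dots> = real (card (boundary R)) * ((2 * c + 2)\<^sup>2 * \<epsilon>)"
    by simp
  also have "\<dots> \<le> (2 * (2 * c / a + 1)) * ((2 * c + 2)\<^sup>2 * \<epsilon>)"
    using eps by (intro mult_right_mono boundary_card) auto
  finally show ?thesis
    unfolding \<open>s = s'\<close> by (simp only: mult_ac)
qed

end

text \<open>The norm square of the test function is \<epsilon> times the number of points in the
  block, which is unbounded in \<open>R\<close>, while the coefficient sum stays below a constant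
  times \<epsilon>. The factor \<epsilon> cancels, so it may depend on \<open>R\<close>.\<close>

lemma not_frame: "\<not> is_frame UNIV (gabor_system (haar_window c) a)"
proof
  assume "is_frame UNIV (gabor_system (haar_window c) a)"
  then obtain A where A: "A > 0"
    and frame: "\<And>f. f \<in> L2 \<Longrightarrow> (\<lambda>k. (cmod (L2_inner f (gabor_system (haar_window c) a k)))\<^sup>2) summable_on UNIV \<and>
      A * (L2_norm f)\<^sup>2 \<le> (\<Sum>\<^sub>\<infinity>k\<in>UNIV. (cmod (L2_inner f (gabor_system (haar_window c) a k)))\<^sup>2)"
    unfolding is_frame_def by blast
  let ?C = "(2 * c + 2)\<^sup>2 * (2 * (2 * c / a + 1))"
  obtain M :: nat where M: "?C / A < real M"
    using reals_Archimedean2 by blast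
  obtain R where R: "M \<le> card (block R)"
    using block_large by blast
  obtain \<epsilon> where eps: "0 < \<epsilon>" "\<epsilon> \<le> 1"
    "\<And>j n x. j \<in> block R \<Longrightarrow> x \<in> {0..<\<epsilon>} \<Longrightarrow> H (pt j + x - of_int n * a) = H (pt j - of_int n * a)"
    using block_right_constant by blast
  have "A * (L2_norm (bumps R \<epsilon>))\<^sup>2 \<le> ?C * \<epsilon>"
    using frame[OF bumps_L2[OF eps]] bumps_coefficients_sum[OF eps]
    by (meson has_sum_infsum order_trans)
  also have "(L2_norm (bumps R \<epsilon>))\<^sup>2 = \<epsilon> * real (card (block R))"
    by (rule bumps_norm[OF eps])
  finally have "A * real (card (block R)) * \<epsilon> \<le> ?C * \<epsilon>"
    by (simp only: mult_ac)
  then have "A * real (card (block R)) \<le> ?C"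
    using eps(1) by (rule mult_right_le_imp_le)
  moreover have "?C < A * real M"
    using M A by (simp add: pos_divide_less_eq mult.commute)
  moreover have "A * real M \<le> A * real (card (block R))"
    using R A by simp
  ultimately show False
    by linarith
qed

end

theorem theorem1p7:
  fixes a c x1 x2 \<alpha> :: real
  assumes "0 < a" and "a < 1" and "1 < c" and "c \<notin> \<nat>"
    and "x1 = max ((a + frac c - 1) / a) 0"
    and "x2 = min (frac c / a) 1"
    and "\<alpha> = (if x2 \<noteq> 1 then frac (of_int \<lfloor>c\<rfloor> / a) else frac (c / a))"
  shows "is_frame (UNIV :: (int \<times> int) set) (gabor_system (haar_window c) a)
           \<longleftrightarrow> sym_max_invariant_set \<alpha> x1 x2 = {}"
proof -
  interpret haar_gabor a c
    by unfold_locales (use assms in auto)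
  note nonempty_iff = sym_max_invariant_set_nonempty_iff[OF assms(5-7)]
  show ?thesis
  proof
    assume frame: "is_frame (UNIV :: (int \<times> int) set) (gabor_system (haar_window c) a)"
    show "sym_max_invariant_set \<alpha> x1 x2 = {}"
    proof (rule ccontr)
      assume "sym_max_invariant_set \<alpha> x1 x2 \<noteq> {}"
      then obtain Q p where "hop_closed Q" "p \<in> Q"
        unfolding nonempty_iff by blast
      then interpret haar_hop_closed a c Q p
        by unfold_locales
      show False
        using not_frame frame by blast
    qed
  next
    assume "sym_max_invariant_set \<alpha> x1 x2 = {}"
    then have "Q = {}" if "hop_closed Q" "\<And>p n. p + of_int n * a \<in> Q \<longleftrightarrow> p \<in> Q" for Q
      using nonempty_iff that by blast
    then obtain N where "\<And>p. \<not> good N p"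
      using hop_closed_good_bound by blast
    then show "is_frame (UNIV :: (int \<times> int) set) (gabor_system (haar_window c) a)"
      by (rule frame_if_no_good)
  qed
qed

end
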